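(* Assume the setting in the context with $\Phi$ a standard Gaussian matrix and $p\ge2$. Then, for both the spectral and Frobenius norm, $$\mathbb E\|A-QQ^TA\|_{2,F}\le(1+C\delta_k^{2q+1})\|\Sigma_\perp\|_{2,F},\qquad \mathbb E\|A-APP^T\|_{2,F}\le(1+C\delta_k^{2q})\|\Sigma_\perp\|_{2,F}.$$
   Context: Let $A\in\mathbb R^{m\times n}$ with $m\ge n$ have full SVD $A=U\Sigma V^T$, with singular values $\sigma_1\ge\sigma_2\ge\dots\ge\sigma_n\ge 0$. Fix an integer $k\ge1$ with $\sigma_k>0$ (the paper regards $A$ as having numerical rank $k$, i.e. $\sigma_k$ well separated from $\sigma_{k+1}$). Write $U=[U_k\ U_\perp]$ with $U_k\in\mathbb R^{m\times k}$ the first $k$ left singular vectors $u_1,\dots,u_k$, $U_\perp\in\mathbb R^{m\times(m-k)}$ the rest; $V=[V_k\ V_\perp]$ with $V_k\in\mathbb R^{n\times k}$ the first $k$ right singular vectors $v_1,\dots,v_k$; $\Sigma_k=\mathrm{diag}(\sigma_1,\dots,\sigma_k)$ and $\Sigma_\perp$ the remaining diagonal block of $\Sigma$ containing $\sigma_{k+1},\dots,\sigma_n$ (so $\|\Sigma_\perp\|_2=\sigma_{k+1}$, $\|\Sigma_\perp\|_F=(\sum_{i>k}\sigma_i^2)^{1/2}$). The notation $\|\cdot\|_{2,F}$ means the statement holds for both the spectral and Frobenius norm. Let $p\ge1$ be an oversampling integer, $d=k+p<n$, and $q\ge0$ an integer (power-iteration parameter). RU-QLP (Randomized Unpivoted QLP):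 given $\Phi\in\mathbb R^{m\times d}$, let $\bar P\in\mathbb R^{n\times d}$ have orthonormal columns spanning the range of $(A^TA)^qA^T\Phi$ (assumed of rank $d$); compute the thin unpivoted QR factorization $A\bar P=QR$ with $Q\in\mathbb R^{m\times d}$ having orthonormal columns and $R\in\mathbb R^{d\times d}$ upper triangular; compute the thin unpivoted QR factorization $R^T=\widetilde P\widetilde R$; set $P=\bar P\widetilde P\in\mathbb R^{n\times d}$ and $L=\widetilde R^T$ (lower triangular), giving $\hat A=QLP^T$. Partition $R=\begin{bmatrix}R_{11}&R_{12}\\0&R_{22}\end{bmatrix}$ and $L=\begin{bmatrix}L_{11}&0\\L_{21}&L_{22}\end{bmatrix}$ with $R_{11},L_{11}\in\mathbb R^{k\times k}$. Define $\widehat\Phi_1=U_k^T\Phi\in\mathbb R^{k\times d}$ and $\widehat\Phi_2=U_\perp^T\Phi\in\mathbb R^{(m-k)\times d}$, assume $\widehat\Phi_1$ has rank $k$, and let $\dagger$ denote the Moore–Penrose inverse. Set $\delta_i=\sigma_{k+1}/\sigma_i$ for $i=1,\dots,k$ and $\gamma=\sigma_n/\sigma_1$. Probabilistic setting: $\Phi\in\mathbb R^{m\times d}$ has i.i.d. standard normal entries (so $\widehat\Phi_1,\widehat\Phi_2$ are independent standard Gaussian matrices, and the rank assumptions hold almost surely); $\mathbb E$ denotes expectation over $\Phi$. Define $\omega_1=\sqrt{m-k}+\sqrt{k+p}+7$, $\omega_2=\frac{4e\sqrt{k+p}}{p+1}$, $\omega=\omega_1\omega_2$, and $C=\sqrt{\frac{k}{p-1}}+\frac{e\sqrt{(m-k)(k+p)}}{p}$,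 where $e$ is Euler's number. *)

theory Defs
  imports "HOL-Probability.Probability" "Jordan_Normal_Form.Matrix"
begin

definition vnorm2 :: "real vec \<Rightarrow> real" where
  "vnorm2 v = sqrt (v \<bullet> v)"

definition spec_norm :: "real mat \<Rightarrow> real" where
  "spec_norm A = Sup {vnorm2 (A *\<^sub>v x) | x. x \<in> carrier_vec (dim_col A) \<and> vnorm2 x = 1}"

definition frob_norm :: "real mat \<Rightarrow> real" where
  "frob_norm A = sqrt (\<Sum>i<dim_row A. \<Sum>j<dim_col A. (A $$ (i,j))\<^sup>2)"

definition orthonormal_cols :: "real mat \<Rightarrow> bool" where
  "orthonormal_cols Q \<longleftrightarrow> transpose_mat Q * Q = 1\<^sub>m (dim_col Q)"

definition col_space :: "real mat \<Rightarrow> real vec set" where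
  "col_space B = {B *\<^sub>v x | x. x \<in> carrier_vec (dim_col B)}"

(* The RU-QLP relations for input A, power parameter q and test matrix Phi:
   Pbar has orthonormal columns spanning range((A^T A)^q A^T Phi) (hence that matrix has rank d),
   A Pbar = Q R thin unpivoted QR, R^T = Ptil Rtil thin unpivoted QR, P = Pbar Ptil, L = Rtil^T. *)
definition ru_qlp ::
  "real mat \<Rightarrow> nat \<Rightarrow> real mat \<Rightarrow> real mat \<Rightarrow> real mat \<Rightarrow> real mat \<Rightarrow> real mat \<Rightarrow> real mat
   \<Rightarrow> real mat \<Rightarrow> real mat \<Rightarrow> bool" where
  "ru_qlp A q Phi Pbar Q R Ptil Rtil P L \<longleftrightarrow>
    (let m = dim_row A; n = dim_col A; d = dim_col Phi;
         Y = (transpose_mat A * A) ^\<^sub>m q * transpose_mat A * Phi in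
      Pbar \<in> carrier_mat n d \<and> orthonormal_cols Pbar \<and> col_space Pbar = col_space Y \<and>
      Q \<in> carrier_mat m d \<and> orthonormal_cols Q \<and>
      R \<in> carrier_mat d d \<and> upper_triangular R \<and> A * Pbar = Q * R \<and>
      Ptil \<in> carrier_mat d d \<and> orthonormal_cols Ptil \<and>
      Rtil \<in> carrier_mat d d \<and> upper_triangular Rtil \<and> transpose_mat R = Ptil * Rtil \<and>
      P = Pbar * Ptil \<and> L = transpose_mat Rtil)"

definition gauss_space :: "nat \<Rightarrow> nat \<Rightarrow> ((nat \<times> nat) \<Rightarrow> real) measure" where
  "gauss_space m d = PiM ({0..<m} \<times> {0..<d}) (\<lambda>_. density lborel std_normal_density)"

definition gauss_mat :: "nat \<Rightarrow> nat \<Rightarrow> ((nat \<times> nat) \<Rightarrow> real) \<Rightarrow> real mat" where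
  "gauss_mat m d \<omega> = mat m d (\<lambda>ij. \<omega> ij)"

end

theory Submission
  imports Defs "Jordan_Normal_Form.Determinant"
begin

text \<open>Write \<open>\<Phi>\<^sub>1 = U\<^sub>k\<^sup>T \<Phi>\<close>, \<open>\<Phi>\<^sub>2 = U\<^sub>\<bottom>\<^sup>T \<Phi>\<close> and let \<open>T\<close> be the pseudoinverse of \<open>\<Phi>\<^sub>1\<close>. The columns of \<open>Q\<close> span
  the range of \<open>(A A\<^sup>T)\<^sup>q\<^sup>+\<^sup>1 \<Phi>\<close> and those of \<open>P\<close> the range of \<open>(A\<^sup>T A)\<^sup>q A\<^sup>T \<Phi>\<close>. Comparing the
  projection of \<open>A x\<close> (or \<open>A\<^sup>T x\<close>) with the element of that range that has the same leading \<open>k\<close>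
  singular coordinates bounds both residuals in terms of \<open>X = \<Phi>\<^sub>2 T\<close>. It remains to bound the
  expected spectral norm of \<open>X\<close> by \<open>C\<close> and the expected Frobenius norm of \<open>S X\<close> by \<open>C\<close> times that of
  \<open>S\<close>, for diagonal \<open>S\<close>.

  The norm of \<open>X\<close> is bounded by a moment method, which replaces both Chevet's inequality and the tail
  bound for the smallest singular value of \<open>\<Phi>\<^sub>1\<close>. If \<open>g\<close> is a standard Gaussian vector and \<open>u\<close> a unit
  vector, then \<open>\<bar>X g\<bar> \<ge> \<bar>u \<bullet> X g\<bar>\<close>, and taking moments of order \<open>2 s\<close> over \<open>g\<close> shows that
  \<open>\<parallel>X\<parallel>\<^sup>2\<^sup>s \<Prod>j<s. (1 + 2 * j)\<close> is at most the moment of \<open>\<bar>X g\<bar>\<close>. By rotation invariance \<open>\<bar>X g\<bar>\<close> is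
  a product of independent \<open>\<chi>\<close> variables with \<open>k\<close> and \<open>m - k\<close> degrees of freedom, divided by one with
  \<open>p + 1\<close> degrees of freedom. So the moment of \<open>\<parallel>X\<parallel>\<close> of order \<open>2 s\<close> is at most
  \<open>\<Prod>j<s. (k + 2 * j) * (m - k + 2 * j) / ((1 + 2 * j) * (p - 1 - 2 * j))\<close>,
  and this is at most \<open>C\<^sup>2\<^sup>s\<close> for a suitable \<open>s \<le> p / 2\<close>.\<close>

section \<open>Rotation invariance of the Gaussian measure\<close>

text \<open>The factors \<open>Q\<close>, \<open>P\<close> and the others are arbitrary functions of
  the sample, tied to it only almost everywhere by \<open>ru_qlp\<close>, so the residual norms may
  fail to be measurable. They are compared pointwise with measurable majorants, and only these are
  integrated, in \<open>ennreal\<close>, where Tonelli asks for no integrability. This also favours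
  the moment method: averaging over \<open>g\<close> gives an integral of a jointly measurable
  function instead of a supremum over uncountably many vectors.

  As for the constant, the product of all \<open>1 + 2 * j\<close> and \<open>p - 1 - 2 * j\<close>
  resembles a factorial and is at least \<open>(p / e)\<^sup>2\<^sup>s\<close>, which produces the
  \<open>e / p\<close> in the second summand of \<open>C\<close>. The square of the first summand
  bounds the second moment of the Frobenius norm of \<open>T\<close>, and this summand alone settles
  the Frobenius norm. In the spectral case it pays, through the cross term of
  \<open>C\<^sup>2\<close>, for the surplus of \<open>(k + s - 1) * (m - k + s - 1)\<close> over
  \<open>(m - k) * (k + p)\<close>.\<close>

abbreviation std_normal :: "real measure" where
  "std_normal \<equiv> density lborel std_normal_density"

abbreviation borels :: "'i set \<Rightarrow> ('i \<Rightarrow> real) measure" where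
  "borels I \<equiv> PiM I (\<lambda>_. borel)"

abbreviation lborels :: "'i set \<Rightarrow> ('i \<Rightarrow> real) measure" where
  "lborels I \<equiv> PiM I (\<lambda>_. lborel)"

text \<open>A general index set makes vectors, single rows, blocks of rows and whole matrices
  instances of one measure, so that conditioning on some rows is a splitting of the index
  set.\<close>

definition gauss :: "'i set \<Rightarrow> ('i \<Rightarrow> real) measure" where
  "gauss I = PiM I (\<lambda>_. std_normal)"

lemma prob_space_std_normal: "prob_space std_normal"
  by (rule prob_space_normal_density) simp

interpretation lb: product_sigma_finite "\<lambda>_ :: 'i. lborel :: real measure"
  by standard

interpretation sn: product_sigma_finite "\<lambda>_ :: 'i. std_normal"
  by (intro product_sigma_finite.intro prob_space_imp_sigma_finite prob_space_std_normal)

lemma prob_space_gauss: "prob_space (gauss I)"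
  unfolding gauss_def by (rule prob_space_PiM) (rule prob_space_std_normal)

lemma sets_gauss [measurable_cong]: "sets (gauss I) = sets (borels I)"
  unfolding gauss_def by (rule sets_PiM_cong) auto

lemma sets_PiM_lborel [measurable_cong]:
  "sets (lborels I) = sets (borels I)"
  by (rule sets_PiM_cong) auto

lemma space_gauss: "space (gauss I) = PiE I (\<lambda>_. UNIV)"
  by (simp add: gauss_def space_PiM)

lemma measurable_gauss_eq: "borel_measurable (gauss I) = borel_measurable (borels I)"
  by (rule measurable_cong_sets) (simp_all add: sets_gauss)

text \<open>Passing to Lebesgue measure splits rotation invariance in two: that of Lebesgue measure,
  and that of the density.\<close>

lemma nn_integral_gauss_lborel:
  assumes "finite I" and "f \<in> borel_measurable (borels I)"
  shows "(\<integral>\<^sup>+x. f x \<partial>gauss I) =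
    (\<integral>\<^sup>+x. f x * (\<Prod>i\<in>I. ennreal (std_normal_density (x i))) \<partial>lborels I)"
  using assms
proof (induction I arbitrary: f rule: finite_induct)
  case empty
  show ?case by (simp add: gauss_def PiM_empty nn_integral_count_space_finite)
next
  case (insert i I)
  note [measurable] = insert.prems
  have fm: "f \<in> borel_measurable (PiM (insert i I) (\<lambda>_. std_normal))"
    by measurable
  have "(\<integral>\<^sup>+x. f x \<partial>gauss (insert i I)) =
      (\<integral>\<^sup>+y. \<integral>\<^sup>+x. f (x(i := y)) \<partial>gauss I \<partial>std_normal)"
    unfolding gauss_def by (rule sn.product_nn_integral_insert_rev[OF insert(1,2) fm])
  also have "\<dots> = (\<integral>\<^sup>+y. (\<integral>\<^sup>+x. f (x(i := y)) * (\<Prod>i\<in>I. ennreal (std_normal_density (x i)))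
       \<partial>lborels I) \<partial>std_normal)"
    by (intro nn_integral_cong insert.IH) measurable
  also have "\<dots> = (\<integral>\<^sup>+y. ennreal (std_normal_density y) * (\<integral>\<^sup>+x. f (x(i := y)) * (\<Prod>i\<in>I. ennreal (std_normal_density (x i)))
       \<partial>lborels I) \<partial>lborel)"
  proof (rule nn_integral_density)
    interpret s: sigma_finite_measure "lborels I"
      by (rule lb.sigma_finite[OF insert(1)])
    show "(\<lambda>y. \<integral>\<^sup>+x. f (x(i := y)) * (\<Prod>i\<in>I. ennreal (std_normal_density (x i)))
       \<partial>lborels I) \<in> borel_measurable lborel"
      by measurable
  qed simp
  also have "\<dots> = (\<integral>\<^sup>+y. (\<integral>\<^sup>+x. ennreal (std_normal_density y) * (f (x(i := y)) * (\<Prod>i\<in>I. ennreal (std_normal_density (x i))))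
       \<partial>lborels I) \<partial>lborel)"
    by (intro nn_integral_cong nn_integral_cmult[symmetric]) measurable
  also have "\<dots> = (\<integral>\<^sup>+y. (\<integral>\<^sup>+x. f (x(i := y)) * (\<Prod>j\<in>insert i I. ennreal (std_normal_density ((x(i:=y)) j)))
       \<partial>lborels I) \<partial>lborel)"
  proof (intro nn_integral_cong)
    fix y :: real and x :: "'a \<Rightarrow> real"
    have "(\<Prod>j\<in>I. ennreal (std_normal_density (if j = i then y else x j))) = (\<Prod>j\<in>I. ennreal (std_normal_density (x j)))"
      using insert(2) by (intro prod.cong) auto
    then show "ennreal (std_normal_density y) * (f (x(i := y)) * (\<Prod>i\<in>I. ennreal (std_normal_density (x i)))) =
      f (x(i := y)) * (\<Prod>j\<in>insert i I. ennreal (std_normal_density ((x(i:=y)) j)))"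
      using insert(1,2) by (simp add: ac_simps)
  qed
  also have "\<dots> = (\<integral>\<^sup>+x. f x * (\<Prod>j\<in>insert i I. ennreal (std_normal_density (x j))) \<partial>lborels (insert i I))"
    by (rule lb.product_nn_integral_insert_rev[OF insert(1,2), symmetric]) measurable
  finally show ?case .
qed

lemma nn_integral_PiM_lborel_translate:
  assumes "finite I" and "f \<in> borel_measurable (borels I)"
  shows "(\<integral>\<^sup>+x. f (\<lambda>i\<in>I. x i + c i) \<partial>lborels I) = (\<integral>\<^sup>+x. f x \<partial>lborels I)"
  using assms
proof (induction I arbitrary: f rule: finite_induct)
  case empty
  show ?case by (simp add: PiM_empty nn_integral_count_space_finite restrict_def)
next
  case (insert i I)
  note [measurable] = insert.prems
  have "(\<integral>\<^sup>+x. f (\<lambda>i\<in>insert i I. x i + c i) \<partial>lborels (insert i I)) =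
     (\<integral>\<^sup>+y. \<integral>\<^sup>+x. f (\<lambda>j\<in>insert i I. (x(i:=y)) j + c j) \<partial>lborels I \<partial>lborel)"
    by (rule lb.product_nn_integral_insert_rev[OF insert(1,2)]) measurable
  also have "\<dots> = (\<integral>\<^sup>+y. \<integral>\<^sup>+x. f ((\<lambda>i\<in>I. x i + c i)(i := y + c i)) \<partial>lborels I \<partial>lborel)"
    using insert(2) by (intro nn_integral_cong arg_cong[of _ _ f]) (auto simp: fun_eq_iff)
  also have "\<dots> = (\<integral>\<^sup>+y. \<integral>\<^sup>+x. f (x(i := y + c i)) \<partial>lborels I \<partial>lborel)"
    by (intro nn_integral_cong insert.IH) measurable
  also have "\<dots> = (\<integral>\<^sup>+y. \<integral>\<^sup>+x. f (x(i := y)) \<partial>lborels I \<partial>lborel)"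
  proof -
    interpret s: sigma_finite_measure "lborels I"
      by (rule lb.sigma_finite[OF insert(1)])
    have [measurable]: "(\<lambda>y. \<integral>\<^sup>+x. f (x(i := y)) \<partial>lborels I) \<in> borel_measurable borel"
      by measurable
    show ?thesis
      using nn_integral_real_affine[of "\<lambda>y. \<integral>\<^sup>+x. f (x(i := y)) \<partial>lborels I" 1 "c i"]
      by (simp add: add.commute)
  qed
  also have "\<dots> = (\<integral>\<^sup>+x. f x \<partial>lborels (insert i I))"
    by (rule lb.product_nn_integral_insert_rev[OF insert(1,2), symmetric]) measurable
  finally show ?case .
qed

text \<open>The Householder reflection \<open>1 - 2 v v\<^sup>T\<close>, an isometry once
  \<open>v\<close> is a unit vector on \<open>I\<close>. The restriction to \<open>I\<close> keeps
  the values in the extensional functions that form the space of the product measure.\<close>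

definition reflect :: "'i set \<Rightarrow> ('i \<Rightarrow> real) \<Rightarrow> ('i \<Rightarrow> real) \<Rightarrow> 'i \<Rightarrow> real" where
  "reflect I v x = (\<lambda>i\<in>I. x i - 2 * (\<Sum>j\<in>I. v j * x j) * v i)"

lemma measurable_reflect [measurable]:
  "reflect I v \<in> measurable (borels I) (borels I)"
  unfolding reflect_def by measurable

lemma sum_mult_reflect:
  assumes "finite I" and "(\<Sum>i\<in>I. (v i)\<^sup>2) = 1"
  shows "(\<Sum>i\<in>I. reflect I v x i * reflect I v y i) = (\<Sum>i\<in>I. x i * y i)"
proof -
  let ?a = "\<Sum>j\<in>I. v j * x j" and ?b = "\<Sum>j\<in>I. v j * y j"
  have "(\<Sum>i\<in>I. reflect I v x i * reflect I v y i) =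
      (\<Sum>i\<in>I. x i * y i - 2 * ?b * (v i * x i) - 2 * ?a * (v i * y i) + 4 * ?a * ?b * (v i)\<^sup>2)"
    by (intro sum.cong) (auto simp: reflect_def algebra_simps power2_eq_square)
  also have "\<dots> = (\<Sum>i\<in>I. x i * y i) - 2 * ?b * ?a - 2 * ?a * ?b + 4 * ?a * ?b * (\<Sum>i\<in>I. (v i)\<^sup>2)"
    by (simp add: sum.distrib sum_subtractf sum_distrib_left)
  also have "\<dots> = (\<Sum>i\<in>I. x i * y i)"
    using assms(2) by simp
  finally show ?thesis .
qed

lemma sum_mult_reflect_self:
  assumes "(\<Sum>i\<in>I. (v i)\<^sup>2) = 1"
  shows "(\<Sum>i\<in>I. v i * reflect I v x i) = - (\<Sum>i\<in>I. v i * x i)"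
proof -
  let ?a = "\<Sum>j\<in>I. v j * x j"
  have "(\<Sum>i\<in>I. v i * reflect I v x i) = (\<Sum>i\<in>I. v i * x i - 2 * ?a * (v i)\<^sup>2)"
    by (intro sum.cong) (auto simp: reflect_def algebra_simps power2_eq_square)
  also have "\<dots> = ?a - 2 * ?a * (\<Sum>i\<in>I. (v i)\<^sup>2)"
    by (simp add: sum_subtractf sum_distrib_left)
  finally show ?thesis using assms by simp
qed

lemma reflect_reflect:
  assumes "(\<Sum>i\<in>I. (v i)\<^sup>2) = 1"
  shows "reflect I v (reflect I v x) = restrict x I"
  unfolding reflect_def[of I v "reflect I v x"] sum_mult_reflect_self[OF assms]
  by (auto simp: reflect_def)

text \<open>With a coordinate \<open>i0\<close> of \<open>x\<close> traded for \<open>t = \<Sum>i. v i * x i\<close>, the reflection becomes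
  \<open>t \<mapsto> - t\<close> together with a translation of the remaining coordinates by \<open>- 2 * t * v\<close>.\<close>

lemma nn_integral_PiM_lborel_reflect:
  fixes h :: "('i \<Rightarrow> real) \<Rightarrow> ennreal"
  assumes fin: "finite I" and v: "(\<Sum>i\<in>I. (v i)\<^sup>2) = 1"
    and h [measurable]: "h \<in> borel_measurable (borels I)"
  shows "(\<integral>\<^sup>+x. h (reflect I v x) \<partial>lborels I) = (\<integral>\<^sup>+x. h x \<partial>lborels I)"
proof -
  obtain i0 where i0: "i0 \<in> I" "v i0 \<noteq> 0"
    using v by (metis (no_types, lifting) power_zero_numeral sum.neutral zero_neq_one)
  define J where "J = I - {i0}"
  have I: "I = insert i0 J" "i0 \<notin> J" "finite J"
    using i0 fin by (auto simp: J_def)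
  define w where "w = v i0"
  have w: "w \<noteq> 0" using i0 by (simp add: w_def)
  define dot where "dot y = (\<Sum>j\<in>J. v j * y j)" for y
  have [measurable]: "dot \<in> borel_measurable (borels J)"
    unfolding dot_def by measurable
  interpret s: sigma_finite_measure "lborels J"
    by (rule lb.sigma_finite[OF I(3)])
  interpret ps: pair_sigma_finite "lborels J" "lborel :: real measure"
    by standard
  \<comment> \<open>With \<open>s\<close> the coordinate at \<open>i0\<close>,
    \<open>t = dot y + w * s\<close>, so the substitution contributes the factor
    \<open>1 / \<bar>w\<bar>\<close>, the same before and after the reflection.\<close>
  have subst: "(\<integral>\<^sup>+x. g x \<partial>lborels I) =
      ennreal \<bar>1/w\<bar> * (\<integral>\<^sup>+t. (\<integral>\<^sup>+y. g (y(i0 := (t - dot y) / w)) \<partial>lborels J) \<partial>lborel)"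
    if [measurable]: "g \<in> borel_measurable (borels I)" for g :: "('i \<Rightarrow> real) \<Rightarrow> ennreal"
  proof -
    have [measurable]: "g \<in> borel_measurable (borels (insert i0 J))"
      using that I by simp
    have "(\<integral>\<^sup>+x. g x \<partial>lborels I) = (\<integral>\<^sup>+y. \<integral>\<^sup>+s. g (y(i0 := s)) \<partial>lborel \<partial>lborels J)"
      unfolding I(1) by (rule lb.product_nn_integral_insert) (use I in auto)
    also have "\<dots> = (\<integral>\<^sup>+y. ennreal \<bar>1/w\<bar> * (\<integral>\<^sup>+t. g (y(i0 := (t - dot y) / w)) \<partial>lborel) \<partial>lborels J)"
    proof (intro nn_integral_cong)
      fix y assume y: "y \<in> space (lborels J)"
      have [measurable]: "(\<lambda>s. g (y(i0 := s))) \<in> borel_measurable borel"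
      proof -
        have "(\<lambda>s. y(i0 := s)) \<in> measurable borel (borels (insert i0 J))"
          using y by (intro measurable_fun_upd[where J = J]) (auto simp: space_PiM)
        then show ?thesis by measurable
      qed
      have "(\<integral>\<^sup>+s. g (y(i0 := s)) \<partial>lborel) =
          ennreal \<bar>1/w\<bar> * (\<integral>\<^sup>+t. g (y(i0 := (- dot y / w) + (1/w) * t)) \<partial>lborel)"
        using w by (intro nn_integral_real_affine) auto
      then show "(\<integral>\<^sup>+s. g (y(i0 := s)) \<partial>lborel) =
          ennreal \<bar>1/w\<bar> * (\<integral>\<^sup>+t. g (y(i0 := (t - dot y) / w)) \<partial>lborel)"
        by (simp add: diff_divide_distrib)
    qed
    also have "\<dots> = ennreal \<bar>1/w\<bar> * (\<integral>\<^sup>+y. (\<integral>\<^sup>+t. g (y(i0 := (t - dot y) / w)) \<partial>lborel) \<partial>lborels J)"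
      by (rule nn_integral_cmult) measurable
    also have "(\<integral>\<^sup>+y. (\<integral>\<^sup>+t. g (y(i0 := (t - dot y) / w)) \<partial>lborel) \<partial>lborels J) =
        (\<integral>\<^sup>+t. (\<integral>\<^sup>+y. g (y(i0 := (t - dot y) / w)) \<partial>lborels J) \<partial>lborel)"
      by (rule ps.Fubini'[symmetric]) measurable
    finally show ?thesis .
  qed
  have hJ [measurable]: "h \<in> borel_measurable (borels (insert i0 J))"
    using h I by simp
  have v': "w\<^sup>2 + (\<Sum>j\<in>J. (v j)\<^sup>2) = 1"
    using v I by (simp add: w_def)
  let ?k = "\<lambda>t y. h (y(i0 := (t - dot y) / w))"
  have "(\<integral>\<^sup>+x. h (reflect I v x) \<partial>lborels I) = ennreal \<bar>1/w\<bar> *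
      (\<integral>\<^sup>+t. (\<integral>\<^sup>+y. h (reflect I v (y(i0 := (t - dot y) / w))) \<partial>lborels J) \<partial>lborel)"
    by (rule subst) measurable
  also have "(\<integral>\<^sup>+t. (\<integral>\<^sup>+y. h (reflect I v (y(i0 := (t - dot y) / w))) \<partial>lborels J) \<partial>lborel) =
      (\<integral>\<^sup>+t. (\<integral>\<^sup>+y. ?k (- t) (\<lambda>j\<in>J. y j + (- 2 * t * v j)) \<partial>lborels J) \<partial>lborel)"
  proof (intro nn_integral_cong arg_cong[of _ _ h])
    fix t :: real and y :: "'i \<Rightarrow> real"
    let ?x = "y(i0 := (t - dot y) / w)" and ?y = "\<lambda>j\<in>J. y j + (- 2 * t * v j)"
    have dotx: "(\<Sum>j\<in>I. v j * ?x j) = t"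
    proof -
      have "(\<Sum>j\<in>J. v j * ?x j) = dot y"
        unfolding dot_def using I by (intro sum.cong) auto
      then show ?thesis using I w by (simp add: w_def)
    qed
    \<comment> \<open>The translation moves the inner product over \<open>J\<close> by
      \<open>2 * t\<close> times the squared norm of \<open>v\<close> on \<open>J\<close>, which is
      \<open>1 - w\<^sup>2\<close>. This makes the coordinate at \<open>i0\<close> come out as in
      \<open>reflect\<close>.\<close>
    have "dot ?y = dot y - 2 * t * (\<Sum>j\<in>J. (v j)\<^sup>2)"
      unfolding dot_def by (simp add: algebra_simps sum.distrib sum_subtractf sum_distrib_left power2_eq_square)
    moreover have "(\<Sum>j\<in>J. (v j)\<^sup>2) = 1 - w\<^sup>2"
      using v' by simp
    ultimately have doty: "dot ?y = dot y - 2 * t * (1 - w\<^sup>2)"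
      by simp
    have e: "(- t - dot ?y) / w = (t - dot y) / w - 2 * t * w"
      unfolding doty using w by (simp add: field_simps power2_eq_square)
    show "reflect I v ?x = ?y(i0 := (- t - dot ?y) / w)"
      unfolding e reflect_def dotx using I by (auto simp: fun_eq_iff w_def)
  qed
  also have "\<dots> = (\<integral>\<^sup>+t. (\<integral>\<^sup>+y. ?k (- t) y \<partial>lborels J) \<partial>lborel)"
    by (intro nn_integral_cong nn_integral_PiM_lborel_translate) (use I in measurable)
  also have "\<dots> = (\<integral>\<^sup>+t. (\<integral>\<^sup>+y. ?k t y \<partial>lborels J) \<partial>lborel)"
  proof -
    have [measurable]: "(\<lambda>t. \<integral>\<^sup>+y. ?k t y \<partial>lborels J) \<in> borel_measurable borel"
      by measurable
    show ?thesis
      using nn_integral_real_affine[of "\<lambda>t. \<integral>\<^sup>+y. ?k t y \<partial>lborels J" "-1" 0] by simp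
  qed
  also have "ennreal \<bar>1/w\<bar> * \<dots> = (\<integral>\<^sup>+x. h x \<partial>lborels I)"
    by (rule subst[symmetric]) measurable
  finally show ?thesis .
qed

lemma nn_integral_gauss_reflect:
  assumes fin: "finite I" and v: "(\<Sum>i\<in>I. (v i)\<^sup>2) = 1"
    and f [measurable]: "f \<in> borel_measurable (borels I)"
  shows "(\<integral>\<^sup>+x. f (reflect I v x) \<partial>gauss I) = (\<integral>\<^sup>+x. f x \<partial>gauss I)"
proof -
  let ?w = "\<lambda>x. \<Prod>i\<in>I. ennreal (std_normal_density (x i))"
  \<comment> \<open>The joint density depends on \<open>x\<close> only through its squared norm,
    which \<open>sum_mult_reflect\<close> preserves.\<close>
  have w: "?w x = ennreal (\<Prod>i\<in>I. 1 / sqrt (2 * pi)) * ennreal (exp (- (\<Sum>i\<in>I. x i * x i) / 2))" for x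
  proof -
    have "?w x = ennreal (\<Prod>i\<in>I. std_normal_density (x i))"
      by (rule prod_ennreal) simp
    also have "(\<Prod>i\<in>I. std_normal_density (x i)) = (\<Prod>i\<in>I. 1 / sqrt (2 * pi)) * (\<Prod>i\<in>I. exp (- (x i)\<^sup>2 / 2))"
      unfolding std_normal_density_def prod.distrib ..
    also have "(\<Prod>i\<in>I. exp (- (x i)\<^sup>2 / 2)) = exp (- (\<Sum>i\<in>I. x i * x i) / 2)"
      by (subst exp_sum[OF fin, symmetric]) (simp add: sum_divide_distrib sum_negf power2_eq_square)
    finally show ?thesis
      by (simp add: ennreal_mult prod_nonneg)
  qed
  have "(\<integral>\<^sup>+x. f (reflect I v x) \<partial>gauss I) =
      (\<integral>\<^sup>+x. f (reflect I v x) * ?w x \<partial>lborels I)"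
    by (rule nn_integral_gauss_lborel[OF fin]) measurable
  also have "\<dots> = (\<integral>\<^sup>+x. f (reflect I v x) * ?w (reflect I v x) \<partial>lborels I)"
    unfolding w sum_mult_reflect[OF fin v] ..
  also have "\<dots> = (\<integral>\<^sup>+x. f x * ?w x \<partial>lborels I)"
    by (rule nn_integral_PiM_lborel_reflect[OF fin v]) measurable
  also have "\<dots> = (\<integral>\<^sup>+x. f x \<partial>gauss I)"
    by (rule nn_integral_gauss_lborel[OF fin, symmetric]) measurable
  finally show ?thesis .
qed

section \<open>Orthogonal maps as products of reflections\<close>

definition orth_on :: "'i set \<Rightarrow> ('i \<Rightarrow> 'i \<Rightarrow> real) \<Rightarrow> bool" where
  "orth_on I a \<longleftrightarrow> (\<forall>k\<in>I. \<forall>l\<in>I. (\<Sum>i\<in>I. a i k * a i l) = (if k = l then 1 else 0))"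

definition lin_map :: "'i set \<Rightarrow> ('i \<Rightarrow> 'i \<Rightarrow> real) \<Rightarrow> ('i \<Rightarrow> real) \<Rightarrow> 'i \<Rightarrow> real" where
  "lin_map I a x = (\<lambda>i\<in>I. \<Sum>j\<in>I. a i j * x j)"

text \<open>Every column is reflected, so this is the matrix of the reflection multiplied by
  \<open>a\<close>.\<close>

definition refl_mat :: "'i set \<Rightarrow> ('i \<Rightarrow> real) \<Rightarrow> ('i \<Rightarrow> 'i \<Rightarrow> real) \<Rightarrow> 'i \<Rightarrow> 'i \<Rightarrow> real" where
  "refl_mat I v a i j = reflect I v (\<lambda>i. a i j) i"

lemma measurable_lin_map [measurable]:
  "lin_map I a \<in> measurable (borels I) (borels I)"
  unfolding lin_map_def by measurable

lemma orth_on_refl_mat: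
  assumes "finite I" "(\<Sum>i\<in>I. (v i)\<^sup>2) = 1" "orth_on I a"
  shows "orth_on I (refl_mat I v a)"
  using assms(3) unfolding orth_on_def refl_mat_def sum_mult_reflect[OF assms(1,2)] .

lemma lin_map_refl_mat: "lin_map I (refl_mat I v a) x = reflect I v (lin_map I a x)"
proof -
  have "(\<Sum>j\<in>I. refl_mat I v a i j * x j) = reflect I v (lin_map I a x) i" if "i \<in> I" for i
  proof -
    have "(\<Sum>j\<in>I. refl_mat I v a i j * x j) =
        (\<Sum>j\<in>I. a i j * x j) - (\<Sum>j\<in>I. 2 * (\<Sum>l\<in>I. v l * a l j) * v i * x j)"
      using that by (simp add: refl_mat_def reflect_def algebra_simps sum_subtractf)
    also have "(\<Sum>j\<in>I. 2 * (\<Sum>l\<in>I. v l * a l j) * v i * x j) = 2 * (\<Sum>j\<in>I. \<Sum>l\<in>I. v l * a l j * x j) * v i"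
      by (simp add: sum_distrib_left sum_distrib_right mult_ac)
    also have "(\<Sum>j\<in>I. \<Sum>l\<in>I. v l * a l j * x j) = (\<Sum>l\<in>I. v l * (\<Sum>j\<in>I. a l j * x j))"
      by (subst sum.swap) (simp add: sum_distrib_left mult_ac)
    finally show ?thesis
      using that by (simp add: reflect_def lin_map_def cong: sum.cong)
  qed
  then show ?thesis
    by (auto simp: fun_eq_iff lin_map_def[of I "refl_mat I v a"] reflect_def)
qed

text \<open>A Householder reflection moves one column to a unit vector without disturbing the columns
  that are unit vectors already.\<close>

lemma nn_integral_gauss_orth:
  assumes fin: "finite I" and a: "orth_on I a"
    and f: "f \<in> borel_measurable (borels I)"
  shows "(\<integral>\<^sup>+x. f (lin_map I a x) \<partial>gauss I) = (\<integral>\<^sup>+x. f x \<partial>gauss I)"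
proof -
  \<comment> \<open>\<open>J\<close> collects columns known to be unit vectors; the induction is on
    the number of the others.\<close>
  have "(\<integral>\<^sup>+x. f (lin_map I a x) \<partial>gauss I) = (\<integral>\<^sup>+x. f x \<partial>gauss I)"
    if "J \<subseteq> I" "\<And>i j. i \<in> I \<Longrightarrow> j \<in> J \<Longrightarrow> a i j = (if i = j then 1 else 0)"
      "orth_on I a" "f \<in> borel_measurable (borels I)" for J a f
    using that
  proof (induction "card (I - J)" arbitrary: J a f)
    case 0
    then have J: "J = I" using fin by auto
    have "lin_map I a x = x" if "x \<in> space (gauss I)" for x
    proof -
      have "(\<Sum>j\<in>I. a i j * x j) = x i" if "i \<in> I" for i
      proof -
        have "(\<Sum>j\<in>I. a i j * x j) = (\<Sum>j\<in>I. if i = j then x j else 0)"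
          using 0(3) that J by (intro sum.cong) auto
        then show ?thesis using fin that by simp
      qed
      then show ?thesis
        using that by (auto simp: lin_map_def fun_eq_iff space_gauss PiE_def extensional_def)
    qed
    then show ?case by (simp cong: nn_integral_cong)
  next
    case (Suc n)
    note f [measurable] = Suc.prems(4)
    obtain j where j: "j \<in> I" "j \<notin> J"
      using Suc.hyps(2) Suc.prems(1) by (metis DiffE card.empty equals0I Zero_not_Suc)
    have n: "n = card (I - insert j J)"
      using Suc.hyps(2) j fin
      by (metis Diff_iff Diff_insert card_Diff_singleton diff_Suc_1 finite_Diff)
    have cols: "(\<Sum>i\<in>I. a i k * a i l) = (if k = l then 1 else 0)" if "k \<in> I" "l \<in> I" for k l
      using Suc.prems(3) that by (auto simp: orth_on_def)
    \<comment> \<open>Column \<open>l\<close> is a unit vector, so orthogonality to it kills the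
      entry of column \<open>j\<close> in row \<open>l\<close>. Hence the reflection vector below is
      zero on \<open>J\<close> and fixes the columns in \<open>J\<close>.\<close>
    have aJ: "a l j = 0" if "l \<in> J" for l
    proof -
      have "(\<Sum>i\<in>I. a i l * a i j) = (\<Sum>i\<in>I. if i = l then a i j else 0)"
        using that Suc.prems(2) by (intro sum.cong) auto
      also have "\<dots> = a l j" using fin that Suc.prems(1) by (auto simp: subset_iff)
      finally show ?thesis using cols[of l j] that j Suc.prems(1) by auto
    qed
    show ?case
    proof (cases "\<forall>i\<in>I. a i j = (if i = j then 1 else 0)")
      case True
      show ?thesis
        by (rule Suc.hyps(1)[OF n]) (use Suc.prems True j in auto)
    next
      case False
      \<comment> \<open>The difference of two vectors of equal norm is the axis of a reflection that
        exchanges them: \<open>u0\<close> is column \<open>j\<close> minus the unit vector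
        \<open>e\<close>.\<close>
      define e where "e i = (if i = j then 1 else 0 :: real)" for i
      define u0 where "u0 i = a i j - e i" for i
      define q where "q = (\<Sum>i\<in>I. (u0 i)\<^sup>2)"
      have qpos: "q > 0"
      proof -
        from False obtain i where i: "i \<in> I" "u0 i \<noteq> 0" by (auto simp: u0_def e_def)
        have "0 < (u0 i)\<^sup>2" using i by simp
        also have "\<dots> \<le> q" unfolding q_def by (rule member_le_sum) (use i fin in auto)
        finally show ?thesis .
      qed
      have q_eq: "q = 2 - 2 * a j j"
      proof -
        have "q = (\<Sum>i\<in>I. a i j * a i j - 2 * (if i = j then a i j else 0) + (if i = j then 1 else 0))"
          unfolding q_def by (intro sum.cong) (auto simp: u0_def e_def algebra_simps power2_eq_square)
        also have "\<dots> = 1 - 2 * a j j + 1"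
          using cols[of j j] j fin by (simp add: sum.distrib sum_subtractf sum_distrib_left[symmetric])
        finally show ?thesis by simp
      qed
      define u where "u i = u0 i / sqrt q" for i
      have u1: "(\<Sum>i\<in>I. (u i)\<^sup>2) = 1"
        using qpos by (simp add: u_def power_divide sum_divide_distrib[symmetric] q_def[symmetric])
      have uJ: "u l = 0" if "l \<in> J" for l
        using that aJ j by (auto simp: u_def u0_def e_def)
      let ?b = "refl_mat I u a"
      have bJ: "?b i l = (if i = l then 1 else 0)" if "i \<in> I" "l \<in> insert j J" for i l
      proof (cases "l = j")
        case True
        have "(\<Sum>i\<in>I. u i * a i j) = (\<Sum>i\<in>I. a i j * a i j - (if i = j then a i j else 0)) / sqrt q"
          unfolding sum_divide_distrib
          by (intro sum.cong) (auto simp: u_def u0_def e_def algebra_simps diff_divide_distrib)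
        also have "(\<Sum>i\<in>I. a i j * a i j - (if i = j then a i j else 0)) = 1 - a j j"
          using cols[of j j] j fin by (simp add: sum_subtractf)
        also have "1 - a j j = q / 2" using q_eq by simp
        finally have "2 * (\<Sum>i\<in>I. u i * a i j) * u i = u0 i"
          using qpos by (simp add: u_def)
        then show ?thesis
          using that True by (simp add: refl_mat_def reflect_def u0_def e_def)
      next
        case False
        then have l: "l \<in> J" using that by auto
        have "(\<Sum>i\<in>I. u i * a i l) = (\<Sum>i\<in>I. 0)"
          using l Suc.prems(2) uJ by (intro sum.cong) auto
        then show ?thesis
          using that l Suc.prems(2) by (simp add: refl_mat_def reflect_def)
      qed
      \<comment> \<open>The reflection is an involution, so \<open>lin_map I a\<close> is the
        reflection after \<open>lin_map I ?b\<close>, and \<open>?b\<close> has one more unit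
        column.\<close>
      have "(\<integral>\<^sup>+x. f (lin_map I a x) \<partial>gauss I) = (\<integral>\<^sup>+x. f (reflect I u (lin_map I ?b x)) \<partial>gauss I)"
        unfolding lin_map_refl_mat reflect_reflect[OF u1] by (simp add: lin_map_def)
      also have "\<dots> = (\<integral>\<^sup>+x. f (reflect I u x) \<partial>gauss I)"
        by (rule Suc.hyps(1)[OF n])
          (use Suc.prems j bJ orth_on_refl_mat[OF fin u1] in auto)
      also have "\<dots> = (\<integral>\<^sup>+x. f x \<partial>gauss I)"
        by (rule nn_integral_gauss_reflect[OF fin u1 f])
      finally show ?thesis .
    qed
  qed
  from this[of "{}" a f] a f show ?thesis by auto
qed

section \<open>Moments of Gaussian vectors\<close>

lemma sum_mult_lin_map:
  assumes fin: "finite I" and a: "orth_on I a"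
  shows "(\<Sum>i\<in>I. lin_map I a x i * lin_map I a y i) = (\<Sum>i\<in>I. x i * y i)"
proof -
  have "(\<Sum>i\<in>I. lin_map I a x i * lin_map I a y i) = (\<Sum>i\<in>I. \<Sum>k\<in>I. \<Sum>l\<in>I. x k * y l * (a i k * a i l))"
    by (intro sum.cong) (auto simp: lin_map_def sum_product mult_ac)
  also have "\<dots> = (\<Sum>k\<in>I. \<Sum>l\<in>I. x k * y l * (\<Sum>i\<in>I. a i k * a i l))"
    by (subst sum.swap, subst sum.swap[of _ I I]) (simp add: sum_distrib_left)
  also have "\<dots> = (\<Sum>k\<in>I. \<Sum>l\<in>I. if k = l then x k * y l else 0)"
    using a by (intro sum.cong) (auto simp: orth_on_def)
  finally show ?thesis using fin by simp
qed

lemma orth_on_id: "finite I \<Longrightarrow> orth_on I (\<lambda>i j. if i = j then 1 else 0)"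
proof -
  assume "finite I"
  have "(\<Sum>i\<in>I. (if i = k then 1 else 0) * (if i = l then 1 else 0)) =
     (\<Sum>i\<in>I. if i = k then (if k = l then 1 else 0) else (0::real))" for k l
    by (intro sum.cong) auto
  then show ?thesis
    using \<open>finite I\<close> by (simp add: orth_on_def)
qed

text \<open>As in Householder's QR factorisation, the reflection for the next vector is supported
  away from the coordinates that carry the earlier ones and so leaves these vectors fixed. With
  \<open>c = 1\<close> this turns one vector into a multiple of a coordinate vector; with the rows
  of a matrix it confines their span to the chosen coordinates.\<close>

lemma orth_triangular:
  fixes e :: "nat \<Rightarrow> 'i" and r :: "nat \<Rightarrow> 'i \<Rightarrow> real"
  assumes fin: "finite I" and e: "inj_on e {..<c}" "e ` {..<c} \<subseteq> I"
  shows "\<exists>a. orth_on I a \<and> (\<forall>i<c. \<forall>j\<in>I - e ` {..<c}. lin_map I a (r i) j = 0)"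
  using e
proof (induction c)
  case 0
  show ?case using orth_on_id[OF fin] by auto
next
  case (Suc c)
  let ?J = "e ` {..<c}"
  have inj: "inj_on e {..<c}" "?J \<subseteq> I"
    using Suc.prems by (auto simp: inj_on_def)
  obtain a where a: "orth_on I a" "\<And>i j. i < c \<Longrightarrow> j \<in> I - ?J \<Longrightarrow> lin_map I a (r i) j = 0"
    using Suc.IH[OF inj] by auto
  have j: "e c \<in> I" "e c \<notin> ?J"
    using Suc.prems by (auto dest: inj_onD[OF Suc.prems(1)])
  define w where "w = lin_map I a (r c)"
  define N where "N = sqrt (\<Sum>i\<in>I - ?J. (w i)\<^sup>2)"
  have N2: "N\<^sup>2 = (\<Sum>i\<in>I - ?J. (w i)\<^sup>2)"
    unfolding N_def by (intro real_sqrt_pow2 sum_nonneg) auto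
  define u0 where "u0 i = (if i \<in> ?J then 0 else w i - (if i = e c then N else 0))" for i
  define q where "q = (\<Sum>i\<in>I. (u0 i)\<^sup>2)"
  show ?case
  proof (cases "q = 0")
    case True
    then have "u0 i = 0" if "i \<in> I" for i
      using that fin by (auto simp: q_def sum_nonneg_eq_0_iff)
    then have "lin_map I a (r c) i = 0" if "i \<in> I - ?J" "i \<noteq> e c" for i
      using that by (force simp: u0_def w_def)
    then show ?thesis
      using a by (intro exI[of _ a]) (auto simp: less_Suc_eq lessThan_Suc)
  next
    case False
    then have q: "q > 0" by (simp add: q_def less_le sum_nonneg)
    define u where "u i = u0 i / sqrt q" for i
    have u1: "(\<Sum>i\<in>I. (u i)\<^sup>2) = 1"
      using q by (simp add: u_def power_divide sum_divide_distrib[symmetric] q_def[symmetric])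
    \<comment> \<open>Together \<open>s1\<close> and \<open>s2\<close> say that the inner product of
      \<open>u0\<close> and \<open>w\<close> is half the squared norm of \<open>u0\<close>, so the
      reflection subtracts exactly \<open>u0\<close> from \<open>w\<close>.\<close>
    have s1: "(\<Sum>i\<in>I. u0 i * w i) = N\<^sup>2 - N * w (e c)"
    proof -
      have "(\<Sum>i\<in>I. u0 i * w i) = (\<Sum>i\<in>I - ?J. u0 i * w i)"
        by (rule sum.mono_neutral_right) (use fin in \<open>auto simp: u0_def\<close>)
      also have "\<dots> = (\<Sum>i\<in>I - ?J. (w i)\<^sup>2 - (if i = e c then N * w i else 0))"
        by (intro sum.cong) (auto simp: u0_def power2_eq_square algebra_simps)
      finally show ?thesis using j fin N2 by (simp add: sum_subtractf)
    qed
    have s2: "q = 2 * (N\<^sup>2 - N * w (e c))"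
    proof -
      have "q = (\<Sum>i\<in>I - ?J. (u0 i)\<^sup>2)"
        unfolding q_def by (rule sum.mono_neutral_right) (use fin in \<open>auto simp: u0_def\<close>)
      also have "\<dots> = (\<Sum>i\<in>I - ?J. (w i)\<^sup>2 + (if i = e c then N\<^sup>2 - 2 * N * w i else 0))"
        by (intro sum.cong) (auto simp: u0_def power2_eq_square algebra_simps)
      finally show ?thesis using j fin N2 by (simp add: sum.distrib)
    qed
    let ?b = "refl_mat I u a"
    have "lin_map I ?b (r i) l = 0" if i: "i < Suc c" and l: "l \<in> I - e ` {..<Suc c}" for i l
    proof (cases "i = c")
      case True
      have "2 * (\<Sum>i\<in>I. u i * w i) * u l = 2 * (\<Sum>i\<in>I. u0 i * w i) * u0 l / q"
        using q by (simp add: u_def sum_divide_distrib[symmetric])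
      also have "\<dots> = u0 l" using q s1 s2 by simp
      finally show ?thesis
        using l True by (auto simp: lin_map_refl_mat reflect_def w_def[symmetric] u0_def lessThan_Suc)
    next
      case False
      then have i: "i < c" using i by simp
      have "u j * lin_map I a (r i) j = 0" if "j \<in> I" for j
        using a(2)[OF i, of j] that by (cases "j \<in> ?J") (auto simp: u_def u0_def)
      then have "(\<Sum>j\<in>I. u j * lin_map I a (r i) j) = 0" by (intro sum.neutral) auto
      then show ?thesis
        using l a(2)[OF i] by (auto simp: lin_map_refl_mat reflect_def lessThan_Suc)
    qed
    then show ?thesis
      using orth_on_refl_mat[OF fin u1 a(1)] by blast
  qed
qed

lemma nn_integral_gauss_restrict:
  assumes "finite I" "J \<subseteq> I" and f [measurable]: "f \<in> borel_measurable (borels J)"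
  shows "(\<integral>\<^sup>+x. f (restrict x J) \<partial>gauss I) = (\<integral>\<^sup>+x. f x \<partial>gauss J)"
proof -
  interpret product_prob_space "\<lambda>_. std_normal" I
    by (intro product_prob_space.intro product_prob_space_axioms.intro prob_space_std_normal
        product_sigma_finite.intro prob_space_imp_sigma_finite)
  have "gauss J = distr (gauss I) (gauss J) (\<lambda>x. restrict x J)"
    unfolding gauss_def
    by (rule distr_PiM_restrict_finite[symmetric]) (use assms finite_subset in auto)
  then have "(\<integral>\<^sup>+x. f x \<partial>gauss J) = (\<integral>\<^sup>+x. f x \<partial>distr (gauss I) (gauss J) (\<lambda>x. restrict x J))"
    by simp
  also have "\<dots> = (\<integral>\<^sup>+x. f (restrict x J) \<partial>gauss I)"
  proof (rule nn_integral_distr)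
    show "(\<lambda>x. restrict x J) \<in> measurable (gauss I) (gauss J)"
      using assms(2) unfolding gauss_def by (rule measurable_restrict_subset)
  qed measurable
  finally show ?thesis ..
qed

lemma nn_integral_gauss_component:
  assumes "finite I" "i \<in> I" and [measurable]: "f \<in> borel_measurable borel"
  shows "(\<integral>\<^sup>+x. f (x i) \<partial>gauss I) = (\<integral>\<^sup>+y. f y \<partial>std_normal)"
proof -
  have "(\<integral>\<^sup>+x. f (x i) \<partial>gauss I) = (\<integral>\<^sup>+x. f (restrict x {i} i) \<partial>gauss I)"
    by simp
  also have "\<dots> = (\<integral>\<^sup>+x. f (x i) \<partial>gauss {i})"
    by (rule nn_integral_gauss_restrict) (use assms in auto)
  also have "\<dots> = (\<integral>\<^sup>+y. f y \<partial>std_normal)"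
    unfolding gauss_def by (rule sn.product_nn_integral_singleton) simp
  finally show ?thesis .
qed

text \<open>A rotation takes \<open>w\<close> to a multiple of the coordinate vector at
  \<open>i0\<close>. The sign of the multiple is left open, so \<open>\<beta>\<close> is given by
  its square, which is all that even moments see.\<close>

lemma nn_integral_gauss_linear:
  assumes fin: "finite I" and "i0 \<in> I" and F [measurable]: "F \<in> borel_measurable borel"
  obtains \<beta> where "\<beta>\<^sup>2 = (\<Sum>i\<in>I. (w i)\<^sup>2)"
    and "(\<integral>\<^sup>+x. F (\<Sum>i\<in>I. w i * x i) \<partial>gauss I) = (\<integral>\<^sup>+y. F (\<beta> * y) \<partial>std_normal)"
proof -
  obtain a where a: "orth_on I a" "\<And>j. j \<in> I - {i0} \<Longrightarrow> lin_map I a w j = 0"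
    using orth_triangular[OF fin, of "\<lambda>_. i0" 1 "\<lambda>_. w"] assms(2) by (auto simp: lessThan_Suc)
  have sum: "(\<Sum>i\<in>I. lin_map I a w i * y i) = lin_map I a w i0 * y i0" for y
    using fin a(2) assms(2) by (subst sum.mono_neutral_right[of I "{i0}"]) auto
  have "(\<Sum>i\<in>I. w i * x i) = lin_map I a w i0 * lin_map I a x i0" for x
    by (subst sum_mult_lin_map[OF fin a(1), symmetric]) (rule sum)
  then have "(\<integral>\<^sup>+x. F (\<Sum>i\<in>I. w i * x i) \<partial>gauss I) = (\<integral>\<^sup>+x. F (lin_map I a w i0 * lin_map I a x i0) \<partial>gauss I)"
    by simp
  also have "\<dots> = (\<integral>\<^sup>+x. F (lin_map I a w i0 * x i0) \<partial>gauss I)"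
    by (rule nn_integral_gauss_orth[OF fin a(1)]) (use assms(2) in measurable)
  also have "\<dots> = (\<integral>\<^sup>+y. F (lin_map I a w i0 * y) \<partial>std_normal)"
    by (rule nn_integral_gauss_component[OF fin assms(2)]) measurable
  finally have 1: "(\<integral>\<^sup>+x. F (\<Sum>i\<in>I. w i * x i) \<partial>gauss I) = (\<integral>\<^sup>+y. F (lin_map I a w i0 * y) \<partial>std_normal)" .
  have "(lin_map I a w i0)\<^sup>2 = (\<Sum>i\<in>I. lin_map I a w i * lin_map I a w i)"
    unfolding sum by (simp add: power2_eq_square)
  also have "\<dots> = (\<Sum>i\<in>I. (w i)\<^sup>2)"
    by (simp add: sum_mult_lin_map[OF fin a(1)] power2_eq_square)
  finally show ?thesis using that 1 by blast
qed

text \<open>On matrices indexed by \<open>K \<times> D\<close> this is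
  \<open>x \<mapsto> x a\<^sup>T\<close>: each row is transformed by \<open>a\<close>.\<close>

definition row_block :: "('l \<Rightarrow> 'l \<Rightarrow> real) \<Rightarrow> 'k \<times> 'l \<Rightarrow> 'k \<times> 'l \<Rightarrow> real" where
  "row_block a = (\<lambda>(i, l) (i', l'). if i = i' then a l l' else 0)"

lemma orth_on_row_block:
  fixes K :: "'k set" and D :: "'l set"
  assumes "finite K" "finite D" "orth_on D a"
  shows "orth_on (K \<times> D) (row_block a)"
  unfolding orth_on_def
proof (intro ballI)
  fix x y :: "'k \<times> 'l" assume xy: "x \<in> K \<times> D" "y \<in> K \<times> D"
  obtain i l i' l' where [simp]: "x = (i, l)" "y = (i', l')" by fastforce
  have "(\<Sum>z\<in>K\<times>D. row_block a z x * row_block a z y) =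
      (\<Sum>j\<in>K. \<Sum>m\<in>D. (if j = i then a m l else 0) * (if j = i' then a m l' else 0))"
    by (simp add: sum.cartesian_product row_block_def case_prod_beta cong: if_cong)
  also have "\<dots> = (\<Sum>j\<in>K. if j = i then (if i = i' then (\<Sum>m\<in>D. a m l * a m l') else 0) else 0)"
    by (intro sum.cong) auto
  also have "\<dots> = (if x = y then 1 else 0)"
    using assms xy by (auto simp: orth_on_def)
  finally show "(\<Sum>z\<in>K\<times>D. row_block a z x * row_block a z y) = (if x = y then 1 else 0)" .
qed

lemma lin_map_row_block:
  assumes "finite K" "i \<in> K" "l \<in> D"
  shows "lin_map (K \<times> D) (row_block a) x (i, l) = (\<Sum>m\<in>D. a l m * x (i, m))"
proof -
  have "lin_map (K \<times> D) (row_block a) x (i, l) = (\<Sum>j\<in>K. \<Sum>m\<in>D. (if i = j then a l m else 0) * x (j, m))"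
    unfolding sum.cartesian_product
    using assms by (auto simp: lin_map_def row_block_def intro!: sum.cong)
  also have "\<dots> = (\<Sum>j\<in>K. if i = j then (\<Sum>m\<in>D. a l m * x (j, m)) else 0)"
    by (intro sum.cong) auto
  finally show ?thesis using assms by simp
qed

text \<open>One rotation applied to all rows at once turns the product of the matrix with
  \<open>w\<close> into a multiple of a single column, whose entries are independent.\<close>

lemma nn_integral_gauss_rows_linear:
  assumes fin: "finite K" "finite D" and "l0 \<in> D"
    and F [measurable]: "F \<in> borel_measurable (borels K)"
  obtains \<beta> where "\<beta>\<^sup>2 = (\<Sum>l\<in>D. (w l)\<^sup>2)"
    and "(\<integral>\<^sup>+x. F (\<lambda>i\<in>K. \<Sum>l\<in>D. w l * x (i, l)) \<partial>gauss (K \<times> D)) =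
      (\<integral>\<^sup>+x. F (\<lambda>i\<in>K. \<beta> * x (i, l0)) \<partial>gauss (K \<times> D))"
proof -
  obtain a where a: "orth_on D a" "\<And>j. j \<in> D - {l0} \<Longrightarrow> lin_map D a w j = 0"
    using orth_triangular[OF fin(2), of "\<lambda>_. l0" 1 "\<lambda>_. w"] assms(3) by (auto simp: lessThan_Suc)
  have sum: "(\<Sum>i\<in>D. lin_map D a w i * y i) = lin_map D a w l0 * y l0" for y
    using fin a(2) assms(3) by (subst sum.mono_neutral_right[of D "{l0}"]) auto
  let ?b = "row_block a :: 'a \<times> 'b \<Rightarrow> _"
  have eq: "(\<Sum>l\<in>D. w l * x (i, l)) = lin_map D a w l0 * lin_map (K \<times> D) ?b x (i, l0)" if "i \<in> K" for i x
  proof -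
    have "(\<Sum>l\<in>D. w l * x (i, l)) = (\<Sum>l\<in>D. lin_map D a w l * lin_map D a (\<lambda>l. x (i, l)) l)"
      by (rule sum_mult_lin_map[OF fin(2) a(1), symmetric])
    also have "\<dots> = lin_map D a w l0 * lin_map D a (\<lambda>l. x (i, l)) l0" by (rule sum)
    also have "lin_map D a (\<lambda>l. x (i, l)) l0 = lin_map (K \<times> D) ?b x (i, l0)"
      unfolding lin_map_row_block[OF fin(1) that assms(3)] using assms(3) by (simp add: lin_map_def)
    finally show ?thesis .
  qed
  have "(\<integral>\<^sup>+x. F (\<lambda>i\<in>K. \<Sum>l\<in>D. w l * x (i, l)) \<partial>gauss (K \<times> D)) =
      (\<integral>\<^sup>+x. F (\<lambda>i\<in>K. lin_map D a w l0 * lin_map (K \<times> D) ?b x (i, l0)) \<partial>gauss (K \<times> D))"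
    by (intro nn_integral_cong arg_cong[of _ _ F]) (auto simp: eq)
  also have "\<dots> = (\<integral>\<^sup>+x. F (\<lambda>i\<in>K. lin_map D a w l0 * x (i, l0)) \<partial>gauss (K \<times> D))"
  proof (rule nn_integral_gauss_orth)
    have "(\<lambda>x. \<lambda>i\<in>K. lin_map D a w l0 * x (i, l0)) \<in> measurable (borels (K \<times> D)) (borels K)"
      using assms(3) by (intro measurable_restrict borel_measurable_times measurable_const measurable_component_singleton) auto
    then show "(\<lambda>x. F (\<lambda>i\<in>K. lin_map D a w l0 * x (i, l0))) \<in> borel_measurable (borels (K \<times> D))"
      by measurable
  qed (use fin orth_on_row_block a in auto)
  finally have 1: "(\<integral>\<^sup>+x. F (\<lambda>i\<in>K. \<Sum>l\<in>D. w l * x (i, l)) \<partial>gauss (K \<times> D)) =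
     (\<integral>\<^sup>+x. F (\<lambda>i\<in>K. lin_map D a w l0 * x (i, l0)) \<partial>gauss (K \<times> D))" .
  have "(lin_map D a w l0)\<^sup>2 = (\<Sum>i\<in>D. lin_map D a w i * lin_map D a w i)"
    unfolding sum by (simp add: power2_eq_square)
  also have "\<dots> = (\<Sum>i\<in>D. (w i)\<^sup>2)"
    by (simp add: sum_mult_lin_map[OF fin(2) a(1)] power2_eq_square)
  finally show ?thesis using that 1 by blast
qed

section \<open>Moments of chi variables\<close>

lemma nn_integral_std_normal_even:
  "(\<integral>\<^sup>+y. ennreal ((y\<^sup>2) ^ s) \<partial>std_normal) = ennreal (2 ^ s * pochhammer (1/2) s)"
proof -
  have "(\<integral>\<^sup>+y. ennreal ((y\<^sup>2) ^ s) \<partial>std_normal) =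
      (\<integral>\<^sup>+y. ennreal (std_normal_density y * y ^ (2 * s)) \<partial>lborel)"
    by (subst nn_integral_density) (auto simp: ennreal_mult[symmetric] power_mult)
  also have "\<dots> = ennreal (fact (2 * s) / (2 ^ s * fact s))"
    by (rule nn_integral_eq_integral[THEN trans])
      (use std_normal_moment_even[of s] in \<open>auto simp: has_bochner_integral_iff power_mult\<close>)
  also have "fact (2 * s) / (2 ^ s * fact s) = 2 ^ s * pochhammer (1/2 :: real) s"
  proof -
    have "(2::real) ^ (2 * s) = 2 ^ s * 2 ^ s" by (simp add: mult_2 power_add)
    then show ?thesis by (simp add: fact_double)
  qed
  finally show ?thesis .
qed

lemma pochhammer_real_nonneg: "0 \<le> x \<Longrightarrow> 0 \<le> pochhammer x n" for x :: real
  by (auto simp: pochhammer_prod intro!: prod_nonneg)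

text \<open>Splitting off one coordinate gives a binomial sum of products of moments. In rising
  factorials this is the Vandermonde convolution \<open>pochhammer_binomial_sum\<close>, which adds
  the parameters \<open>1/2\<close> and \<open>card I / 2\<close>; hence the form with
  \<open>pochhammer\<close>.\<close>

lemma nn_integral_gauss_chi_pow_aux:
  assumes "finite I"
  shows "(\<integral>\<^sup>+x. ennreal ((\<Sum>i\<in>I. (x i)\<^sup>2) ^ s) \<partial>gauss I) =
     ennreal (2 ^ s * pochhammer (real (card I) / 2) s)"
  using assms
proof (induction I arbitrary: s rule: finite_induct)
  case empty
  show ?case
    by (cases s) (simp_all add: gauss_def PiM_empty nn_integral_count_space_finite pochhammer_rec)
next
  case (insert i I)
  note pn = pochhammer_real_nonneg[of "real (card I) / 2"] pochhammer_real_nonneg[of "1/2"]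
  have "(\<integral>\<^sup>+x. ennreal ((\<Sum>i\<in>insert i I. (x i)\<^sup>2) ^ s) \<partial>gauss (insert i I)) =
      (\<integral>\<^sup>+y. \<integral>\<^sup>+x. ennreal ((\<Sum>j\<in>insert i I. ((x(i := y)) j)\<^sup>2) ^ s) \<partial>gauss I \<partial>std_normal)"
    unfolding gauss_def by (rule sn.product_nn_integral_insert_rev[OF insert(1,2)]) measurable
  also have "\<dots> = (\<integral>\<^sup>+y. \<integral>\<^sup>+x. (\<Sum>t\<le>s. ennreal (real (s choose t) * (y\<^sup>2) ^ t) * ennreal ((\<Sum>j\<in>I. (x j)\<^sup>2) ^ (s - t))) \<partial>gauss I \<partial>std_normal)"
  proof (intro nn_integral_cong)
    fix y :: real and x :: "'a \<Rightarrow> real"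
    have "(\<Sum>j\<in>I. ((x(i := y)) j)\<^sup>2) = (\<Sum>j\<in>I. (x j)\<^sup>2)"
      using insert(2) by (intro sum.cong) auto
    then have "(\<Sum>j\<in>insert i I. ((x(i := y)) j)\<^sup>2) ^ s = (\<Sum>t\<le>s. real (s choose t) * (y\<^sup>2) ^ t * (\<Sum>j\<in>I. (x j)\<^sup>2) ^ (s - t))"
      using insert(1,2) by (simp add: binomial_ring)
    then show "ennreal ((\<Sum>j\<in>insert i I. ((x(i := y)) j)\<^sup>2) ^ s) =
        (\<Sum>t\<le>s. ennreal (real (s choose t) * (y\<^sup>2) ^ t) * ennreal ((\<Sum>j\<in>I. (x j)\<^sup>2) ^ (s - t)))"
      by (simp add: sum_nonneg ennreal_mult[symmetric] del: fun_upd_apply)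
  qed
  also have "\<dots> = (\<integral>\<^sup>+y. (\<Sum>t\<le>s. ennreal ((y\<^sup>2) ^ t) * ennreal (real (s choose t) * (2 ^ (s - t) * pochhammer (real (card I) / 2) (s - t)))) \<partial>std_normal)"
  proof (intro nn_integral_cong)
    fix y :: real
    have "(\<integral>\<^sup>+x. (\<Sum>t\<le>s. ennreal (real (s choose t) * (y\<^sup>2) ^ t) * ennreal ((\<Sum>j\<in>I. (x j)\<^sup>2) ^ (s - t))) \<partial>gauss I) =
        (\<Sum>t\<le>s. \<integral>\<^sup>+x. ennreal (real (s choose t) * (y\<^sup>2) ^ t) * ennreal ((\<Sum>j\<in>I. (x j)\<^sup>2) ^ (s - t)) \<partial>gauss I)"
      by (rule nn_integral_sum) measurable
    also have "\<dots> = (\<Sum>t\<le>s. ennreal (real (s choose t) * (y\<^sup>2) ^ t) * ennreal (2 ^ (s - t) * pochhammer (real (card I) / 2) (s - t)))"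
      by (intro sum.cong refl, subst nn_integral_cmult) (measurable, simp add: insert.IH)
    also have "\<dots> = (\<Sum>t\<le>s. ennreal ((y\<^sup>2) ^ t) * ennreal (real (s choose t) * (2 ^ (s - t) * pochhammer (real (card I) / 2) (s - t))))"
      by (intro sum.cong refl) (simp add: ennreal_mult[symmetric] pn mult_ac)
    finally show "(\<integral>\<^sup>+x. (\<Sum>t\<le>s. ennreal (real (s choose t) * (y\<^sup>2) ^ t) * ennreal ((\<Sum>j\<in>I. (x j)\<^sup>2) ^ (s - t))) \<partial>gauss I) = \<dots>" .
  qed
  also have "\<dots> = (\<Sum>t\<le>s. ennreal (2 ^ t * pochhammer (1/2) t) * ennreal (real (s choose t) * (2 ^ (s - t) * pochhammer (real (card I) / 2) (s - t))))"
    by (subst nn_integral_sum) (auto simp: nn_integral_multc nn_integral_std_normal_even)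
  also have "\<dots> = ennreal (\<Sum>t\<le>s. 2 ^ s * (real (s choose t) * pochhammer (1/2) t * pochhammer (real (card I) / 2) (s - t)))"
  proof -
    have "ennreal (2 ^ t * pochhammer (1/2) t) * ennreal (real (s choose t) * (2 ^ (s - t) * pochhammer (real (card I) / 2) (s - t))) =
      ennreal (2 ^ s * (real (s choose t) * pochhammer (1/2) t * pochhammer (real (card I) / 2) (s - t)))" if "t \<le> s" for t
    proof -
      have "(2::real) ^ s = 2 ^ t * 2 ^ (s - t)" using that by (simp add: power_add[symmetric])
      then show ?thesis by (subst ennreal_mult[symmetric]) (simp_all add: pn mult_ac)
    qed
    then show ?thesis
      by (subst sum_ennreal[symmetric]) (simp_all add: pn)
  qed
  also have "(\<Sum>t\<le>s. 2 ^ s * (real (s choose t) * pochhammer (1/2) t * pochhammer (real (card I) / 2) (s - t))) =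
      2 ^ s * pochhammer (1/2 + real (card I) / 2) s"
    by (simp add: pochhammer_binomial_sum sum_distrib_left)
  also have "1/2 + real (card I) / 2 = real (card (insert i I)) / 2"
    using insert(1,2) by (simp add: add_divide_distrib)
  finally show ?case .
qed

lemma pochhammer_half_eq_prod: "2 ^ s * pochhammer (x / 2) s = (\<Prod>j<s. x + 2 * real j)" for x :: real
  by (induction s) (simp_all add: pochhammer_Suc field_simps)

lemma nn_integral_gauss_chi_pow:
  assumes "finite I" "J \<subseteq> I"
  shows "(\<integral>\<^sup>+x. ennreal ((\<Sum>i\<in>J. (x i)\<^sup>2) ^ s) \<partial>gauss I) = ennreal (\<Prod>j<s. real (card J) + 2 * real j)"
proof -
  have "(\<integral>\<^sup>+x. ennreal ((\<Sum>i\<in>J. (x i)\<^sup>2) ^ s) \<partial>gauss I) =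
      (\<integral>\<^sup>+x. ennreal ((\<Sum>i\<in>J. (restrict x J i)\<^sup>2) ^ s) \<partial>gauss I)"
    by simp
  also have "\<dots> = (\<integral>\<^sup>+x. ennreal ((\<Sum>i\<in>J. (x i)\<^sup>2) ^ s) \<partial>gauss J)"
    by (rule nn_integral_gauss_restrict[OF assms]) measurable
  also have "\<dots> = ennreal (\<Prod>j<s. real (card J) + 2 * real j)"
    using assms finite_subset
    by (subst nn_integral_gauss_chi_pow_aux) (auto simp: pochhammer_half_eq_prod)
  finally show ?thesis .
qed

lemma nn_integral_gauss_linear_pow:
  assumes fin: "finite I"
  shows "(\<integral>\<^sup>+x. ennreal (((\<Sum>i\<in>I. w i * x i)\<^sup>2) ^ s) \<partial>gauss I) =
     ennreal ((\<Sum>i\<in>I. (w i)\<^sup>2) ^ s * (\<Prod>j<s. 1 + 2 * real j))"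
proof (cases "I = {}")
  case True
  then show ?thesis
    by (cases s) (simp_all add: gauss_def PiM_empty nn_integral_count_space_finite)
next
  case False
  then obtain i0 where i0: "i0 \<in> I" by auto
  obtain b where b: "b\<^sup>2 = (\<Sum>i\<in>I. (w i)\<^sup>2)"
    "(\<integral>\<^sup>+x. ennreal (((\<Sum>i\<in>I. w i * x i)\<^sup>2) ^ s) \<partial>gauss I) = (\<integral>\<^sup>+y. ennreal (((b * y)\<^sup>2) ^ s) \<partial>std_normal)"
    by (rule nn_integral_gauss_linear[OF fin i0, of "\<lambda>y. ennreal ((y\<^sup>2) ^ s)" w]) auto
  have "(\<integral>\<^sup>+y. ennreal (((b * y)\<^sup>2) ^ s) \<partial>std_normal) = (\<integral>\<^sup>+y. ennreal ((b\<^sup>2) ^ s) * ennreal ((y\<^sup>2) ^ s) \<partial>std_normal)"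
    by (simp add: ennreal_mult[symmetric] power_mult_distrib)
  also have "\<dots> = ennreal ((b\<^sup>2) ^ s) * ennreal (\<Prod>j<s. 1 + 2 * real j)"
    by (subst nn_integral_cmult) (auto simp: nn_integral_std_normal_even pochhammer_half_eq_prod)
  finally show ?thesis
    using b by (subst ennreal_mult) (simp_all add: prod_nonneg sum_nonneg)
qed

section \<open>Negative moments of chi variables\<close>

lemma nn_integral_std_normal_exp:
  assumes "t \<ge> 0"
  shows "(\<integral>\<^sup>+y. ennreal (exp (- t * y\<^sup>2)) \<partial>std_normal) = ennreal (1 / sqrt (1 + 2 * t))"
proof -
  \<comment> \<open>Rescaling by \<open>c\<close> absorbs the exponential into the density, since
    \<open>c\<^sup>2 / 2 = 1 / 2 + t\<close>, at the cost of a factor \<open>1 / c\<close>.\<close>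
  define c where "c = sqrt (1 + 2 * t)"
  have c: "c > 0" "c\<^sup>2 = 1 + 2 * t" using assms by (auto simp: c_def)
  have "1 = emeasure std_normal (space std_normal)"
    using prob_space.emeasure_space_1[OF prob_space_std_normal] ..
  also have "\<dots> = (\<integral>\<^sup>+y. ennreal (std_normal_density y) \<partial>lborel)"
    by (simp add: emeasure_density)
  also have "\<dots> = ennreal \<bar>c\<bar> * (\<integral>\<^sup>+y. ennreal (std_normal_density (0 + c * y)) \<partial>lborel)"
    using c by (intro nn_integral_real_affine) auto
  also have "(\<integral>\<^sup>+y. ennreal (std_normal_density (0 + c * y)) \<partial>lborel) =
      (\<integral>\<^sup>+y. ennreal (std_normal_density y) * ennreal (exp (- t * y\<^sup>2)) \<partial>lborel)"
  proof (intro nn_integral_cong)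
    fix y :: real
    have "- (c * y)\<^sup>2 / 2 = - y\<^sup>2 / 2 + (- t * y\<^sup>2)"
      by (simp add: power_mult_distrib c(2) field_simps)
    then have "std_normal_density (c * y) = std_normal_density y * exp (- t * y\<^sup>2)"
      unfolding std_normal_density_def by (simp add: exp_add[symmetric])
    then show "ennreal (std_normal_density (0 + c * y)) = ennreal (std_normal_density y) * ennreal (exp (- t * y\<^sup>2))"
      by (simp add: ennreal_mult[symmetric])
  qed
  also have "\<dots> = (\<integral>\<^sup>+y. ennreal (exp (- t * y\<^sup>2)) \<partial>std_normal)"
    by (subst nn_integral_density) auto
  finally have "ennreal (1 / c) * 1 = ennreal (1 / c) * (ennreal \<bar>c\<bar> * (\<integral>\<^sup>+y. ennreal (exp (- t * y\<^sup>2)) \<partial>std_normal))"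
    by simp
  then show ?thesis
    using c by (simp add: mult.assoc[symmetric] ennreal_mult[symmetric] c_def[symmetric])
qed

lemma nn_integral_gauss_exp:
  assumes "finite I" "t \<ge> 0"
  shows "(\<integral>\<^sup>+x. ennreal (exp (- t * (\<Sum>i\<in>I. (x i)\<^sup>2))) \<partial>gauss I) = ennreal ((1 / sqrt (1 + 2 * t)) ^ card I)"
proof -
  have "exp (- t * (\<Sum>i\<in>I. (x i)\<^sup>2)) = (\<Prod>i\<in>I. exp (- t * (x i)\<^sup>2))" for x
    by (subst exp_sum[OF assms(1), symmetric]) (simp add: sum_distrib_left sum_negf)
  then have "(\<integral>\<^sup>+x. ennreal (exp (- t * (\<Sum>i\<in>I. (x i)\<^sup>2))) \<partial>gauss I) =
      (\<integral>\<^sup>+x. (\<Prod>i\<in>I. ennreal (exp (- t * (x i)\<^sup>2))) \<partial>gauss I)"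
    by (simp add: prod_ennreal)
  also have "\<dots> = (\<Prod>i\<in>I. \<integral>\<^sup>+y. ennreal (exp (- t * y\<^sup>2)) \<partial>std_normal)"
    unfolding gauss_def by (rule sn.product_nn_integral_prod) (use assms in auto)
  also have "\<dots> = ennreal ((1 / sqrt (1 + 2 * t)) ^ card I)"
    by (subst nn_integral_std_normal_exp) (use assms in \<open>auto simp: ennreal_power\<close>)
  finally show ?thesis .
qed

lemma AE_gauss_component_nonzero:
  assumes "finite I" "i \<in> I"
  shows "AE x in gauss I. x i \<noteq> 0"
proof -
  have "(\<integral>\<^sup>+x. indicator {0} (x i) \<partial>gauss I) = (\<integral>\<^sup>+y. indicator {0} y \<partial>std_normal)"
    by (rule nn_integral_gauss_component[OF assms]) auto
  also have "\<dots> = (\<integral>\<^sup>+y. ennreal (std_normal_density y) * indicator {0} y \<partial>lborel)"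
    by (subst nn_integral_density) auto
  also have "\<dots> = 0"
    by (subst nn_integral_0_iff_AE) (use AE_lborel_singleton[of 0] in auto)
  finally have "AE x in gauss I. indicator {0} (x i) = (0 :: ennreal)"
    by (subst (asm) nn_integral_0_iff_AE) (use assms in measurable)
  then show ?thesis by eventually_elim (auto simp: indicator_def split: if_splits)
qed

text \<open>The Gamma integral, rescaled. It writes a negative power of \<open>S\<close> as a
  mixture of exponentials \<open>exp (- t * S)\<close>, whose Gaussian expectations factor over the
  coordinates.\<close>

lemma nn_integral_power_exp_Ici:
  assumes "S > 0"
  shows "(\<integral>\<^sup>+t. ennreal (t ^ s * exp (- t * S)) * indicator {0..} t \<partial>lborel) =
    ennreal (fact s / S ^ Suc s)"
proof -
  have "ennreal (fact s) = (\<integral>\<^sup>+t. ennreal (t ^ s * exp (- t)) * indicator {0..} t \<partial>lborel)"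
    using nn_intergal_power_times_exp_Ici[of s] by simp
  also have "\<dots> = ennreal \<bar>S\<bar> * (\<integral>\<^sup>+t. ennreal ((0 + S * t) ^ s * exp (- (0 + S * t))) * indicator {0..} (0 + S * t) \<partial>lborel)"
    using assms by (intro nn_integral_real_affine) auto
  also have "(\<integral>\<^sup>+t. ennreal ((0 + S * t) ^ s * exp (- (0 + S * t))) * indicator {0..} (0 + S * t) \<partial>lborel) =
      (\<integral>\<^sup>+t. ennreal (S ^ s) * (ennreal (t ^ s * exp (- t * S)) * indicator {0..} t) \<partial>lborel)"
    using assms
    by (intro nn_integral_cong)
      (auto simp: indicator_def power_mult_distrib ennreal_mult[symmetric] mult_ac zero_le_mult_iff)
  also have "\<dots> = ennreal (S ^ s) * (\<integral>\<^sup>+t. ennreal (t ^ s * exp (- t * S)) * indicator {0..} t \<partial>lborel)"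
    by (rule nn_integral_cmult) measurable
  finally have "ennreal (1 / S ^ Suc s) * ennreal (fact s) = ennreal (1 / S ^ Suc s) *
      (ennreal \<bar>S\<bar> * (ennreal (S ^ s) * (\<integral>\<^sup>+t. ennreal (t ^ s * exp (- t * S)) * indicator {0..} t \<partial>lborel)))"
    by simp
  then show ?thesis
    using assms by (simp add: mult.assoc[symmetric] ennreal_mult[symmetric])
qed

text \<open>A Beta integral, evaluated by recursion. Multiplying the integrand by
  \<open>(1 + 2 * t) / (1 + 2 * t)\<close> expresses the value at \<open>(s, \<nu> - 2)\<close>
  through those at \<open>(s + 1, \<nu>)\<close> and \<open>(s, \<nu>)\<close>, so the induction on
  \<open>s\<close> keeps \<open>\<nu>\<close> arbitrary. The hypothesis is exactly convergence at
  infinity.\<close>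

lemma nn_integral_power_inverse_sqrt:
  assumes "2 * s + 3 \<le> \<nu>"
  shows "(\<integral>\<^sup>+t. ennreal (t ^ s * (1 / sqrt (1 + 2 * t)) ^ \<nu>) * indicator {0..} t \<partial>lborel) =
    ennreal (fact s / (\<Prod>i<Suc s. real \<nu> - 2 - 2 * real i))"
  using assms
proof (induction s arbitrary: \<nu>)
  case 0
  let ?F = "\<lambda>t. - ((1 + 2 * t) powr (- (real \<nu> - 2) / 2) / (real \<nu> - 2))"
  have nu: "real \<nu> - 2 > 0" using 0 by simp
  have eq: "(1 / sqrt (1 + 2 * t)) ^ \<nu> = (1 + 2 * t) powr (- real \<nu> / 2)" if "t \<ge> 0" for t :: real
  proof -
    have "1 / sqrt (1 + 2 * t) = (1 + 2 * t) powr (- (1 / 2))"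
      using that by (simp add: powr_half_sqrt powr_minus_divide)
    then show ?thesis using that by (simp add: powr_power)
  qed
  have "(\<integral>\<^sup>+t. ennreal (t ^ 0 * (1 / sqrt (1 + 2 * t)) ^ \<nu>) * indicator {0..} t \<partial>lborel) =
      (\<integral>\<^sup>+t. ennreal ((1 + 2 * t) powr (- real \<nu> / 2)) * indicator {0..} t \<partial>lborel)"
    by (intro nn_integral_cong) (auto simp: eq indicator_def)
  also have "\<dots> = ennreal (0 - ?F 0)"
  proof (rule nn_integral_FTC_atLeast)
    show "((\<lambda>t. ?F t) \<longlongrightarrow> 0) at_top"
    proof -
      have "filterlim (\<lambda>t::real. 1 + 2 * t) at_top at_top"
        by (intro filterlim_tendsto_add_at_top[OF tendsto_const] filterlim_tendsto_pos_mult_at_top[OF tendsto_const]) (auto simp: filterlim_ident)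
      then have "((\<lambda>t::real. (1 + 2 * t) powr (- (real \<nu> - 2) / 2)) \<longlongrightarrow> 0) at_top"
        using nu by (intro tendsto_neg_powr) auto
      from tendsto_minus[OF tendsto_divide[OF this tendsto_const, of "real \<nu> - 2"]] nu show ?thesis by simp
    qed
    fix t :: real assume t: "0 \<le> t"
    have "((\<lambda>t. (1 + 2 * t) powr (- (real \<nu> - 2) / 2)) has_real_derivative
        (- (real \<nu> - 2) / 2) * (1 + 2 * t) powr (- (real \<nu> - 2) / 2 - of_nat 1) * 2) (at t)"
      using t by (intro DERIV_fun_powr) (auto intro!: derivative_eq_intros)
    from DERIV_minus[OF DERIV_cdivide[OF this, of "real \<nu> - 2"]]
    have "(?F has_real_derivative - ((- (real \<nu> - 2) / 2) * (1 + 2 * t) powr (- (real \<nu> - 2) / 2 - 1) * 2) / (real \<nu> - 2)) (at t)"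
      by simp
    moreover have "- ((- (real \<nu> - 2) / 2) * (1 + 2 * t) powr (- (real \<nu> - 2) / 2 - 1) * 2) / (real \<nu> - 2) = (1 + 2 * t) powr (- real \<nu> / 2)"
    proof -
      have "- (real \<nu> - 2) / 2 - 1 = - real \<nu> / 2" by (simp add: field_simps)
      moreover have "- ((- (real \<nu> - 2) / 2) * x * 2) / (real \<nu> - 2) = x" for x
        using nu by (simp add: field_simps)
      ultimately show ?thesis by metis
    qed
    ultimately show "(?F has_real_derivative (1 + 2 * t) powr (- real \<nu> / 2)) (at t)" by simp
  qed auto
  finally show ?case using nu by simp
next
  case (Suc s)
  let ?y = "\<lambda>t. 1 / sqrt (1 + 2 * t)"
  let ?g = "\<lambda>s \<nu> t. ennreal (t ^ s * ?y t ^ \<nu>) * indicator {0..} t"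
  let ?I = "\<lambda>s \<nu>. \<integral>\<^sup>+t. ?g s \<nu> t \<partial>lborel"
  let ?P = "\<Prod>i<s. real \<nu> - 2 - 2 * real (Suc i)"
  let ?B = "real \<nu> - 2 - 2 * real (Suc s)"
  have lin: "ennreal (2 * a + b) = 2 * ennreal a + ennreal b" if "0 \<le> a" "0 \<le> b" for a b
    using that by (simp add: ennreal_mult')
  \<comment> \<open>In \<open>ennreal\<close> a summand cancels only when it is finite; here it is
    the value at \<open>(s, \<nu>)\<close>, known from the induction hypothesis.\<close>
  have cancel: "a = b" if "2 * a + ennreal c = 2 * b + ennreal c" for a b c
    using that by (simp add: ennreal_add_left_cancel add.commute[of _ "ennreal c"] ennreal_mult_cancel_left)
  have pos: "?B > 0" "real \<nu> - 2 > 0" using Suc.prems by auto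
  have P: "?P > 0" using Suc.prems by (intro prod_pos) auto
  obtain \<mu> where \<mu>: "\<nu> = \<mu> + 2"
    using Suc.prems by (intro that[of "\<nu> - 2"]) simp
  have "?I s \<mu> =
     (\<integral>\<^sup>+t. 2 * (?g (Suc s) \<nu> t) + ?g s \<nu> t \<partial>lborel)"
  proof (intro nn_integral_cong)
    fix t :: real
    show "?g s \<mu> t =
       2 * (?g (Suc s) \<nu> t) + ?g s \<nu> t"
    proof (cases "t \<ge> 0")
      case True
      have "(1 + 2 * t) * ?y t ^ 2 = 1" using True by (simp add: power_divide)
      then have "t ^ s * ?y t ^ \<mu> = t ^ s * ?y t ^ \<mu> * ((1 + 2 * t) * ?y t ^ 2)" by simp
      also have "\<dots> = 2 * (t ^ Suc s * ?y t ^ \<nu>) + t ^ s * ?y t ^ \<nu>"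
        unfolding \<mu> power_add by (simp add: algebra_simps)
      finally show ?thesis
        using True lin[of "t ^ Suc s * ?y t ^ \<nu>" "t ^ s * ?y t ^ \<nu>"] by simp
    qed simp
  qed
  also have "\<dots> = 2 * ?I (Suc s) \<nu> +
      ?I s \<nu>"
    by (subst nn_integral_add) (auto simp: nn_integral_cmult)
  also have "?I s \<nu> = ennreal (fact s / ((real \<nu> - 2) * ?P))"
    using Suc.prems by (subst Suc.IH) (auto simp: prod.lessThan_Suc_shift simp del: prod.lessThan_Suc)
  also have "?I s \<mu> = ennreal (fact s / (?P * ?B))"
  proof -
    have "(\<Prod>i<Suc s. real \<mu> - 2 - 2 * real i) = ?P * ?B"
      by (simp add: \<mu> algebra_simps)
    then show ?thesis using Suc.prems \<mu> by (subst Suc.IH) auto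
  qed
  also have "fact s / (?P * ?B) = 2 * (fact (Suc s) / ((real \<nu> - 2) * ?P * ?B)) + fact s / ((real \<nu> - 2) * ?P)"
  proof -
    have "F / (p * b) = 2 * (S * F / (A * p * b)) + F / (A * p)"
      if "A = 2 * S + b" "A > 0" "b > 0" "p > 0" for A b p F S :: real
    proof -
      have "F / (p * b) = (F * A) / (A * p * b)" using that(2) by simp
      also have "F * A = 2 * (S * F) + F * b" unfolding that(1) by (simp add: algebra_simps)
      finally show ?thesis using that(3) by (simp add: add_divide_distrib)
    qed
    from this[of "real \<nu> - 2" "real (Suc s)" ?B ?P "fact s"] pos P show ?thesis
      unfolding fact_Suc by simp
  qed
  also have "ennreal \<dots> = 2 * ennreal (fact (Suc s) / ((real \<nu> - 2) * ?P * ?B)) + ennreal (fact s / ((real \<nu> - 2) * ?P))"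
  proof -
    have "0 \<le> fact (Suc s) / ((real \<nu> - 2) * ?P * ?B)" "0 \<le> fact s / ((real \<nu> - 2) * ?P)"
      using pos P by (intro divide_nonneg_nonneg mult_nonneg_nonneg; force)+
    then show ?thesis by (rule lin)
  qed
  finally have "?I (Suc s) \<nu> =
      ennreal (fact (Suc s) / ((real \<nu> - 2) * ?P * ?B))"
    by (rule cancel[OF sym])
  also have "(real \<nu> - 2) * ?P * ?B = (\<Prod>i<Suc (Suc s). real \<nu> - 2 - 2 * real i)"
    by (subst prod.lessThan_Suc_shift) simp
  finally show ?case .
qed

text \<open>The Gamma integral is inserted for the negative power and exchanged with the
  expectation, leaving \<open>nn_integral_gauss_exp\<close> inside the integral over
  \<open>t\<close>. The exponent is \<open>Suc s\<close> because the weight \<open>t ^ s\<close>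
  yields the power \<open>- (s + 1)\<close>. The origin, where \<open>inverse\<close> is infinite,
  is a null set.\<close>

lemma nn_integral_gauss_inverse_chi_aux:
  assumes fin: "finite I" and "2 * s + 3 \<le> card I"
  shows "(\<integral>\<^sup>+x. inverse (ennreal (\<Sum>i\<in>I. (x i)\<^sup>2)) ^ Suc s \<partial>gauss I) =
     ennreal (1 / (\<Prod>i<Suc s. real (card I) - 2 - 2 * real i))"
proof -
  let ?S = "\<lambda>x. \<Sum>i\<in>I. (x i)\<^sup>2"
  have "I \<noteq> {}" using assms by auto
  then obtain i where i: "i \<in> I" by auto
  interpret g: prob_space "gauss I" by (rule prob_space_gauss)
  interpret pair_sigma_finite "gauss I" "lborel :: real measure"
    by standard
  have "(\<integral>\<^sup>+x. inverse (ennreal (?S x)) ^ Suc s \<partial>gauss I) =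
      (\<integral>\<^sup>+x. ennreal (1 / fact s) * (\<integral>\<^sup>+t. ennreal (t ^ s * exp (- t * ?S x)) * indicator {0..} t \<partial>lborel) \<partial>gauss I)"
  proof (rule nn_integral_cong_AE)
    show "AE x in gauss I. inverse (ennreal (?S x)) ^ Suc s =
      ennreal (1 / fact s) * (\<integral>\<^sup>+t. ennreal (t ^ s * exp (- t * ?S x)) * indicator {0..} t \<partial>lborel)"
      using AE_gauss_component_nonzero[OF fin i]
    proof eventually_elim
      case (elim x)
      have "0 < (x i)\<^sup>2" using elim by simp
      also have "\<dots> \<le> ?S x" by (rule member_le_sum) (use i fin in auto)
      finally have S: "?S x > 0" .
      then show ?case
        unfolding nn_integral_power_exp_Ici[OF S]
        by (simp add: inverse_ennreal ennreal_power ennreal_mult[symmetric] power_inverse[symmetric] divide_simps del: power_Suc)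
    qed
  qed
  also have "\<dots> = ennreal (1 / fact s) * (\<integral>\<^sup>+x. (\<integral>\<^sup>+t. ennreal (t ^ s * exp (- t * ?S x)) * indicator {0..} t \<partial>lborel) \<partial>gauss I)"
    by (rule nn_integral_cmult) measurable
  also have "(\<integral>\<^sup>+x. (\<integral>\<^sup>+t. ennreal (t ^ s * exp (- t * ?S x)) * indicator {0..} t \<partial>lborel) \<partial>gauss I) =
      (\<integral>\<^sup>+t. (\<integral>\<^sup>+x. ennreal (t ^ s * exp (- t * ?S x)) * indicator {0..} t \<partial>gauss I) \<partial>lborel)"
    by (rule Fubini'[symmetric]) measurable
  also have "\<dots> = (\<integral>\<^sup>+t. ennreal (t ^ s * (1 / sqrt (1 + 2 * t)) ^ card I) * indicator {0..} t \<partial>lborel)"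
  proof (intro nn_integral_cong)
    fix t :: real
    show "(\<integral>\<^sup>+x. ennreal (t ^ s * exp (- t * ?S x)) * indicator {0..} t \<partial>gauss I) =
        ennreal (t ^ s * (1 / sqrt (1 + 2 * t)) ^ card I) * indicator {0..} t"
    proof (cases "t \<ge> 0")
      case True
      have "(\<integral>\<^sup>+x. ennreal (t ^ s * exp (- t * ?S x)) * indicator {0..} t \<partial>gauss I) =
         (\<integral>\<^sup>+x. ennreal (t ^ s) * ennreal (exp (- t * ?S x)) \<partial>gauss I)"
        using True by (simp add: ennreal_mult)
      also have "\<dots> = ennreal (t ^ s) * (\<integral>\<^sup>+x. ennreal (exp (- t * ?S x)) \<partial>gauss I)"
        by (rule nn_integral_cmult) measurable
      finally show ?thesis
        using True by (simp add: nn_integral_gauss_exp[OF fin True, simplified] ennreal_mult)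
    qed simp
  qed
  also have "\<dots> = ennreal (fact s / (\<Prod>i<Suc s. real (card I) - 2 - 2 * real i))"
    by (rule nn_integral_power_inverse_sqrt[OF assms(2)])
  also have "ennreal (1 / fact s) * \<dots> = ennreal (1 / (\<Prod>i<Suc s. real (card I) - 2 - 2 * real i))"
    by (subst ennreal_mult'[symmetric]) simp_all
  finally show ?thesis .
qed

lemma nn_integral_gauss_inverse_chi:
  assumes "finite I" "J \<subseteq> I" "1 \<le> s" "2 * s + 1 \<le> card J"
  shows "(\<integral>\<^sup>+x. inverse (ennreal (\<Sum>i\<in>J. (x i)\<^sup>2)) ^ s \<partial>gauss I) =
     ennreal (1 / (\<Prod>i<s. real (card J) - 2 - 2 * real i))"
proof -
  obtain s' where s: "s = Suc s'" using assms(3) by (cases s) auto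
  have "(\<integral>\<^sup>+x. inverse (ennreal (\<Sum>i\<in>J. (x i)\<^sup>2)) ^ s \<partial>gauss I) =
      (\<integral>\<^sup>+x. inverse (ennreal (\<Sum>i\<in>J. (restrict x J i)\<^sup>2)) ^ s \<partial>gauss I)"
    by simp
  also have "\<dots> = (\<integral>\<^sup>+x. inverse (ennreal (\<Sum>i\<in>J. (x i)\<^sup>2)) ^ s \<partial>gauss J)"
    by (rule nn_integral_gauss_restrict[OF assms(1,2)]) measurable
  also have "\<dots> = ennreal (1 / (\<Prod>i<s. real (card J) - 2 - 2 * real i))"
    unfolding s by (rule nn_integral_gauss_inverse_chi_aux) (use assms s finite_subset in auto)
  finally show ?thesis .
qed

section \<open>The right inverse of a Gaussian matrix\<close>

lemma mult_mat_index_sum: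
  assumes "A \<in> carrier_mat n m" "B \<in> carrier_mat m q" "i < n" "j < q"
  shows "(A * B) $$ (i, j) = (\<Sum>t<m. A $$ (i, t) * B $$ (t, j))"
  using assms by (auto simp: scalar_prod_def lessThan_atLeast0 intro!: sum.cong)

lemma mult_mat_vec_index_sum:
  assumes "A \<in> carrier_mat n m" "v \<in> carrier_vec m" "i < n"
  shows "vec_index (A *\<^sub>v v) i = (\<Sum>t<m. A $$ (i, t) * vec_index v t)"
  using assms by (auto simp: scalar_prod_def lessThan_atLeast0 intro!: sum.cong)

definition gram :: "nat \<Rightarrow> nat \<Rightarrow> (nat \<times> nat \<Rightarrow> real) \<Rightarrow> real mat" where
  "gram k d G = mat k k (\<lambda>(i, j). \<Sum>l<d. G (i, l) * G (j, l))"

text \<open>The pseudoinverse \<open>G\<^sup>T (G G\<^sup>T)\<^sup>-\<^sup>1\<close> of the first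
  \<open>k\<close> rows. The adjugate over the determinant makes the entries rational functions of
  \<open>G\<close>, hence measurable, and gives \<open>0\<close> when the Gram matrix is
  singular.\<close>

definition rinv :: "nat \<Rightarrow> nat \<Rightarrow> (nat \<times> nat \<Rightarrow> real) \<Rightarrow> nat \<Rightarrow> nat \<Rightarrow> real" where
  "rinv k d G l j =
    (\<Sum>i<k. G (i, l) * (adj_mat (gram k d G) $$ (i, j) / Determinant.det (gram k d G)))"

lemma gram_carrier [simp]: "gram k d G \<in> carrier_mat k k"
  by (simp add: gram_def)

lemma gram_dim [simp]: "dim_row (gram k d G) = k" "dim_col (gram k d G) = k"
  by (simp_all add: gram_def)

lemma rinv_cong:
  assumes "\<And>i l. i < k \<Longrightarrow> l < d \<Longrightarrow> G (i, l) = H (i, l)" "l < d"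
  shows "rinv k d G l j = rinv k d H l j"
proof -
  have "gram k d G = gram k d H"
    using assms by (auto simp: gram_def intro!: eq_matI)
  then show ?thesis using assms by (simp add: rinv_def)
qed

lemma gram_cong:
  assumes "\<And>i l. i < k \<Longrightarrow> l < d \<Longrightarrow> G (i, l) = H (i, l)"
  shows "gram k d G = gram k d H"
  using assms by (auto simp: gram_def intro!: eq_matI)

lemma gram_adj:
  assumes "i < k" "j < k"
  shows "(\<Sum>i'<k. (\<Sum>l<d. G (i, l) * G (i', l)) * adj_mat (gram k d G) $$ (i', j)) =
    (if i = j then Determinant.det (gram k d G) else 0)"
proof -
  let ?M = "gram k d G"
  have c: "adj_mat ?M \<in> carrier_mat k k" by (rule adj_mat(1)) simp
  have "(?M * adj_mat ?M) $$ (i, j) = (\<Sum>i'<k. ?M $$ (i, i') * adj_mat ?M $$ (i', j))"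
    using assms c by (intro mult_mat_index_sum) auto
  also have "\<dots> = (\<Sum>i'<k. (\<Sum>l<d. G (i, l) * G (i', l)) * adj_mat ?M $$ (i', j))"
    using assms by (intro sum.cong) (auto simp: gram_def)
  finally show ?thesis
    unfolding adj_mat(2)[OF gram_carrier] using assms by auto
qed

lemma rinv_right_inverse:
  assumes "Determinant.det (gram k d G) \<noteq> 0" "i < k" "j < k"
  shows "(\<Sum>l<d. G (i, l) * rinv k d G l j) = (if i = j then 1 else 0)"
proof -
  let ?D = "Determinant.det (gram k d G)"
  have "(\<Sum>l<d. G (i, l) * rinv k d G l j) =
      (\<Sum>l<d. \<Sum>i'<k. G (i, l) * G (i', l) * adj_mat (gram k d G) $$ (i', j) / ?D)"
    by (simp add: rinv_def sum_distrib_left mult_ac)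
  also have "\<dots> = (\<Sum>i'<k. (\<Sum>l<d. G (i, l) * G (i', l)) * adj_mat (gram k d G) $$ (i', j)) / ?D"
    by (subst sum.swap) (simp add: sum_distrib_right sum_divide_distrib)
  also have "\<dots> = (if i = j then 1 else 0)"
    using assms by (simp add: gram_adj)
  finally show ?thesis .
qed

text \<open>The quadratic form of the Gram matrix at \<open>v\<close> is the squared norm of the
  combination of rows with coefficients \<open>v\<close>, so a kernel vector is a linear relation
  between the rows.\<close>

lemma det_gram_0_iff:
  "Determinant.det (gram k d G) = 0 \<longleftrightarrow>
    (\<exists>v. (\<exists>i<k. v i \<noteq> 0) \<and> (\<forall>l<d. (\<Sum>i<k. v i * G (i, l)) = 0))"
proof
  assume "Determinant.det (gram k d G) = 0"
  then obtain v where v: "v \<in> carrier_vec k" "v \<noteq> 0\<^sub>v k" "gram k d G *\<^sub>v v = 0\<^sub>v k"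
    unfolding det_0_iff_vec_prod_zero_field[OF gram_carrier] by blast
  let ?v = "\<lambda>i. vec_index v i"
  have "(\<Sum>l<d. (\<Sum>i<k. ?v i * G (i, l))\<^sup>2) = 0"
  proof -
    have "(\<Sum>l<d. (\<Sum>i<k. ?v i * G (i, l))\<^sup>2) =
        (\<Sum>l<d. \<Sum>i<k. \<Sum>j<k. ?v i * (G (i, l) * G (j, l) * ?v j))"
      by (simp add: power2_eq_square sum_product mult_ac)
    also have "\<dots> = (\<Sum>i<k. ?v i * (\<Sum>j<k. (\<Sum>l<d. G (i, l) * G (j, l)) * ?v j))"
      by (subst sum.swap, rule sum.cong[OF refl], subst sum.swap)
        (simp add: sum_distrib_left sum_distrib_right)
    also have "\<dots> = (\<Sum>i<k. ?v i * vec_index (gram k d G *\<^sub>v v) i)"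
    proof (intro sum.cong refl)
      fix i assume i: "i \<in> {..<k}"
      have "vec_index (gram k d G *\<^sub>v v) i = (\<Sum>j<k. gram k d G $$ (i, j) * ?v j)"
        using i v(1) by (intro mult_mat_vec_index_sum) auto
      also have "\<dots> = (\<Sum>j<k. (\<Sum>l<d. G (i, l) * G (j, l)) * ?v j)"
        using i by (intro sum.cong) (auto simp: gram_def)
      finally show "?v i * (\<Sum>j<k. (\<Sum>l<d. G (i, l) * G (j, l)) * ?v j) =
          ?v i * vec_index (gram k d G *\<^sub>v v) i" by simp
    qed
    also have "\<dots> = 0" by (simp add: v(3))
    finally show ?thesis .
  qed
  then have "\<forall>l<d. (\<Sum>i<k. ?v i * G (i, l)) = 0"
    by (subst (asm) sum_nonneg_eq_0_iff) auto
  moreover have "\<exists>i<k. ?v i \<noteq> 0"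
  proof (rule ccontr)
    assume "\<not> ?thesis"
    then have "v = 0\<^sub>v k" using v(1) by (intro eq_vecI) auto
    then show False using v(2) by simp
  qed
  ultimately show "\<exists>v. (\<exists>i<k. v i \<noteq> 0) \<and> (\<forall>l<d. (\<Sum>i<k. v i * G (i, l)) = 0)"
    by blast
next
  assume "\<exists>v. (\<exists>i<k. v i \<noteq> 0) \<and> (\<forall>l<d. (\<Sum>i<k. v i * G (i, l)) = 0)"
  then obtain v i0 where v: "i0 < k" "v i0 \<noteq> 0" "\<And>l. l < d \<Longrightarrow> (\<Sum>i<k. v i * G (i, l)) = 0" by auto
  show "Determinant.det (gram k d G) = 0"
    unfolding det_0_iff_vec_prod_zero_field[OF gram_carrier]
  proof (intro exI conjI)
    show "vec k v \<in> carrier_vec k" by simp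
    show "vec k v \<noteq> 0\<^sub>v k"
    proof
      assume "vec k v = 0\<^sub>v k"
      then have "vec_index (vec k v) i0 = vec_index (0\<^sub>v k) i0" by simp
      then show False using v by simp
    qed
    show "gram k d G *\<^sub>v vec k v = 0\<^sub>v k"
    proof (rule eq_vecI)
      fix i assume i: "i < dim_vec (0\<^sub>v k :: real vec)"
      have "vec_index (gram k d G *\<^sub>v vec k v) i = (\<Sum>j<k. gram k d G $$ (i, j) * v j)"
        using i by (subst mult_mat_vec_index_sum[of _ k k]) auto
      also have "\<dots> = (\<Sum>j<k. \<Sum>l<d. G (i, l) * (v j * G (j, l)))"
        using i by (intro sum.cong) (auto simp: gram_def sum_distrib_left sum_distrib_right mult_ac)
      also have "\<dots> = (\<Sum>l<d. G (i, l) * (\<Sum>j<k. v j * G (j, l)))"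
        by (subst sum.swap) (simp add: sum_distrib_left)
      also have "\<dots> = 0" by (simp add: v)
      finally show "vec_index (gram k d G *\<^sub>v vec k v) i = vec_index (0\<^sub>v k) i"
        using i by simp
    qed simp
  qed
qed

lemma borel_measurable_det:
  assumes "\<And>i j. i < n \<Longrightarrow> j < n \<Longrightarrow> (\<lambda>x. F x i j) \<in> borel_measurable M"
  shows "(\<lambda>x. Determinant.det (mat n n (\<lambda>(i, j). F x i j)) :: real) \<in> borel_measurable M"
proof -
  have "Determinant.det (mat n n (\<lambda>(i, j). F x i j)) =
      (\<Sum>p\<in>{p. p permutes {0..<n}}. signof p * (\<Prod>i = 0..<n. F x i (p i)))" for x
  proof (subst det_def'[where n = n])
    have "p i < n" if "p permutes {0..<n}" "i < n" for p i
      using that permutes_in_image[of p "{0..<n}" i] by simp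
    then show "(\<Sum>p\<in>{p. p permutes {0..<n}}. signof p * (\<Prod>i = 0..<n. mat n n (\<lambda>(i, j). F x i j) $$ (i, p i))) =
        (\<Sum>p\<in>{p. p permutes {0..<n}}. signof p * (\<Prod>i = 0..<n. F x i (p i)))"
      by (intro sum.cong refl arg_cong2[where f = "(*)"] prod.cong) simp_all
  qed simp
  moreover have "(\<lambda>x. \<Sum>p\<in>{p. p permutes {0..<n}}. signof p * (\<Prod>i = 0..<n. F x i (p i))) \<in> borel_measurable M"
    by (intro borel_measurable_sum borel_measurable_times borel_measurable_const borel_measurable_prod assms)
      (auto simp: permutes_in_image)
  ultimately show ?thesis by simp
qed

lemma measurable_entry: "(i, l) \<in> I \<Longrightarrow> (\<lambda>G. G (i, l)) \<in> borel_measurable (borels I)"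
  by measurable

lemma borel_measurable_gram_det:
  assumes "{..<k} \<times> {..<d} \<subseteq> I"
  shows "(\<lambda>G. Determinant.det (gram k d G)) \<in> borel_measurable (borels I)"
  unfolding gram_def
  by (intro borel_measurable_det borel_measurable_sum borel_measurable_times measurable_entry)
    (use assms in auto)

lemma borel_measurable_gram_adj:
  assumes "{..<k} \<times> {..<d} \<subseteq> I" "i < k" "j < k"
  shows "(\<lambda>G. adj_mat (gram k d G) $$ (i, j)) \<in> borel_measurable (borels I)"
proof -
  let ?s = "\<lambda>a i. if i < a then i else Suc i"
  have "adj_mat (gram k d G) $$ (i, j) = (-1) ^ (j + i) *
      Determinant.det (mat (k - 1) (k - 1) (\<lambda>(a, b). \<Sum>l<d. G (?s j a, l) * G (?s i b, l)))" for G
  proof -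
    have "mat_delete (gram k d G) j i = mat (k - 1) (k - 1) (\<lambda>(a, b). \<Sum>l<d. G (?s j a, l) * G (?s i b, l))"
      using assms(2,3) by (intro eq_matI) (auto simp: mat_delete_def gram_def)
    then show ?thesis
      using assms(2,3) by (simp add: adj_mat_def Determinant.cofactor_def)
  qed
  moreover have "(\<lambda>G :: nat \<times> nat \<Rightarrow> real. Determinant.det (mat (k - 1) (k - 1) (\<lambda>(a, b). \<Sum>l<d. G (?s j a, l) * G (?s i b, l))))
      \<in> borel_measurable (borels I)"
    by (intro borel_measurable_det borel_measurable_sum borel_measurable_times measurable_entry)
      (use assms in auto)
  ultimately show ?thesis
    by (simp only: borel_measurable_times borel_measurable_const)
qed

lemma borel_measurable_rinv:
  assumes "{..<k} \<times> {..<d} \<subseteq> I" "l < d" "j < k"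
  shows "(\<lambda>G. rinv k d G l j) \<in> borel_measurable (borels I)"
  unfolding rinv_def
  by (intro borel_measurable_sum borel_measurable_times borel_measurable_divide measurable_entry
      borel_measurable_gram_det borel_measurable_gram_adj) (use assms in auto)

section \<open>Column rotations, independent row blocks and almost sure full rank\<close>

lemma orth_on_transpose:
  fixes n :: nat
  assumes "orth_on {..<n} a"
  shows "orth_on {..<n} (\<lambda>i j. a j i)"
proof -
  define A where "A = mat n n (\<lambda>(i, j). a i j)"
  have A: "A \<in> carrier_mat n n" "A\<^sup>T \<in> carrier_mat n n"
    by (simp_all add: A_def)
  have ix: "A $$ (i, j) = a i j" "A\<^sup>T $$ (i, j) = a j i" if "i < n" "j < n" for i j
    using that by (simp_all add: A_def)
  have "A\<^sup>T * A = 1\<^sub>m n"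
  proof (rule eq_matI)
    fix i j assume "i < dim_row (1\<^sub>m n :: real mat)" "j < dim_col (1\<^sub>m n :: real mat)"
    then have ij: "i < n" "j < n" by simp_all
    have "(A\<^sup>T * A) $$ (i, j) = (\<Sum>t<n. a t i * a t j)"
      unfolding mult_mat_index_sum[OF A(2,1) ij] using ij by (intro sum.cong) (simp_all add: ix)
    also have "\<dots> = 1\<^sub>m n $$ (i, j)"
      using assms[unfolded orth_on_def, rule_format, of i j] ij by simp
    finally show "(A\<^sup>T * A) $$ (i, j) = 1\<^sub>m n $$ (i, j)" .
  qed (use A in auto)
  then have AA: "A * A\<^sup>T = 1\<^sub>m n"
    by (intro mat_mult_left_right_inverse[OF A(2,1)])
  have "(\<Sum>t<n. a i t * a j t) = (if i = j then 1 else 0)" if ij: "i < n" "j < n" for i j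
  proof -
    have "(\<Sum>t<n. a i t * a j t) = (\<Sum>t<n. A $$ (i, t) * A\<^sup>T $$ (t, j))"
      using ij by (intro sum.cong) (simp_all add: ix)
    also have "\<dots> = 1\<^sub>m n $$ (i, j)"
      unfolding mult_mat_index_sum[OF A ij, symmetric] AA ..
    finally show ?thesis using ij by simp
  qed
  then show ?thesis by (simp add: orth_on_def)
qed

text \<open>The counterpart of \<open>row_block\<close>: left multiplication
  \<open>x \<mapsto> a x\<close>, which mixes the rows within each column.\<close>

definition col_block :: "('k \<Rightarrow> 'k \<Rightarrow> real) \<Rightarrow> 'k \<times> 'l \<Rightarrow> 'k \<times> 'l \<Rightarrow> real" where
  "col_block a = (\<lambda>(i, l) (i', l'). if l = l' then a i i' else 0)"

lemma orth_on_col_block: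
  fixes K :: "'k set" and D :: "'l set"
  assumes "finite K" "finite D" "orth_on K a"
  shows "orth_on (K \<times> D) (col_block a)"
  unfolding orth_on_def
proof (intro ballI)
  fix x y :: "'k \<times> 'l" assume xy: "x \<in> K \<times> D" "y \<in> K \<times> D"
  obtain i l i' l' where [simp]: "x = (i, l)" "y = (i', l')" by fastforce
  have "(\<Sum>z\<in>K\<times>D. col_block a z x * col_block a z y) =
      (\<Sum>j\<in>K. \<Sum>m\<in>D. (if m = l then a j i else 0) * (if m = l' then a j i' else 0))"
    by (simp add: sum.cartesian_product col_block_def case_prod_beta cong: if_cong)
  also have "\<dots> = (\<Sum>m\<in>D. if m = l then (if l = l' then (\<Sum>j\<in>K. a j i * a j i') else 0) else 0)"
  proof (subst sum.swap, rule sum.cong[OF refl])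
    fix m
    show "(\<Sum>j\<in>K. (if m = l then a j i else 0) * (if m = l' then a j i' else 0)) =
        (if m = l then (if l = l' then (\<Sum>j\<in>K. a j i * a j i') else 0) else 0)"
      by (cases "m = l"; cases "l = l'") simp_all
  qed
  also have "\<dots> = (if x = y then 1 else 0)"
    using assms xy by (auto simp: orth_on_def)
  finally show "(\<Sum>z\<in>K\<times>D. col_block a z x * col_block a z y) = (if x = y then 1 else 0)" .
qed

lemma lin_map_col_block:
  assumes "finite D" "i \<in> K" "l \<in> D"
  shows "lin_map (K \<times> D) (col_block a) x (i, l) = (\<Sum>j\<in>K. a i j * x (j, l))"
proof -
  have "lin_map (K \<times> D) (col_block a) x (i, l) = (\<Sum>j\<in>K. \<Sum>m\<in>D. (if l = m then a i j else 0) * x (j, m))"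
    unfolding sum.cartesian_product
    using assms by (auto simp: lin_map_def col_block_def intro!: sum.cong)
  also have "\<dots> = (\<Sum>j\<in>K. \<Sum>m\<in>D. if l = m then a i j * x (j, m) else 0)"
    by (intro sum.cong) auto
  finally show ?thesis using assms by simp
qed

text \<open>Disjoint blocks of rows are independent, so the rows in \<open>K1\<close> can be frozen
  while those in \<open>K2\<close> are integrated out.\<close>

lemma nn_integral_gauss_rows_split:
  assumes "finite K1" "finite K2" "finite D" "K1 \<inter> K2 = {}"
    and "f \<in> borel_measurable (borels ((K1 \<union> K2) \<times> D))"
  shows "(\<integral>\<^sup>+x. f x \<partial>gauss ((K1 \<union> K2) \<times> D)) =
    (\<integral>\<^sup>+x. (\<integral>\<^sup>+y. f (merge (K1 \<times> D) (K2 \<times> D) (x, y)) \<partial>gauss (K2 \<times> D)) \<partial>gauss (K1 \<times> D))"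
proof -
  have e: "(K1 \<union> K2) \<times> D = K1 \<times> D \<union> K2 \<times> D" by auto
  have f: "f \<in> borel_measurable (PiM (K1 \<times> D \<union> K2 \<times> D) (\<lambda>_. std_normal))"
    using assms(5) measurable_gauss_eq[of "K1 \<times> D \<union> K2 \<times> D"] unfolding e gauss_def by simp
  show ?thesis
    unfolding e gauss_def by (rule sn.product_nn_integral_fold[OF _ _ _ f]) (use assms in auto)
qed

text \<open>Induction on the rows. A rotation that depends only on the first \<open>k\<close> rows
  moves them into the first \<open>k\<close> coordinates. If these rows are independent and the next
  one depends on them, its rotated coordinate \<open>k\<close> vanishes, which has probability
  zero.\<close>

lemma AE_gauss_gram_det_nonzero:
  assumes "k \<le> d"
  shows "AE G in gauss ({..<k} \<times> {..<d}). Determinant.det (gram k d G) \<noteq> 0"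
  using assms
proof (induction k)
  case 0
  then show ?case using det_gram_0_iff[of 0 d] by simp
next
  case (Suc k)
  let ?I1 = "{..<k} \<times> {..<d}" and ?I2 = "{k} \<times> {..<d}"
  define f :: "(nat \<times> nat \<Rightarrow> real) \<Rightarrow> ennreal"
    where "f G = indicator {0} (Determinant.det (gram (Suc k) d G))" for G
  have rows: "{..<Suc k} = {..<k} \<union> {k}" by auto
  have fm [measurable]: "f \<in> borel_measurable (borels ({..<Suc k} \<times> {..<d}))"
    unfolding f_def using borel_measurable_gram_det[of "Suc k" d "{..<Suc k} \<times> {..<d}"] by simp
  have "(\<integral>\<^sup>+G. f G \<partial>gauss ({..<Suc k} \<times> {..<d})) =
      (\<integral>\<^sup>+x. (\<integral>\<^sup>+y. f (merge ?I1 ?I2 (x, y)) \<partial>gauss ?I2) \<partial>gauss ?I1)"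
    unfolding rows by (rule nn_integral_gauss_rows_split) (use fm rows in auto)
  also have "\<dots> = (\<integral>\<^sup>+x. 0 \<partial>gauss ?I1)"
  proof (rule nn_integral_cong_AE)
    show "AE x in gauss ?I1. (\<integral>\<^sup>+y. f (merge ?I1 ?I2 (x, y)) \<partial>gauss ?I2) = 0"
      using Suc.IH[OF Suc_leD[OF Suc.prems]]
    proof eventually_elim
      case (elim x)
      obtain a where a: "orth_on {..<d} a"
        "\<And>i j. i < k \<Longrightarrow> j < d \<Longrightarrow> j \<ge> k \<Longrightarrow> lin_map {..<d} a (\<lambda>l. x (i, l)) j = 0"
        using orth_triangular[of "{..<d}" "\<lambda>i. i" k "\<lambda>i l. x (i, l)"] Suc.prems by auto
      have kd: "k < d" using Suc.prems by simp
      have le: "f (merge ?I1 ?I2 (x, y)) \<le> indicator {0} (lin_map ?I2 (row_block a) y (k, k))" for y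
      proof (cases "f (merge ?I1 ?I2 (x, y)) = 0")
        case False
        let ?G = "merge ?I1 ?I2 (x, y)"
        have G: "?G (i, l) = (if i = k then y (k, l) else x (i, l))" if "i < Suc k" "l < d" for i l
          using that by (auto simp: merge_def)
        obtain v i0 where v: "i0 < Suc k" "v i0 \<noteq> 0" "\<And>l. l < d \<Longrightarrow> (\<Sum>i<Suc k. v i * ?G (i, l)) = 0"
          using False det_gram_0_iff[of "Suc k" d ?G] by (auto simp: f_def indicator_def split: if_splits)
        have eq: "(\<Sum>i<k. v i * x (i, l)) + v k * y (k, l) = 0" if "l < d" for l
        proof -
          have "(\<Sum>i<Suc k. v i * ?G (i, l)) = (\<Sum>i<k. v i * x (i, l)) + v k * y (k, l)"
            using that by (simp add: G)
          then show ?thesis using v(3)[OF that] by simp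
        qed
        have vk: "v k \<noteq> 0"
        proof
          assume "v k = 0"
          then have "i0 < k" "\<And>l. l < d \<Longrightarrow> (\<Sum>i<k. v i * x (i, l)) = 0"
            using v eq by (auto simp: less_Suc_eq)
          then show False using elim det_gram_0_iff[of k d x] v(2) by blast
        qed
        have "v k * lin_map ?I2 (row_block a) y (k, k) = (\<Sum>m<d. a k m * (v k * y (k, m)))"
          using kd by (simp add: lin_map_row_block sum_distrib_left mult_ac)
        also have "\<dots> = (\<Sum>m<d. a k m * (- (\<Sum>i<k. v i * x (i, m))))"
        proof (intro sum.cong refl)
          fix m assume "m \<in> {..<d}"
          then have "v k * y (k, m) = - (\<Sum>i<k. v i * x (i, m))" using eq[of m] by simp
          then show "a k m * (v k * y (k, m)) = a k m * (- (\<Sum>i<k. v i * x (i, m)))" by (simp only:)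
        qed
        also have "\<dots> = - (\<Sum>m<d. \<Sum>i<k. v i * (a k m * x (i, m)))"
          by (simp add: sum_negf sum_distrib_left mult_ac)
        also have "\<dots> = - (\<Sum>i<k. v i * lin_map {..<d} a (\<lambda>l. x (i, l)) k)"
          using kd by (subst sum.swap) (simp add: lin_map_def sum_distrib_left)
        also have "\<dots> = 0"
          using a(2) kd by simp
        finally show ?thesis using vk by (simp add: f_def indicator_def)
      qed simp
      have "(\<integral>\<^sup>+y. f (merge ?I1 ?I2 (x, y)) \<partial>gauss ?I2) \<le>
          (\<integral>\<^sup>+y. indicator {0} (lin_map ?I2 (row_block a) y (k, k)) \<partial>gauss ?I2)"
        by (intro nn_integral_mono le)
      also have "\<dots> = (\<integral>\<^sup>+y. indicator {0} (y (k, k)) \<partial>gauss ?I2)"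
        by (rule nn_integral_gauss_orth) (use a kd in \<open>auto intro!: orth_on_row_block\<close>)
      also have "\<dots> = (\<integral>\<^sup>+y. 0 \<partial>gauss ?I2)"
        using AE_gauss_component_nonzero[of ?I2 "(k, k)"] kd
        by (intro nn_integral_cong_AE) (auto elim!: eventually_mono)
      finally show ?case by simp
    qed
  qed
  finally have "(\<integral>\<^sup>+G. f G \<partial>gauss ({..<Suc k} \<times> {..<d})) = 0" by simp
  then have "AE G in gauss ({..<Suc k} \<times> {..<d}). f G = 0"
    by (subst (asm) nn_integral_0_iff_AE) (auto simp: measurable_gauss_eq fm)
  then show ?case
    by eventually_elim (auto simp: f_def indicator_def split: if_splits)
qed

text \<open>The vector \<open>w\<close> lies in the row space and is orthogonal to all rows but the
  last, so its norm is \<open>\<bar>h\<bar>\<close> over the distance of the last row from the span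
  of the others. Once the others are rotated into the first \<open>\<kappa>\<close> coordinates, the
  remaining coordinates of the last row bound this distance from below.\<close>

lemma min_norm_solution_le:
  fixes G :: "nat \<times> nat \<Rightarrow> real"
  assumes k: "\<kappa> < d" and a: "orth_on {..<d} a"
    and tri: "\<And>i j. i < \<kappa> \<Longrightarrow> \<kappa> \<le> j \<Longrightarrow> j < d \<Longrightarrow> lin_map {..<d} a (\<lambda>l. G (i, l)) j = 0"
    and w: "\<And>l. l < d \<Longrightarrow> w l = (\<Sum>i<Suc \<kappa>. x i * G (i, l))"
    and g: "\<And>i. i < \<kappa> \<Longrightarrow> (\<Sum>l<d. G (i, l) * w l) = 0" "(\<Sum>l<d. G (\<kappa>, l) * w l) = h"
  shows "ennreal (\<Sum>l<d. (w l)\<^sup>2) \<le>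
    ennreal (h\<^sup>2) * inverse (ennreal (\<Sum>j\<in>{\<kappa>..<d}. (lin_map {..<d} a (\<lambda>l. G (\<kappa>, l)) j)\<^sup>2))"
proof -
  let ?S = "\<Sum>l<d. (w l)\<^sup>2" and ?D = "\<Sum>j\<in>{\<kappa>..<d}. (lin_map {..<d} a (\<lambda>l. G (\<kappa>, l)) j)\<^sup>2"
  have "?S = (\<Sum>l<d. \<Sum>i<Suc \<kappa>. x i * (G (i, l) * w l))"
  proof (intro sum.cong refl)
    fix l assume "l \<in> {..<d}"
    then have "(w l)\<^sup>2 = (\<Sum>i<Suc \<kappa>. x i * G (i, l)) * w l"
      using w[of l] by (metis lessThan_iff power2_eq_square)
    then show "(w l)\<^sup>2 = (\<Sum>i<Suc \<kappa>. x i * (G (i, l) * w l))"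
      by (simp only: sum_distrib_right mult.assoc)
  qed
  also have "\<dots> = (\<Sum>i<Suc \<kappa>. x i * (\<Sum>l<d. G (i, l) * w l))"
    by (subst sum.swap) (simp add: sum_distrib_left)
  also have "\<dots> = x \<kappa> * h"
    using g by simp
  finally have S: "?S = x \<kappa> * h" .
  have aw: "lin_map {..<d} a w j = x \<kappa> * lin_map {..<d} a (\<lambda>l. G (\<kappa>, l)) j" if "\<kappa> \<le> j" "j < d" for j
  proof -
    have "lin_map {..<d} a w j = (\<Sum>l<d. \<Sum>i<Suc \<kappa>. x i * (a j l * G (i, l)))"
      using that by (auto simp: lin_map_def w sum_distrib_left mult_ac simp del: sum.lessThan_Suc intro!: sum.cong)
    also have "\<dots> = (\<Sum>i<Suc \<kappa>. x i * lin_map {..<d} a (\<lambda>l. G (i, l)) j)"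
      using that by (subst sum.swap) (simp add: lin_map_def sum_distrib_left)
    also have "\<dots> = x \<kappa> * lin_map {..<d} a (\<lambda>l. G (\<kappa>, l)) j"
      using tri that by simp
    finally show ?thesis .
  qed
  have "(x \<kappa>)\<^sup>2 * ?D = (\<Sum>j\<in>{\<kappa>..<d}. (lin_map {..<d} a w j)\<^sup>2)"
    by (simp add: aw sum_distrib_left power_mult_distrib)
  also have "\<dots> \<le> (\<Sum>j<d. (lin_map {..<d} a w j)\<^sup>2)"
    by (rule sum_mono2) auto
  also have "\<dots> = ?S"
    using sum_mult_lin_map[OF _ a, of w w] by (simp add: power2_eq_square)
  finally have le: "(x \<kappa>)\<^sup>2 * ?D \<le> ?S" .
  have D0: "?D \<ge> 0" and S0: "?S \<ge> 0" by (auto intro: sum_nonneg)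
  \<comment> \<open>One of the two factors \<open>S = X * h\<close> is cancelled afterwards, which
    eliminates the unknown coefficient \<open>X\<close>.\<close>
  have "S\<^sup>2 * D \<le> S * h\<^sup>2" if "S = X * h" "X\<^sup>2 * D \<le> S" for S X D :: real
    using mult_right_mono[OF that(2), of "h\<^sup>2"] that(1) by (simp add: power_mult_distrib mult_ac)
  from this[OF S le] have "?S\<^sup>2 * ?D \<le> ?S * h\<^sup>2" .
  then have SD: "?S * ?D \<le> h\<^sup>2"
    using S0 by (cases "?S = 0") (auto simp: power2_eq_square mult.assoc)
  show ?thesis
  \<comment> \<open>If the bound for the distance vanishes, the right side is infinite unless
    \<open>h = 0\<close>, and then \<open>w\<close> has norm zero.\<close>
  proof (cases "?D = 0")
    case True
    then show ?thesis
      by (cases "h = 0") (auto simp: S ennreal_mult_top zero_less_power2)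
  next
    case False
    then have D: "?D > 0" using D0 by simp
    then have "?S \<le> h\<^sup>2 / ?D" using SD by (simp add: field_simps)
    then have "ennreal ?S \<le> ennreal (h\<^sup>2 * inverse ?D)"
      by (intro ennreal_leI) (simp add: divide_inverse)
    then show ?thesis
      using D by (simp add: ennreal_mult inverse_ennreal)
  qed
qed

text \<open>A rotation of the rows makes \<open>v\<close> a multiple of the last unit vector, which
  leaves only the reciprocal distance of the last row from the other \<open>k - 1\<close> rows.
  Given those, the squared distance is at least a chi-square variable with
  \<open>d - (k - 1) = p + 1\<close> degrees of freedom.\<close>

lemma nn_integral_gauss_rinv_pow:
  assumes k: "1 \<le> k" and d: "d = k + p" and s: "1 \<le> s" "2 * s \<le> p"
  shows "(\<integral>\<^sup>+G. ennreal ((\<Sum>l<d. (\<Sum>j<k. rinv k d G l j * v j)\<^sup>2) ^ s) \<partial>gauss ({..<k} \<times> {..<d})) \<le>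
    ennreal ((\<Sum>j<k. (v j)\<^sup>2) ^ s / (\<Prod>i<s. real p - 1 - 2 * real i))"
proof -
  obtain \<kappa> where \<kappa>: "k = Suc \<kappa>" using k by (cases k) auto
  let ?I = "{..<k} \<times> {..<d}" and ?I1 = "{..<\<kappa>} \<times> {..<d}" and ?I2 = "{\<kappa>} \<times> {..<d}"
  have rows: "{..<k} = {..<\<kappa>} \<union> {\<kappa>}" using \<kappa> by auto
  have \<kappa>d: "\<kappa> < d" using d \<kappa> by simp
  define V where "V = (\<Sum>j<k. (v j)\<^sup>2)"
  have V0: "V \<ge> 0" by (simp add: V_def sum_nonneg)
  define \<Psi> where "\<Psi> G = ennreal ((\<Sum>l<d. (\<Sum>j<k. rinv k d G l j * v j)\<^sup>2) ^ s)" for G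
  have \<Psi>m: "\<Psi> \<in> borel_measurable (borels ?I)"
    unfolding \<Psi>_def
    by (intro measurable_compose[OF _ measurable_ennreal] borel_measurable_power borel_measurable_sum
        borel_measurable_times borel_measurable_rinv borel_measurable_const) auto
  obtain a where a: "orth_on {..<k} a" "\<And>i. i < \<kappa> \<Longrightarrow> lin_map {..<k} a v i = 0"
    using orth_triangular[of "{..<k}" "\<lambda>_. \<kappa>" 1 "\<lambda>_. v"] \<kappa> by (auto simp: lessThan_Suc)
  define b where "b i j = a j i" for i j
  have b: "orth_on {..<k} b" unfolding b_def by (rule orth_on_transpose[OF a(1)])
  define h where "h = lin_map {..<k} a v \<kappa>"
  have h2: "h\<^sup>2 = V"
  proof -
    have "V = (\<Sum>i<k. lin_map {..<k} a v i * lin_map {..<k} a v i)"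
      using sum_mult_lin_map[OF _ a(1), of v v] by (simp add: V_def power2_eq_square)
    also have "\<dots> = h\<^sup>2"
      using a(2) by (simp add: \<kappa> h_def power2_eq_square)
    finally show ?thesis ..
  qed
  \<comment> \<open>\<open>B G\<close> is \<open>a\<^sup>T G\<close>, so a solution of
    \<open>B G w = v\<close> solves \<open>G w = a v\<close>, and \<open>a v\<close> is
    \<open>h\<close> times the last unit vector.\<close>
  define B where "B = lin_map ?I (col_block b)"
  have Bm: "B \<in> measurable (borels ?I) (borels ?I)"
    unfolding B_def by measurable
  have key: "\<Psi> (B G) \<le> (ennreal V * inverse (ennreal (\<Sum>j\<in>{\<kappa>..<d}. (lin_map {..<d} c (\<lambda>l. G (\<kappa>, l)) j)\<^sup>2))) ^ s"
    if c: "orth_on {..<d} c" "\<And>i j. i < \<kappa> \<Longrightarrow> \<kappa> \<le> j \<Longrightarrow> j < d \<Longrightarrow> lin_map {..<d} c (\<lambda>l. G (i, l)) j = 0"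
    for G c
  proof -
    define w where "w l = (\<Sum>j<k. rinv k d (B G) l j * v j)" for l
    have BG: "B G (i, l) = (\<Sum>i'<k. a i' i * G (i', l))" if "i < k" "l < d" for i l
      using that by (simp add: B_def lin_map_col_block b_def)
    have "ennreal (\<Sum>l<d. (w l)\<^sup>2) \<le>
        ennreal V * inverse (ennreal (\<Sum>j\<in>{\<kappa>..<d}. (lin_map {..<d} c (\<lambda>l. G (\<kappa>, l)) j)\<^sup>2))"
    proof (cases "Determinant.det (gram k d (B G)) = 0")
      case True
      then show ?thesis by (simp add: w_def rinv_def)
    next
      case False
      define y where "y i = (\<Sum>j<k. adj_mat (gram k d (B G)) $$ (i, j) / Determinant.det (gram k d (B G)) * v j)" for i
      have wy: "w l = (\<Sum>i<k. B G (i, l) * y i)" for l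
      proof -
        have "w l = (\<Sum>j<k. \<Sum>i<k. B G (i, l) * (adj_mat (gram k d (B G)) $$ (i, j) / Determinant.det (gram k d (B G)) * v j))"
          by (simp add: w_def rinv_def sum_distrib_right mult.assoc)
        also have "\<dots> = (\<Sum>i<k. B G (i, l) * y i)"
          unfolding y_def by (subst sum.swap) (simp add: sum_distrib_left)
        finally show ?thesis .
      qed
      have Gw: "(\<Sum>l<d. B G (i, l) * w l) = v i" if "i < k" for i
      proof -
        have "(\<Sum>l<d. B G (i, l) * w l) = (\<Sum>l<d. \<Sum>j<k. B G (i, l) * rinv k d (B G) l j * v j)"
          by (simp add: w_def sum_distrib_left mult.assoc)
        also have "\<dots> = (\<Sum>j<k. (\<Sum>l<d. B G (i, l) * rinv k d (B G) l j) * v j)"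
          by (subst sum.swap) (simp add: sum_distrib_right)
        also have "\<dots> = (\<Sum>j<k. if i = j then v j else 0)"
          using that False by (intro sum.cong) (auto simp: rinv_right_inverse)
        finally show ?thesis using that by simp
      qed
      define x where "x i' = (\<Sum>i<k. a i' i * y i)" for i'
      have wx: "w l = (\<Sum>i<Suc \<kappa>. x i * G (i, l))" if "l < d" for l
      proof -
        have "w l = (\<Sum>i<k. \<Sum>i'<k. a i' i * y i * G (i', l))"
          unfolding wy using that by (intro sum.cong) (auto simp: BG sum_distrib_left sum_distrib_right mult_ac)
        also have "\<dots> = (\<Sum>i'<k. x i' * G (i', l))"
          by (subst sum.swap) (simp add: x_def sum_distrib_right)
        finally show ?thesis by (simp add: \<kappa>)
      qed
      have GB: "G (i, l) = (\<Sum>i'<k. a i i' * B G (i', l))" if "i < k" "l < d" for i l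
      proof -
        have "(\<Sum>i'<k. a i i' * B G (i', l)) = (\<Sum>i'<k. \<Sum>j<k. b i' i * b i' j * G (j, l))"
          using that by (intro sum.cong) (auto simp: BG sum_distrib_left b_def mult_ac)
        also have "\<dots> = (\<Sum>j<k. (\<Sum>i'<k. b i' i * b i' j) * G (j, l))"
          by (subst sum.swap) (simp add: sum_distrib_right)
        also have "\<dots> = (\<Sum>j<k. if i = j then G (j, l) else 0)"
          using that b by (intro sum.cong) (auto simp: orth_on_def)
        finally show ?thesis using that by simp
      qed
      have Gav: "(\<Sum>l<d. G (i, l) * w l) = lin_map {..<k} a v i" if "i < k" for i
      proof -
        have "(\<Sum>l<d. G (i, l) * w l) = (\<Sum>l<d. \<Sum>i'<k. a i i' * (B G (i', l) * w l))"
          using that by (intro sum.cong) (auto simp: GB[of i] sum_distrib_left sum_distrib_right mult_ac)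
        also have "\<dots> = (\<Sum>i'<k. a i i' * (\<Sum>l<d. B G (i', l) * w l))"
          by (subst sum.swap) (simp add: sum_distrib_left)
        also have "\<dots> = lin_map {..<k} a v i"
          using that by (simp add: Gw lin_map_def)
        finally show ?thesis .
      qed
      have "ennreal (\<Sum>l<d. (w l)\<^sup>2) \<le>
        ennreal (h\<^sup>2) * inverse (ennreal (\<Sum>j\<in>{\<kappa>..<d}. (lin_map {..<d} c (\<lambda>l. G (\<kappa>, l)) j)\<^sup>2))"
        by (rule min_norm_solution_le[OF \<kappa>d c wx]) (use Gav a(2) \<kappa> in \<open>auto simp: h_def\<close>)
      then show ?thesis by (simp add: h2)
    qed
    then have "ennreal (\<Sum>l<d. (w l)\<^sup>2) ^ s \<le> (ennreal V * inverse (ennreal (\<Sum>j\<in>{\<kappa>..<d}. (lin_map {..<d} c (\<lambda>l. G (\<kappa>, l)) j)\<^sup>2))) ^ s"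
      by (rule power_mono) simp
    then show ?thesis
      by (simp add: \<Psi>_def w_def ennreal_power sum_nonneg)
  qed
  have "(\<integral>\<^sup>+G. \<Psi> G \<partial>gauss ?I) = (\<integral>\<^sup>+G. \<Psi> (B G) \<partial>gauss ?I)"
    unfolding B_def using \<Psi>m b by (intro nn_integral_gauss_orth[symmetric] orth_on_col_block) auto
  also have "\<dots> = (\<integral>\<^sup>+x. (\<integral>\<^sup>+y. \<Psi> (B (merge ?I1 ?I2 (x, y))) \<partial>gauss ?I2) \<partial>gauss ?I1)"
    unfolding rows
    by (rule nn_integral_gauss_rows_split) (use measurable_compose[OF Bm \<Psi>m] rows in auto)
  also have "\<dots> \<le> (\<integral>\<^sup>+x. ennreal (V ^ s / (\<Prod>i<s. real p - 1 - 2 * real i)) \<partial>gauss ?I1)"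
  proof (rule nn_integral_mono)
    fix x
    obtain c where c: "orth_on {..<d} c"
      "\<And>i j. i < \<kappa> \<Longrightarrow> \<kappa> \<le> j \<Longrightarrow> j < d \<Longrightarrow> lin_map {..<d} c (\<lambda>l. x (i, l)) j = 0"
      using orth_triangular[of "{..<d}" "\<lambda>i. i" \<kappa> "\<lambda>i l. x (i, l)"] \<kappa>d by auto
    let ?J = "{\<kappa>} \<times> {\<kappa>..<d}"
    have J: "?J \<subseteq> ?I2" "card ?J = p + 1" using d \<kappa> by auto
    have Jm [measurable]: "(\<lambda>y :: nat \<times> nat \<Rightarrow> real. \<Sum>z\<in>?J. (y z)\<^sup>2) \<in> borel_measurable (borels ?I2)"
      using J(1) by (intro borel_measurable_sum borel_measurable_power measurable_component_singleton) blast
    have lin_map_merge: "lin_map {..<d} c (\<lambda>l. merge ?I1 ?I2 (x, y) (i, l)) =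
        lin_map {..<d} c (\<lambda>l. if i = \<kappa> then y (i, l) else x (i, l))" if "i < k" for i y
      using that \<kappa> by (auto simp: lin_map_def merge_def fun_eq_iff intro!: sum.cong)
    have "(\<integral>\<^sup>+y. \<Psi> (B (merge ?I1 ?I2 (x, y))) \<partial>gauss ?I2) \<le>
        (\<integral>\<^sup>+y. (ennreal V * inverse (ennreal (\<Sum>z\<in>?J. (lin_map ?I2 (row_block c) y z)\<^sup>2))) ^ s \<partial>gauss ?I2)"
    proof (rule nn_integral_mono)
      fix y
      have "\<Psi> (B (merge ?I1 ?I2 (x, y))) \<le>
          (ennreal V * inverse (ennreal (\<Sum>j\<in>{\<kappa>..<d}. (lin_map {..<d} c (\<lambda>l. merge ?I1 ?I2 (x, y) (\<kappa>, l)) j)\<^sup>2))) ^ s"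
        by (rule key) (use c \<kappa> in \<open>auto simp: lin_map_merge\<close>)
      also have "(\<Sum>j\<in>{\<kappa>..<d}. (lin_map {..<d} c (\<lambda>l. merge ?I1 ?I2 (x, y) (\<kappa>, l)) j)\<^sup>2) =
          (\<Sum>j\<in>{\<kappa>..<d}. (lin_map ?I2 (row_block c) y (\<kappa>, j))\<^sup>2)"
      proof (intro sum.cong refl)
        fix j assume j: "j \<in> {\<kappa>..<d}"
        have "lin_map {..<d} c (\<lambda>l. merge ?I1 ?I2 (x, y) (\<kappa>, l)) j = (\<Sum>m<d. c j m * y (\<kappa>, m))"
          using j \<kappa> by (simp add: lin_map_merge) (simp add: lin_map_def)
        then show "(lin_map {..<d} c (\<lambda>l. merge ?I1 ?I2 (x, y) (\<kappa>, l)) j)\<^sup>2 = (lin_map ?I2 (row_block c) y (\<kappa>, j))\<^sup>2"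
          using j by (simp add: lin_map_row_block)
      qed
      also have "\<dots> = (\<Sum>z\<in>?J. (lin_map ?I2 (row_block c) y z)\<^sup>2)"
        using sum.cartesian_product[of "\<lambda>i j. (lin_map ?I2 (row_block c) y (i, j))\<^sup>2" "{\<kappa>..<d}" "{\<kappa>}"]
        by (simp add: case_prod_beta)
      finally show "\<Psi> (B (merge ?I1 ?I2 (x, y))) \<le>
          (ennreal V * inverse (ennreal (\<Sum>z\<in>?J. (lin_map ?I2 (row_block c) y z)\<^sup>2))) ^ s" .
    qed
    also have "\<dots> = (\<integral>\<^sup>+y. (ennreal V * inverse (ennreal (\<Sum>z\<in>?J. (y z)\<^sup>2))) ^ s \<partial>gauss ?I2)"
      using c(1) by (intro nn_integral_gauss_orth orth_on_row_block) measurable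
    also have "\<dots> = (\<integral>\<^sup>+y. ennreal V ^ s * inverse (ennreal (\<Sum>z\<in>?J. (y z)\<^sup>2)) ^ s \<partial>gauss ?I2)"
      by (simp add: power_mult_distrib)
    also have "\<dots> = ennreal V ^ s * (\<integral>\<^sup>+y. inverse (ennreal (\<Sum>z\<in>?J. (y z)\<^sup>2)) ^ s \<partial>gauss ?I2)"
      by (intro nn_integral_cmult) measurable
    also have "\<dots> = ennreal V ^ s * ennreal (1 / (\<Prod>i<s. real (card ?J) - 2 - 2 * real i))"
      using J s by (subst nn_integral_gauss_inverse_chi) auto
    also have "\<dots> = ennreal (V ^ s / (\<Prod>i<s. real p - 1 - 2 * real i))"
    proof -
      have "0 \<le> (\<Prod>i<s. real p - 1 - 2 * real i)" using s by (intro prod_nonneg) auto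
      then show ?thesis
        unfolding J(2) using V0 by (simp add: ennreal_power ennreal_mult[symmetric])
    qed
    finally show "(\<integral>\<^sup>+y. \<Psi> (B (merge ?I1 ?I2 (x, y))) \<partial>gauss ?I2) \<le> ennreal (V ^ s / (\<Prod>i<s. real p - 1 - 2 * real i))" .
  qed
  also have "\<dots> = ennreal (V ^ s / (\<Prod>i<s. real p - 1 - 2 * real i))"
    using prob_space.emeasure_space_1[OF prob_space_gauss[of ?I1]] by simp
  finally show ?thesis by (simp add: \<Psi>_def V_def)
qed

lemma nn_integral_gauss_rows_pow:
  assumes fin: "finite K" "finite D" "D \<noteq> {}" and "K' \<subseteq> K"
  shows "(\<integral>\<^sup>+y. ennreal ((\<Sum>i\<in>K'. (\<Sum>l\<in>D. w l * y (i, l))\<^sup>2) ^ s) \<partial>gauss (K \<times> D)) =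
    ennreal ((\<Sum>l\<in>D. (w l)\<^sup>2) ^ s * (\<Prod>j<s. real (card K') + 2 * real j))"
proof -
  obtain l0 where l0: "l0 \<in> D" using fin by auto
  have sub: "K' \<times> {l0} \<subseteq> K \<times> D" using assms(4) l0 by auto
  let ?F = "\<lambda>z. ennreal ((\<Sum>i\<in>K'. (z i)\<^sup>2) ^ s)"
  have Fm: "?F \<in> borel_measurable (borels K)"
    using assms(4) by (intro measurable_compose[OF _ measurable_ennreal] borel_measurable_power
        borel_measurable_sum measurable_component_singleton) blast
  obtain b where b: "b\<^sup>2 = (\<Sum>l\<in>D. (w l)\<^sup>2)"
    "(\<integral>\<^sup>+y. ?F (\<lambda>i\<in>K. \<Sum>l\<in>D. w l * y (i, l)) \<partial>gauss (K \<times> D)) =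
      (\<integral>\<^sup>+y. ?F (\<lambda>i\<in>K. b * y (i, l0)) \<partial>gauss (K \<times> D))"
    by (rule nn_integral_gauss_rows_linear[OF fin(1,2) l0 Fm])
  have "(\<integral>\<^sup>+y. ennreal ((\<Sum>i\<in>K'. (\<Sum>l\<in>D. w l * y (i, l))\<^sup>2) ^ s) \<partial>gauss (K \<times> D)) =
      (\<integral>\<^sup>+y. ?F (\<lambda>i\<in>K. \<Sum>l\<in>D. w l * y (i, l)) \<partial>gauss (K \<times> D))"
    using assms(4) by (intro nn_integral_cong arg_cong[where f = ennreal] arg_cong[where f = "\<lambda>x. x ^ s"] sum.cong) auto
  also note b(2)
  also have "(\<integral>\<^sup>+y. ?F (\<lambda>i\<in>K. b * y (i, l0)) \<partial>gauss (K \<times> D)) =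
      (\<integral>\<^sup>+y. ennreal ((b\<^sup>2) ^ s) * ennreal ((\<Sum>z\<in>K' \<times> {l0}. (y z)\<^sup>2) ^ s) \<partial>gauss (K \<times> D))"
  proof (intro nn_integral_cong)
    fix y
    have "(\<Sum>i\<in>K'. ((\<lambda>i\<in>K. b * y (i, l0)) i)\<^sup>2) = (\<Sum>i\<in>K'. b\<^sup>2 * (y (i, l0))\<^sup>2)"
      using assms(4) by (intro sum.cong) (auto simp: power_mult_distrib)
    also have "\<dots> = b\<^sup>2 * (\<Sum>z\<in>K' \<times> {l0}. (y z)\<^sup>2)"
      using sum.cartesian_product[of "\<lambda>i j. (y (i, j))\<^sup>2" "{l0}" K']
      by (simp add: sum_distrib_left[symmetric] case_prod_beta)
    finally show "?F (\<lambda>i\<in>K. b * y (i, l0)) = ennreal ((b\<^sup>2) ^ s) * ennreal ((\<Sum>z\<in>K' \<times> {l0}. (y z)\<^sup>2) ^ s)"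
      by (simp add: power_mult_distrib ennreal_mult[symmetric] sum_nonneg)
  qed
  also have "\<dots> = ennreal ((b\<^sup>2) ^ s) * (\<integral>\<^sup>+y. ennreal ((\<Sum>z\<in>K' \<times> {l0}. (y z)\<^sup>2) ^ s) \<partial>gauss (K \<times> D))"
    using sub by (intro nn_integral_cmult) (auto simp: measurable_gauss_eq
      intro!: measurable_compose[OF _ measurable_ennreal] borel_measurable_power
        borel_measurable_sum measurable_component_singleton)
  also have "\<dots> = ennreal ((b\<^sup>2) ^ s) * ennreal (\<Prod>j<s. real (card K') + 2 * real j)"
    using fin sub by (subst nn_integral_gauss_chi_pow) (auto simp: card_cartesian_product)
  finally show ?thesis
    unfolding b(1) by (subst ennreal_mult) (auto simp: sum_nonneg prod_nonneg)
qed

section \<open>The constant\<close>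

lemma power_one_plus_inverse_le: "(1 + 1 / real n) ^ n \<le> exp 1"
  using exp_ge_one_plus_x_over_n_power_n[of n 1] by (cases "n = 0") auto

text \<open>The induction step multiplies by \<open>(1 + 1 / (n + 1)) ^ (n + 1) \<le> e\<close>. The
  base \<open>n + 1\<close> instead of \<open>n\<close> is what bounds \<open>fact (p - 1)\<close>
  by a power of \<open>p / e\<close>.\<close>

lemma fact_ge_power_exp: "((real n + 1) / exp 1) ^ n \<le> fact n"
proof (induction n)
  case (Suc n)
  have "((real (Suc n) + 1) / exp 1) ^ Suc n = (1 + 1 / real (Suc n)) ^ Suc n * real (Suc n) / exp 1 * (((real n + 1) / exp 1) ^ n)"
  proof -
    have "real (Suc n) + 1 = (1 + 1 / real (Suc n)) * (real n + 1)" by (simp add: field_simps)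
    then have "((real (Suc n) + 1) / exp 1) ^ Suc n = (1 + 1 / real (Suc n)) ^ Suc n * ((real n + 1) / exp 1) ^ Suc n"
      by (simp only: times_divide_eq_right[symmetric] power_mult_distrib)
    then show ?thesis by (simp add: add.commute)
  qed
  also have "\<dots> \<le> exp 1 * real (Suc n) / exp 1 * fact n"
    using power_one_plus_inverse_le[of "Suc n"] Suc
    by (intro mult_mono divide_right_mono) (auto simp del: power_Suc of_nat_Suc)
  finally show ?case by simp
qed simp

text \<open>The analogue of \<open>fact_ge_power_exp\<close> for odd factors only, which arise for
  even \<open>p\<close>. From \<open>h\<close> to \<open>h + 1\<close> the left side grows at most
  by the factor \<open>2 * h * (2 * h + 2)\<close>, the right side by
  \<open>(2 * h + 1)\<^sup>2\<close>.\<close>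

lemma odd_prod_ge:
  assumes "h \<ge> 2"
  shows "(2 * real h) ^ (2 * h - 1) / exp 1 ^ (2 * h - 2) \<le> (\<Prod>j<h. 1 + 2 * real j)\<^sup>2"
  using assms
proof (induction h rule: nat_induct_at_least)
  case base
  \<comment> \<open>At \<open>h = 2\<close> the claim is \<open>64 / 9 \<le> e\<^sup>2\<close>, too
    sharp for the Taylor bound \<open>e \<ge> 5 / 2\<close>; the power \<open>1.01 ^ 100\<close>
    gives \<open>27 / 10\<close>.\<close>
  have "(27/10 :: real) \<le> exp 1"
    using exp_lower_Taylor_quadratic[of "1::real"] exp_ge_add_one_self[of "1::real"]
      power_one_plus_inverse_le[of 100] by (simp add: power_divide)
  then have "(27/10)\<^sup>2 \<le> (exp 1 :: real)\<^sup>2" by (intro power_mono) auto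
  then show ?case
    by (simp add: eval_nat_numeral lessThan_Suc field_simps)
next
  case (Suc h)
  have h: "real h > 0" using Suc by simp
  obtain g where g: "h = Suc g" using Suc by (cases h) auto
  have "(2 * real (Suc h)) ^ (2 * Suc h - 1) / exp 1 ^ (2 * Suc h - 2) =
      ((1 + 1 / real h) ^ h)\<^sup>2 * ((2 * real h) * (2 * real h + 2)) / (exp 1)\<^sup>2 *
      ((2 * real h) ^ (2 * h - 1) / exp 1 ^ (2 * h - 2))"
  proof -
    have *: "2 * real (Suc h) = (1 + 1 / real h) * (2 * real h)" using h by (simp add: field_simps)
    have "(2 * real (Suc h)) ^ (2 * Suc h - 1) = (2 * real (Suc h)) ^ (2 * h) * (2 * real h + 2)"
      by simp
    also have "(2 * real (Suc h)) ^ (2 * h) = ((1 + 1 / real h) ^ h)\<^sup>2 * (2 * real h) ^ (2 * h)"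
      unfolding * power_mult_distrib by (simp add: power_mult[symmetric] mult.commute)
    also have "(2 * real h) ^ (2 * h) = (2 * real h) ^ (2 * h - 1) * (2 * real h)"
      by (simp add: g)
    also have "exp 1 ^ (2 * Suc h - 2) = (exp 1 :: real) ^ (2 * h - 2) * (exp 1)\<^sup>2"
      by (simp add: g power2_eq_square)
    ultimately show ?thesis by (simp only: times_divide_eq_right times_divide_eq_left divide_divide_eq_left mult_ac)
  qed
  also have "\<dots> \<le> (exp 1)\<^sup>2 * ((2 * real h) * (2 * real h + 2)) / (exp 1)\<^sup>2 * (\<Prod>j<h. 1 + 2 * real j)\<^sup>2"
    using power_one_plus_inverse_le[of h] Suc h
    by (intro mult_mono divide_right_mono power_mono) auto
  also have "\<dots> = ((2 * real h) * (2 * real h + 2)) * (\<Prod>j<h. 1 + 2 * real j)\<^sup>2"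
    by simp
  also have "\<dots> \<le> (1 + 2 * real h)\<^sup>2 * (\<Prod>j<h. 1 + 2 * real j)\<^sup>2"
    by (intro mult_right_mono) (auto simp: power2_eq_square algebra_simps)
  finally show ?case by (simp add: power_mult_distrib mult.commute)
qed

text \<open>The number \<open>s\<close> of moments is close to the largest one, \<open>p / 2\<close>, for which \<open>\<chi>\<^sup>-\<^sup>2\<^sup>s\<close> with
  \<open>p + 1\<close> degrees of freedom has an expectation.\<close>

lemma ex_moment:
  assumes "p \<ge> 2"
  obtains s where "1 \<le> s" "2 * s \<le> p"
    "(real p / exp 1) ^ (2 * s) \<le> (\<Prod>j<s. 1 + 2 * real j) * (\<Prod>j<s. real p - 1 - 2 * real j)"
proof (cases "even p")
  case False
  then obtain h where p: "p = 2 * h + 1" by (elim oddE)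
  \<comment> \<open>For odd \<open>p = 2 * h + 1\<close> the two products run over the odd and the
    even numbers up to \<open>2 * h\<close>.\<close>
  have "(\<Prod>j<h. 1 + 2 * real j) * (\<Prod>j<h. real p - 1 - 2 * real j) = fact (2 * h)"
  proof -
    have "(\<Prod>j<h. real p - 1 - 2 * real j) = (\<Prod>j<h. 2 * real j + 2)"
      by (subst prod.nat_diff_reindex[symmetric]) (auto simp: p of_nat_diff intro!: prod.cong)
    moreover have "(\<Prod>j<h. 1 + 2 * real j) * (\<Prod>j<h. 2 * real j + 2) = fact (2 * h)"
      by (induction h) (auto simp: algebra_simps)
    ultimately show ?thesis by simp
  qed
  then show ?thesis
    using that[of h] fact_ge_power_exp[of "2 * h"] assms by (auto simp: p add.commute)
next
  case True
  then obtain h where p: "p = 2 * h" by (elim evenE)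
  show ?thesis
  proof (cases "h \<ge> 2")
    case False
    then have "p = 2" using assms p by simp
    moreover have "2 \<le> exp (1::real)" using exp_ge_add_one_self[of "1::real"] by simp
    then have "2\<^sup>2 \<le> (exp (1::real))\<^sup>2" by (intro power_mono) auto
    ultimately show ?thesis
      by (intro that[of 1]) (auto simp: power2_eq_square field_simps)
  next
    case True
    then obtain g where g: "h = Suc g" "g \<ge> 1" by (cases h) auto
    let ?D = "\<Prod>j<h. 1 + 2 * real j"
    have D1: "?D = (\<Prod>j<g. 1 + 2 * real j) * (1 + 2 * real g)"
      by (simp add: g)
    \<comment> \<open>For even \<open>p\<close> both products consist of odd numbers; with
      \<open>s = g = h - 1\<close> the second runs from \<open>3\<close> to \<open>p - 1\<close>,
      and the missing factor \<open>1\<close> makes it equal to \<open>?D\<close>.\<close>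
    have D2: "(\<Prod>j<g. real p - 1 - 2 * real j) = ?D"
    proof -
      have "(\<Prod>j<g. real p - 1 - 2 * real j) = (\<Prod>j<g. 1 + 2 * real (Suc j))"
        by (subst prod.nat_diff_reindex[symmetric]) (auto simp: p g of_nat_diff intro!: prod.cong)
      also have "\<dots> = ?D" unfolding g prod.lessThan_Suc_shift by simp
      finally show ?thesis .
    qed
    have "(real p / exp 1) ^ (2 * g) * (1 + 2 * real g) \<le> (real p / exp 1) ^ (2 * g) * (2 * real h)"
      by (intro mult_left_mono) (auto simp: g)
    also have "\<dots> = (2 * real h) ^ (2 * h - 1) / exp 1 ^ (2 * h - 2)"
      by (simp add: p g power_divide)
    also have "\<dots> \<le> ?D\<^sup>2" by (rule odd_prod_ge[OF True])
    also have "\<dots> = (\<Prod>j<g. 1 + 2 * real j) * ?D * (1 + 2 * real g)"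
      by (simp add: D1 power2_eq_square)
    finally have "(real p / exp 1) ^ (2 * g) \<le> (\<Prod>j<g. 1 + 2 * real j) * ?D"
      by (rule mult_right_le_imp_le) simp
    then show ?thesis
      by (intro that[of g]) (use g p D2 in simp_all)
  qed
qed

text \<open>Pairing factor \<open>j\<close> with factor \<open>s - 1 - j\<close> gives two numbers
  with sum \<open>2 * (x + s - 1)\<close>, whose product is at most the square of half the
  sum.\<close>

lemma prod_arith_le_power:
  fixes x :: real
  assumes "x \<ge> 0"
  shows "(\<Prod>j<s. x + 2 * real j) \<le> (x + real s - 1) ^ s"
proof (cases "s = 0")
  case False
  have s: "0 \<le> x + real s - 1" using False assms by simp
  have "(\<Prod>j<s. x + 2 * real j)\<^sup>2 = (\<Prod>j<s. (x + 2 * real j) * (x + 2 * real (s - Suc j)))"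
    unfolding power2_eq_square prod.distrib
    by (subst (2) prod.nat_diff_reindex[symmetric]) simp
  also have "\<dots> \<le> (\<Prod>j<s. (x + real s - 1)\<^sup>2)"
  proof (rule prod_mono, safe)
    fix j assume j: "j < s"
    show "0 \<le> (x + 2 * real j) * (x + 2 * real (s - Suc j))" using assms by simp
    have "(x + 2 * real j) * (x + 2 * real (s - Suc j)) =
        (x + real s - 1)\<^sup>2 - (real s - 1 - 2 * real j)\<^sup>2"
      using j by (simp add: of_nat_diff power2_eq_square algebra_simps)
    then show "(x + 2 * real j) * (x + 2 * real (s - Suc j)) \<le> (x + real s - 1)\<^sup>2" by simp
  qed
  also have "\<dots> = ((x + real s - 1) ^ s)\<^sup>2"
    by (simp add: power_mult[symmetric] mult.commute)
  finally show ?thesis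
    by (rule power2_le_imp_le) (use s in simp)
qed simp

text \<open>Here \<open>r\<close> stands for \<open>m - k\<close>. By
  \<open>prod_arith_le_power\<close> it is enough that
  \<open>(k + h) * (r + h) * e\<^sup>2 \<le> (p * C)\<^sup>2\<close> with \<open>h = p / 2\<close>.
  In the expanded square, \<open>(e * Y)\<^sup>2\<close> covers \<open>r * (k + p)\<close>, and the
  leftover \<open>h * k\<close> is covered by the cross term because
  \<open>k \<le> X * Y\<close>.\<close>

lemma ex_moment_bound:
  fixes k p r :: nat
  assumes "k \<ge> 1" "p \<ge> 2" "r \<ge> p + 1"
  defines "C \<equiv> sqrt (real k / (real p - 1)) + exp 1 * sqrt (real r * real (k + p)) / real p"
  obtains s where "1 \<le> s" "2 * s \<le> p"
    "(\<Prod>j<s. real k + 2 * real j) * (\<Prod>j<s. real r + 2 * real j) \<le>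
      (C\<^sup>2) ^ s * ((\<Prod>j<s. 1 + 2 * real j) * (\<Prod>j<s. real p - 1 - 2 * real j))"
proof -
  obtain s where s: "1 \<le> s" "2 * s \<le> p"
    "(real p / exp 1) ^ (2 * s) \<le> (\<Prod>j<s. 1 + 2 * real j) * (\<Prod>j<s. real p - 1 - 2 * real j)"
    using ex_moment[OF assms(2)] .
  define h where "h = real p / 2"
  define e where "e = exp (1::real)"
  have e: "e > 0" "e \<le> 4" using exp_le by (auto simp: e_def)
  have sh: "real s \<le> h" using s(2) by (simp add: h_def)
  have h: "h \<ge> 1" using assms(2) by (simp add: h_def)
  have p: "real p = 2 * h" by (simp add: h_def)
  have r: "real r \<ge> 2 * h + 1" using assms(3) by (simp add: h_def)
  define X where "X = sqrt (real k / (real p - 1))"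
  define Y where "Y = sqrt (real r * real (k + p))"
  have XY: "real k \<le> X * Y"
  proof -
    have "real k * (real p - 1) \<le> real r * real (k + p)"
      using r assms(1,2) h by (subst mult.commute, intro mult_mono) (auto simp: p)
    then have "real k / (real p - 1) * (real k * (real p - 1)) \<le> real k / (real p - 1) * (real r * real (k + p))"
      using assms(2) by (intro mult_left_mono) auto
    then have "(real k)\<^sup>2 \<le> real k / (real p - 1) * (real r * real (k + p))"
      using assms(2) by (simp add: power2_eq_square)
    then show ?thesis
      unfolding X_def Y_def real_sqrt_mult[symmetric] by (rule real_le_rsqrt)
  qed
  have Y2: "Y\<^sup>2 = real r * (real k + 2 * h)"
    unfolding Y_def p[symmetric] by simp
  have "(real k + real s - 1) * (real r + real s - 1) * e\<^sup>2 \<le> (real k + h) * (real r + h) * e\<^sup>2"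
    using sh s(1) by (intro mult_mono) auto
  also have "\<dots> \<le> (real p)\<^sup>2 * C\<^sup>2"
  proof -
    have pC: "real p * C = real p * X + e * Y"
      using assms(2) by (simp add: C_def X_def Y_def e_def distrib_left)
    have "(real k + h) * (real r + h) \<le> real r * (real k + 2 * h) + h * real k"
    proof -
      have "h * h \<le> h * real r" using r h by (intro mult_left_mono) auto
      then show ?thesis by (simp add: algebra_simps)
    qed
    then have "(real k + h) * (real r + h) * e\<^sup>2 \<le> (Y\<^sup>2 + h * real k) * e\<^sup>2"
      unfolding Y2 by (rule mult_right_mono) simp
    \<comment> \<open>The cross term is \<open>4 * h * e * (X * Y)\<close>, so
      \<open>e \<le> 4\<close> is the only bound on \<open>e\<close> that is used.\<close>
    also have "h * real k * e\<^sup>2 \<le> 2 * (real p * X) * (e * Y)"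
    proof -
      have "h * real k * e\<^sup>2 = (h * e * real k) * e" by (simp add: power2_eq_square)
      also have "\<dots> \<le> (h * e * (X * Y)) * 4"
        using XY h e by (intro mult_mono) auto
      finally show ?thesis by (simp add: p mult_ac)
    qed
    then have "(Y\<^sup>2 + h * real k) * e\<^sup>2 \<le> (real p * X + e * Y)\<^sup>2"
      by (simp add: add_increasing2 power2_sum power_mult_distrib algebra_simps)
    finally show ?thesis unfolding pC[symmetric] by (simp add: power_mult_distrib)
  qed
  finally have main: "(real k + real s - 1) * (real r + real s - 1) \<le> (real p / e)\<^sup>2 * C\<^sup>2"
    using e by (simp add: power_divide field_simps)
  have nn: "0 \<le> real k + real s - 1" "0 \<le> real r + real s - 1" using s(1) by auto
  have "(\<Prod>j<s. real k + 2 * real j) * (\<Prod>j<s. real r + 2 * real j) \<le>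
      (real k + real s - 1) ^ s * (real r + real s - 1) ^ s"
    using nn by (intro mult_mono prod_arith_le_power prod_nonneg) auto
  also have "\<dots> = ((real k + real s - 1) * (real r + real s - 1)) ^ s"
    by (simp add: power_mult_distrib)
  also have "\<dots> \<le> ((real p / e)\<^sup>2 * C\<^sup>2) ^ s"
    using main nn by (intro power_mono) auto
  also have "\<dots> = (C\<^sup>2) ^ s * (real p / exp 1) ^ (2 * s)"
    unfolding e_def power_mult_distrib power_mult by (rule mult.commute)
  also have "\<dots> \<le> (C\<^sup>2) ^ s * ((\<Prod>j<s. 1 + 2 * real j) * (\<Prod>j<s. real p - 1 - 2 * real j))"
    using s(3) by (intro mult_left_mono) auto
  finally show ?thesis using that s by blast
qed

section \<open>The projected trailing block\<close>

text \<open>Row \<open>i\<close> of \<open>X v\<close> for \<open>i \<ge> k\<close>, with both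
  blocks stored in \<open>G\<close>: \<open>rinv\<close> reads the rows below \<open>k\<close> only
  and is independent of row \<open>i\<close>.\<close>

definition tail :: "nat \<Rightarrow> nat \<Rightarrow> (nat \<times> nat \<Rightarrow> real) \<Rightarrow> (nat \<Rightarrow> real) \<Rightarrow> nat \<Rightarrow> real" where
  "tail k d G v i = (\<Sum>l<d. (\<Sum>j<k. rinv k d G l j * v j) * G (i, l))"

lemma tail_altdef: "tail k d G v i = (\<Sum>j<k. (\<Sum>l<d. rinv k d G l j * G (i, l)) * v j)"
  unfolding tail_def by (simp add: sum_distrib_right, subst sum.swap) (simp add: mult_ac)

lemma borel_measurable_tail:
  assumes "{..<k} \<times> {..<d} \<subseteq> I" "{i} \<times> {..<d} \<subseteq> I"
    and "\<And>j. j < k \<Longrightarrow> (\<lambda>x. v x j) \<in> borel_measurable M" and "g \<in> measurable M (borels I)"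
  shows "(\<lambda>x. tail k d (g x) (v x) i) \<in> borel_measurable M"
  unfolding tail_def
  by (intro borel_measurable_sum borel_measurable_times measurable_compose[OF assms(4) borel_measurable_rinv]
      measurable_compose[OF assms(4) measurable_entry] assms(3)) (use assms in auto)

text \<open>Given the first \<open>k\<close> rows, each entry is the product of a fresh Gaussian row
  with the fixed vector \<open>w\<close>. This separates a chi moment with \<open>card K'\<close>
  degrees of freedom from the moment of the norm of \<open>w\<close>. \<open>K'\<close> is the set
  of all trailing rows for the spectral norm and a single row for the Frobenius norm.\<close>

lemma nn_integral_gauss_tail_pow:
  assumes k: "1 \<le> k" and d: "d = k + p" and s: "1 \<le> s" "2 * s \<le> p" and m: "k \<le> m" "K' \<subseteq> {k..<m}"
  shows "(\<integral>\<^sup>+G. ennreal ((\<Sum>i\<in>K'. (tail k d G v i)\<^sup>2) ^ s) \<partial>gauss ({..<m} \<times> {..<d})) \<le>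
    ennreal ((\<Prod>j<s. real (card K') + 2 * real j) / (\<Prod>i<s. real p - 1 - 2 * real i) * (\<Sum>j<k. (v j)\<^sup>2) ^ s)"
proof -
  have rows: "{..<m} = {..<k} \<union> {k..<m}" using m by auto
  let ?I1 = "{..<k} \<times> {..<d}" and ?I2 = "{k..<m} \<times> {..<d}"
  let ?P = "\<Prod>j<s. real (card K') + 2 * real j" and ?Q = "\<Prod>i<s. real p - 1 - 2 * real i"
  have P: "?P \<ge> 0" by (intro prod_nonneg) auto
  let ?f = "\<lambda>G. ennreal ((\<Sum>i\<in>K'. (tail k d G v i)\<^sup>2) ^ s)"
  define w where "w G l = (\<Sum>j<k. rinv k d G l j * v j)" for G l
  have fm: "?f \<in> borel_measurable (borels ({..<m} \<times> {..<d}))"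
    using m by (intro measurable_compose[OF _ measurable_ennreal] borel_measurable_power borel_measurable_sum
      borel_measurable_tail[where g = "\<lambda>x. x" and I = "{..<m} \<times> {..<d}"]) auto
  have "(\<integral>\<^sup>+G. ?f G \<partial>gauss ({..<m} \<times> {..<d})) =
      (\<integral>\<^sup>+x. (\<integral>\<^sup>+y. ?f (merge ?I1 ?I2 (x, y)) \<partial>gauss ?I2) \<partial>gauss ?I1)"
    unfolding rows by (rule nn_integral_gauss_rows_split[OF _ _ _ _ fm[unfolded rows]]) auto
  also have "\<dots> = (\<integral>\<^sup>+x. (\<integral>\<^sup>+y. ennreal ((\<Sum>i\<in>K'. (\<Sum>l<d. w x l * y (i, l))\<^sup>2) ^ s) \<partial>gauss ?I2) \<partial>gauss ?I1)"
  proof -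
    have "tail k d (merge ?I1 ?I2 (x, y)) v i = (\<Sum>l<d. w x l * y (i, l))" if i: "i \<in> K'" for x y i
      unfolding tail_def w_def
    proof (intro sum.cong refl)
      fix l assume l: "l \<in> {..<d}"
      have "rinv k d (merge ?I1 ?I2 (x, y)) l j = rinv k d x l j" for j
        using l by (intro rinv_cong) (auto simp: merge_def)
      moreover have "merge ?I1 ?I2 (x, y) (i, l) = y (i, l)"
        using l i m(2) by (auto simp: merge_def)
      ultimately show "(\<Sum>j<k. rinv k d (merge ?I1 ?I2 (x, y)) l j * v j) * merge ?I1 ?I2 (x, y) (i, l) =
        (\<Sum>j<k. rinv k d x l j * v j) * y (i, l)" by simp
    qed
    then have "(\<Sum>i\<in>K'. (tail k d (merge ?I1 ?I2 (x, y)) v i)\<^sup>2) = (\<Sum>i\<in>K'. (\<Sum>l<d. w x l * y (i, l))\<^sup>2)" for x y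
      by (intro sum.cong) simp_all
    then show ?thesis by (simp only:)
  qed
  also have "\<dots> = (\<integral>\<^sup>+x. ennreal ((\<Sum>l<d. (w x l)\<^sup>2) ^ s * ?P) \<partial>gauss ?I1)"
    using k d m by (intro nn_integral_cong nn_integral_gauss_rows_pow) (auto simp: lessThan_empty_iff)
  also have "\<dots> = (\<integral>\<^sup>+x. ennreal ?P * ennreal ((\<Sum>l<d. (w x l)\<^sup>2) ^ s) \<partial>gauss ?I1)"
  proof -
    have "ennreal (z ^ s * ?P) = ennreal ?P * ennreal (z ^ s)" if "z \<ge> 0" for z
      by (subst ennreal_mult[symmetric]) (use P that in \<open>simp_all only: zero_le_power mult.commute\<close>)
    then show ?thesis by (simp add: sum_nonneg)
  qed
  also have "\<dots> = ennreal ?P * (\<integral>\<^sup>+x. ennreal ((\<Sum>l<d. (w x l)\<^sup>2) ^ s) \<partial>gauss ?I1)"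
  proof (rule nn_integral_cmult)
    show "(\<lambda>x. ennreal ((\<Sum>l<d. (w x l)\<^sup>2) ^ s)) \<in> borel_measurable (gauss ?I1)"
      unfolding measurable_gauss_eq w_def
      by (intro measurable_compose[OF _ measurable_ennreal] borel_measurable_power borel_measurable_sum
        borel_measurable_times borel_measurable_rinv borel_measurable_const) auto
  qed
  also have "\<dots> \<le> ennreal ?P * ennreal ((\<Sum>j<k. (v j)\<^sup>2) ^ s / ?Q)"
    unfolding w_def by (intro mult_left_mono nn_integral_gauss_rinv_pow[OF k d s]) auto
  also have "\<dots> = ennreal (?P / ?Q * (\<Sum>j<k. (v j)\<^sup>2) ^ s)"
    using P by (subst ennreal_mult'[symmetric]) (simp_all add: mult_ac)
  finally show ?thesis .
qed

text \<open>Exchanging the integrals puts \<open>G\<close> inside, so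
  \<open>nn_integral_gauss_tail_pow\<close> applies to the fixed vector \<open>g\<close> and leaves
  a chi moment with \<open>k\<close> degrees of freedom.\<close>

lemma nn_integral_gauss_tail_pow_gauss:
  assumes k: "1 \<le> k" and d: "d = k + p" and s: "1 \<le> s" "2 * s \<le> p" and m: "k \<le> m"
  shows "(\<integral>\<^sup>+G. (\<integral>\<^sup>+g. ennreal ((\<Sum>i\<in>{k..<m}. (tail k d G g i)\<^sup>2) ^ s) \<partial>gauss {..<k}) \<partial>gauss ({..<m} \<times> {..<d})) \<le>
    ennreal ((\<Prod>j<s. real k + 2 * real j) * (\<Prod>j<s. real (m - k) + 2 * real j) / (\<Prod>i<s. real p - 1 - 2 * real i))"
    (is "?lhs \<le> _")
    and "(\<lambda>G. \<integral>\<^sup>+g. ennreal ((\<Sum>i\<in>{k..<m}. (tail k d G g i)\<^sup>2) ^ s) \<partial>gauss {..<k}) \<in>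
      borel_measurable (gauss ({..<m} \<times> {..<d}))"
proof -
  let ?I = "{..<m} \<times> {..<d}"
  let ?P = "\<Prod>j<s. real (m - k) + 2 * real j" and ?Q = "\<Prod>i<s. real p - 1 - 2 * real i"
  have PQ: "0 \<le> ?P / ?Q" using s by (intro divide_nonneg_nonneg prod_nonneg) auto
  interpret g1: prob_space "gauss ?I" by (rule prob_space_gauss)
  interpret g2: prob_space "gauss {..<k}" by (rule prob_space_gauss)
  interpret pair_sigma_finite "gauss ?I" "gauss {..<k}" by standard
  have fst: "fst \<in> measurable (gauss ?I \<Otimes>\<^sub>M gauss {..<k}) (borels ?I)"
    using measurable_fst[of "gauss ?I" "gauss {..<k}"] measurable_cong_sets[OF refl sets_gauss] by blast
  have snd: "snd \<in> measurable (gauss ?I \<Otimes>\<^sub>M gauss {..<k}) (PiM {..<k} (\<lambda>_. borel))"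
    using measurable_snd[of "gauss ?I" "gauss {..<k}"] measurable_cong_sets[OF refl sets_gauss] by blast
  have joint: "(\<lambda>x. ennreal ((\<Sum>i\<in>{k..<m}. (tail k d (fst x) (snd x) i)\<^sup>2) ^ s))
      \<in> borel_measurable (gauss ?I \<Otimes>\<^sub>M gauss {..<k})"
    using m
    by (intro measurable_compose[OF _ measurable_ennreal] borel_measurable_power borel_measurable_sum
        borel_measurable_tail[where I = ?I] fst measurable_compose[OF snd measurable_component_singleton]) auto
  show "(\<lambda>G. \<integral>\<^sup>+g. ennreal ((\<Sum>i\<in>{k..<m}. (tail k d G g i)\<^sup>2) ^ s) \<partial>gauss {..<k}) \<in> borel_measurable (gauss ?I)"
    using g2.borel_measurable_nn_integral_fst[OF joint] by simp
  have "?lhs = (\<integral>\<^sup>+g. (\<integral>\<^sup>+G. ennreal ((\<Sum>i\<in>{k..<m}. (tail k d G g i)\<^sup>2) ^ s) \<partial>gauss ?I) \<partial>gauss {..<k})"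
    using Fubini[OF joint] by simp
  also have "\<dots> \<le> (\<integral>\<^sup>+g. ennreal (?P / ?Q) * ennreal ((\<Sum>j<k. (g j)\<^sup>2) ^ s) \<partial>gauss {..<k})"
    using nn_integral_gauss_tail_pow[OF k d s m order_refl] PQ
    by (intro nn_integral_mono) (simp add: ennreal_mult[symmetric] sum_nonneg)
  also have "\<dots> = ennreal (?P / ?Q) * (\<integral>\<^sup>+g. ennreal ((\<Sum>j<k. (g j)\<^sup>2) ^ s) \<partial>gauss {..<k})"
    by (rule nn_integral_cmult) measurable
  also have "\<dots> = ennreal (?P / ?Q) * ennreal (\<Prod>j<s. real k + 2 * real j)"
    by (subst nn_integral_gauss_chi_pow) auto
  also have "\<dots> = ennreal ((\<Prod>j<s. real k + 2 * real j) * ?P / ?Q)"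
    using PQ by (subst ennreal_mult'[symmetric]) (simp_all add: mult_ac)
  finally show "?lhs \<le> ennreal ((\<Prod>j<s. real k + 2 * real j) * ?P / ?Q)" .
qed

text \<open>With \<open>c = x\<^sup>T x v\<close>, Cauchy-Schwarz gives
  \<open>(c \<bullet> g)\<^sup>2 \<le> S * \<bar>x g\<bar>\<^sup>2\<close>, and moments over
  \<open>g\<close> bound \<open>\<bar>c\<bar>\<close>. Since \<open>S = c \<bullet> v\<close>, this
  bounds \<open>S\<close> for every \<open>v\<close> without choosing a maximising
  direction.\<close>

lemma linear_map_pow_le_gauss:
  fixes x :: "'i \<Rightarrow> nat \<Rightarrow> real"
  assumes K: "finite K" and s: "1 \<le> s" and e: "0 \<le> e"
    and E: "(\<integral>\<^sup>+g. ennreal ((\<Sum>i\<in>K. (\<Sum>j<k. x i j * g j)\<^sup>2) ^ s) \<partial>gauss {..<k}) = ennreal e"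
  shows "(\<Sum>i\<in>K. (\<Sum>j<k. x i j * v j)\<^sup>2) ^ s * (\<Prod>j<s. 1 + 2 * real j) \<le> (\<Sum>j<k. (v j)\<^sup>2) ^ s * e"
proof -
  let ?X = "\<lambda>v i. \<Sum>j<k. x i j * v j" and ?P = "\<Prod>j<s. 1 + 2 * real j" and ?V = "\<Sum>j<k. (v j)\<^sup>2"
  define S where "S = (\<Sum>i\<in>K. (?X v i)\<^sup>2)"
  have S0: "S \<ge> 0" by (simp add: S_def sum_nonneg)
  have P0: "?P > 0" by (intro prod_pos) auto
  have V0: "?V \<ge> 0" by (simp add: sum_nonneg)
  show ?thesis
  proof (cases "S = 0")
    case True
    have "0 \<le> ?V ^ s * e" using e V0 by simp
    then show ?thesis using True s by (simp add: S_def[symmetric] zero_power)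
  next
    case False
    define c where "c j = (\<Sum>i\<in>K. ?X v i * x i j)" for j
    have cg: "(\<Sum>i\<in>K. ?X v i * ?X g i) = (\<Sum>j<k. c j * g j)" for g
      unfolding c_def sum_distrib_left sum_distrib_right by (subst sum.swap) (simp add: mult.assoc)
    have "S = (\<Sum>j<k. c j * v j)"
      unfolding cg[symmetric] S_def by (simp add: power2_eq_square)
    then have S2: "S\<^sup>2 \<le> (\<Sum>j<k. (c j)\<^sup>2) * ?V"
      using Cauchy_Schwarz_ineq_sum[of c v "{..<k}"] by simp
    have "ennreal ((\<Sum>j<k. (c j)\<^sup>2) ^ s * ?P) = (\<integral>\<^sup>+g. ennreal (((\<Sum>j<k. c j * g j)\<^sup>2) ^ s) \<partial>gauss {..<k})"
      by (rule nn_integral_gauss_linear_pow[symmetric]) simp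
    also have "\<dots> \<le> (\<integral>\<^sup>+g. ennreal (S ^ s) * ennreal ((\<Sum>i\<in>K. (?X g i)\<^sup>2) ^ s) \<partial>gauss {..<k})"
    proof (rule nn_integral_mono)
      fix g :: "nat \<Rightarrow> real"
      have "(\<Sum>j<k. c j * g j)\<^sup>2 \<le> S * (\<Sum>i\<in>K. (?X g i)\<^sup>2)"
        unfolding cg[symmetric] S_def by (rule Cauchy_Schwarz_ineq_sum)
      then have "((\<Sum>j<k. c j * g j)\<^sup>2) ^ s \<le> (S * (\<Sum>i\<in>K. (?X g i)\<^sup>2)) ^ s"
        by (intro power_mono) auto
      then show "ennreal (((\<Sum>j<k. c j * g j)\<^sup>2) ^ s) \<le> ennreal (S ^ s) * ennreal ((\<Sum>i\<in>K. (?X g i)\<^sup>2) ^ s)"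
        using S0 by (simp add: ennreal_mult[symmetric] power_mult_distrib sum_nonneg ennreal_leI)
    qed
    also have "\<dots> = ennreal (S ^ s) * ennreal e"
      unfolding E[symmetric] by (rule nn_integral_cmult) measurable
    finally have "ennreal ((\<Sum>j<k. (c j)\<^sup>2) ^ s * ?P) \<le> ennreal (S ^ s * e)"
      using S0 e by (simp add: ennreal_mult)
    then have 1: "(\<Sum>j<k. (c j)\<^sup>2) ^ s * ?P \<le> S ^ s * e"
      by (subst (asm) ennreal_le_iff) (use S0 e in auto)
    have "S ^ s * (S ^ s * ?P) = (S\<^sup>2) ^ s * ?P"
      by (simp add: power2_eq_square power_mult_distrib)
    also have "\<dots> \<le> ((\<Sum>j<k. (c j)\<^sup>2) * ?V) ^ s * ?P"
      using S2 P0 by (intro mult_right_mono power_mono) auto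
    also have "\<dots> = ?V ^ s * ((\<Sum>j<k. (c j)\<^sup>2) ^ s * ?P)"
      by (simp add: power_mult_distrib)
    also have "\<dots> \<le> ?V ^ s * (S ^ s * e)"
      by (rule mult_left_mono[OF 1 zero_le_power[OF V0]])
    finally have "S ^ s * (S ^ s * ?P) \<le> S ^ s * (?V ^ s * e)" by (simp add: mult_ac)
    then show ?thesis
      using False S0 unfolding S_def[symmetric] by (subst (asm) mult_le_cancel_left_pos) auto
  qed
qed

text \<open>Bernoulli's inequality trades the root of the moment \<open>E\<close> for an affine function of it.\<close>

lemma ex_tail_opnorm_bound:
  fixes k p m :: nat
  assumes k: "1 \<le> k" and p: "2 \<le> p" and m: "k + p < m"
  defines "C \<equiv> sqrt (real k / (real p - 1)) + exp 1 * sqrt (real (m - k) * real (k + p)) / real p"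
  obtains N :: "(nat \<times> nat \<Rightarrow> real) \<Rightarrow> ennreal"
  where "N \<in> borel_measurable (gauss ({..<m} \<times> {..<k + p}))"
    "(\<integral>\<^sup>+G. N G \<partial>gauss ({..<m} \<times> {..<k + p})) \<le> ennreal C"
    "\<And>G v. ennreal (sqrt (\<Sum>i\<in>{k..<m}. (tail k (k + p) G v i)\<^sup>2)) \<le> N G * ennreal (sqrt (\<Sum>j<k. (v j)\<^sup>2))"
proof -
  let ?M = "gauss ({..<m} \<times> {..<k + p})"
  obtain s where s: "1 \<le> s" "2 * s \<le> p"
    "(\<Prod>j<s. real k + 2 * real j) * (\<Prod>j<s. real (m - k) + 2 * real j) \<le>
      (C\<^sup>2) ^ s * ((\<Prod>j<s. 1 + 2 * real j) * (\<Prod>j<s. real p - 1 - 2 * real j))"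
    unfolding C_def by (rule ex_moment_bound[of k p "m - k"]) (use k p m in auto)
  let ?P = "\<Prod>j<s. 1 + 2 * real j" and ?Q = "\<Prod>j<s. real p - 1 - 2 * real j"
  have P: "?P > 0" by (intro prod_pos) auto
  have Q: "?Q > 0" using s by (intro prod_pos) auto
  have "sqrt (real k / (real p - 1)) > 0" using k p by simp
  then have C: "C > 0" unfolding C_def by (intro add_pos_nonneg) auto
  define E where "E G = (\<integral>\<^sup>+g. ennreal ((\<Sum>i\<in>{k..<m}. (tail k (k + p) G g i)\<^sup>2) ^ s) \<partial>gauss {..<k})" for G
  \<comment> \<open>Bernoulli gives
    \<open>y \<le> (y\<^sup>2\<^sup>s + 2 * s - 1) / (2 * s)\<close>. For \<open>y\<close> the
    stretch of \<open>v\<close> divided by \<open>C\<close>, and with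
    \<open>E G / (?P * C\<^sup>2\<^sup>s)\<close> as a bound for the power, the right side times
    \<open>C\<close> is \<open>A + B * E G\<close>. The mean of \<open>E\<close> is at most
    \<open>?P * C\<^sup>2\<^sup>s\<close>, so that of \<open>N\<close> is at most
    \<open>C\<close>.\<close>
  define A where "A = C * (2 * real s - 1) / (2 * real s)"
  define B where "B = C / (2 * real s * ?P * (C\<^sup>2) ^ s)"
  have A0: "A \<ge> 0" using C s by (simp add: A_def)
  have B0: "B > 0" unfolding B_def using C s P by (intro divide_pos_pos mult_pos_pos) auto
  define N where "N G = ennreal A + ennreal B * E G" for G
  have Em [measurable]: "E \<in> borel_measurable ?M"
    unfolding E_def by (rule nn_integral_gauss_tail_pow_gauss(2)[OF k refl s(1,2)]) (use m in simp)
  have Nm: "N \<in> borel_measurable ?M" unfolding N_def by measurable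
  have "(\<integral>\<^sup>+G. E G \<partial>?M) \<le>
      ennreal ((\<Prod>j<s. real k + 2 * real j) * (\<Prod>j<s. real (m - k) + 2 * real j) / ?Q)"
    unfolding E_def by (rule nn_integral_gauss_tail_pow_gauss(1)[OF k refl s(1,2)]) (use m in simp)
  also have "\<dots> \<le> ennreal ((C\<^sup>2) ^ s * ?P)"
    using s(3) Q by (intro ennreal_leI) (simp add: field_simps)
  finally have EE: "(\<integral>\<^sup>+G. E G \<partial>?M) \<le> ennreal ((C\<^sup>2) ^ s * ?P)" .
  have "(\<integral>\<^sup>+G. N G \<partial>?M) = ennreal A + ennreal B * (\<integral>\<^sup>+G. E G \<partial>?M)"
    unfolding N_def using prob_space.emeasure_space_1[OF prob_space_gauss[of "{..<m} \<times> {..<k + p}"]]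
    by (subst nn_integral_add) (auto simp: nn_integral_cmult)
  also have "\<dots> \<le> ennreal A + ennreal B * ennreal ((C\<^sup>2) ^ s * ?P)"
    by (intro add_left_mono mult_left_mono EE) auto
  also have "\<dots> = ennreal (A + B * ((C\<^sup>2) ^ s * ?P))"
    using A0 B0 C P by (simp add: ennreal_mult[symmetric] ennreal_plus[symmetric] del: ennreal_plus)
  also have "B * ((C\<^sup>2) ^ s * ?P) = C / (2 * real s)"
    using C P s by (simp add: B_def)
  also have "A + C / (2 * real s) = C"
    using s by (simp add: A_def field_simps)
  finally have N1: "(\<integral>\<^sup>+G. N G \<partial>?M) \<le> ennreal C" .
  have N2: "ennreal (sqrt (\<Sum>i\<in>{k..<m}. (tail k (k + p) G v i)\<^sup>2)) \<le> N G * ennreal (sqrt (\<Sum>j<k. (v j)\<^sup>2))"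
    for G v
  proof -
    define S where "S = (\<Sum>i\<in>{k..<m}. (tail k (k + p) G v i)\<^sup>2)"
    define V where "V = (\<Sum>j<k. (v j)\<^sup>2)"
    have SV: "0 \<le> S" "0 \<le> V" by (simp_all add: S_def V_def sum_nonneg)
    show ?thesis
    \<comment> \<open>Separated because \<open>\<top> * 0 = 0\<close> in \<open>ennreal\<close>: an
      infinite \<open>E G\<close> makes the bound trivial only when \<open>V > 0\<close>.\<close>
    proof (cases "V = 0")
      case True
      then have "v j = 0" if "j < k" for j
        using that by (simp add: V_def sum_nonneg_eq_0_iff)
      then have "S = 0" by (simp add: S_def tail_def)
      then show ?thesis by (simp add: S_def)
    next
      case False
      then have V: "V > 0" using SV by simp
      show ?thesis
      proof (cases "E G = \<top>")
        case True
        then show ?thesis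
          using V B0 by (simp add: N_def ennreal_mult_top V_def[symmetric] ennreal_top_mult)
      next
        case False
        then obtain e where e: "e \<ge> 0" "E G = ennreal e" by (cases "E G") auto
        have Se: "S ^ s * ?P \<le> V ^ s * e"
          unfolding S_def V_def tail_altdef
          using e(2)[unfolded E_def tail_altdef]
          by (intro linear_map_pow_le_gauss[OF _ s(1) e(1)]) auto
        define X where "X = e / (?P * (C\<^sup>2) ^ s)"
        define y where "y = sqrt S / (sqrt V * C)"
        have y0: "y \<ge> 0" using SV C by (simp add: y_def)
        have "y ^ (2 * s) = S ^ s / (V ^ s * (C\<^sup>2) ^ s)"
          using SV C by (simp add: y_def power_mult power_divide power_mult_distrib)
        also have "\<dots> \<le> e / (?P * (C\<^sup>2) ^ s)"
          using Se V P C by (simp add: field_simps)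
        finally have "y ^ (2 * s) \<le> X" unfolding X_def .
        then have "1 + real (2 * s) * (y - 1) \<le> X"
          using Bernoulli_inequality[of "y - 1" "2 * s"] y0 by simp
        then have yX: "y * (2 * real s) \<le> X + (2 * real s - 1)"
          by (simp add: algebra_simps)
        have "y * C = y * (2 * real s) * (C / (2 * real s))"
          using s by simp
        also have "\<dots> \<le> (X + (2 * real s - 1)) * (C / (2 * real s))"
          using yX C by (intro mult_right_mono) auto
        also have "\<dots> = X * (C / (2 * real s)) + A"
          by (simp add: A_def distrib_left distrib_right add_divide_distrib diff_divide_distrib mult_ac)
        also have "X * (C / (2 * real s)) = B * e"
          by (simp add: B_def X_def mult_ac)
        finally have "y * C \<le> A + B * e" by simp
        then have "y * C * sqrt V \<le> (A + B * e) * sqrt V"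
          using SV by (intro mult_right_mono) auto
        moreover have "y * C * sqrt V = sqrt S"
          using V C unfolding y_def by simp
        ultimately have "sqrt S \<le> (A + B * e) * sqrt V" by (rule ord_eq_le_trans[OF sym, rotated])
        then have "ennreal (sqrt S) \<le> ennreal ((A + B * e) * sqrt V)" by (rule ennreal_leI)
        then show ?thesis
          using A0 B0 e SV by (simp add: N_def S_def V_def ennreal_mult)
      qed
    qed
  qed
  show ?thesis by (rule that[OF Nm N1 N2])
qed

lemma ennreal_half_add_half:
  assumes "a > 0"
  shows "ennreal (a / 2) + ennreal (1 / (2 * a)) * ennreal (a\<^sup>2) = ennreal a"
proof -
  have "ennreal (1 / (2 * a)) * ennreal (a\<^sup>2) = ennreal (1 / (2 * a) * a\<^sup>2)"
    by (rule ennreal_mult[symmetric]) (use assms in auto)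
  moreover have "1 / (2 * a) * a\<^sup>2 = a / 2"
    using assms by (simp add: power2_eq_square)
  moreover have "ennreal (a / 2) + ennreal (a / 2) = ennreal (a / 2 + a / 2)"
    by (rule ennreal_plus[symmetric]) (use assms in auto)
  ultimately show ?thesis by (simp only: field_sum_of_halves)
qed

text \<open>Second moments suffice here: at \<open>s = 1\<close> each entry of \<open>X\<close>
  contributes at most \<open>1 / (p - 1)\<close>. Jensen's inequality for the square root takes the
  form of the tangent line at \<open>a\<^sup>2\<close>, namely
  \<open>sqrt y \<le> a / 2 + y / (2 * a)\<close>.\<close>

lemma nn_integral_gauss_tail_frob:
  fixes k p m :: nat
  assumes k: "1 \<le> k" and p: "2 \<le> p" and m: "k \<le> m"
  shows "(\<integral>\<^sup>+G. ennreal (sqrt (\<Sum>j<k. \<Sum>i\<in>{k..<m}. (c i * tail k (k + p) G (\<lambda>j'. if j' = j then 1 else 0) i)\<^sup>2))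
     \<partial>gauss ({..<m} \<times> {..<k + p})) \<le> ennreal (sqrt (real k / (real p - 1)) * sqrt (\<Sum>i\<in>{k..<m}. (c i)\<^sup>2))"
proof -
  let ?M = "gauss ({..<m} \<times> {..<k + p})"
  let ?e = "\<lambda>j j'. if j' = j then 1 else 0 :: real"
  define Y where "Y G = (\<Sum>j<k. \<Sum>i\<in>{k..<m}. (c i * tail k (k + p) G (?e j) i)\<^sup>2)" for G
  define F where "F = (\<Sum>i\<in>{k..<m}. (c i)\<^sup>2)"
  define a where "a = sqrt (real k / (real p - 1)) * sqrt F"
  have F0: "F \<ge> 0" by (simp add: F_def sum_nonneg)
  have Y0: "Y G \<ge> 0" for G by (simp add: Y_def sum_nonneg)
  have tm: "(\<lambda>G. tail k (k + p) G (?e j) i) \<in> borel_measurable ?M" if "i \<in> {k..<m}" for i j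
    unfolding measurable_gauss_eq using m that
    by (intro borel_measurable_tail[where g = "\<lambda>x. x" and I = "{..<m} \<times> {..<k + p}"]) auto
  have tm2: "(\<lambda>G. ennreal ((c i * tail k (k + p) G (?e j) i)\<^sup>2)) \<in> borel_measurable ?M" if "i \<in> {k..<m}" for i j
    by (intro measurable_compose[OF _ measurable_ennreal] borel_measurable_power borel_measurable_times
        borel_measurable_const tm that)
  have Ym [measurable]: "Y \<in> borel_measurable ?M"
    unfolding Y_def by (intro borel_measurable_sum borel_measurable_power borel_measurable_times tm borel_measurable_const)
  show ?thesis
  proof (cases "F = 0")
    case True
    then have "c i = 0" if "i \<in> {k..<m}" for i
      using that by (simp add: F_def sum_nonneg_eq_0_iff)
    then show ?thesis by simp
  next
    case False
    then have a: "a > 0" using F0 k p by (simp add: a_def)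
    have one: "(\<integral>\<^sup>+G. ennreal ((tail k (k + p) G (?e j) i)\<^sup>2) \<partial>?M) \<le> ennreal (1 / (real p - 1))"
      if "j < k" "i \<in> {k..<m}" for i j
    proof -
      have "(\<Sum>j'<k. (?e j j')\<^sup>2) = (\<Sum>j'<k. if j' = j then 1 else 0)" by (intro sum.cong) auto
      then have "(\<Sum>j'<k. (?e j j')\<^sup>2) = 1" using that by simp
      then show ?thesis
        using nn_integral_gauss_tail_pow[OF k refl, of 1 p m "{i}" "?e j"] p m that by simp
    qed
    have "(\<integral>\<^sup>+G. ennreal (Y G) \<partial>?M) =
       (\<integral>\<^sup>+G. (\<Sum>j<k. \<Sum>i\<in>{k..<m}. ennreal ((c i * tail k (k + p) G (?e j) i)\<^sup>2)) \<partial>?M)"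
      unfolding Y_def by (simp add: sum_nonneg)
    also have "\<dots> = (\<Sum>j<k. \<Sum>i\<in>{k..<m}. \<integral>\<^sup>+G. ennreal ((c i * tail k (k + p) G (?e j) i)\<^sup>2) \<partial>?M)"
      by (subst nn_integral_sum, (intro borel_measurable_sum tm2; assumption)?, intro sum.cong refl nn_integral_sum tm2) assumption
    also have "\<dots> = (\<Sum>j<k. \<Sum>i\<in>{k..<m}. ennreal ((c i)\<^sup>2) * (\<integral>\<^sup>+G. ennreal ((tail k (k + p) G (?e j) i)\<^sup>2) \<partial>?M))"
    proof (intro sum.cong refl)
      fix i j assume i: "i \<in> {k..<m}"
      have "(\<integral>\<^sup>+G. ennreal ((c i * tail k (k + p) G (?e j) i)\<^sup>2) \<partial>?M) =
          (\<integral>\<^sup>+G. ennreal ((c i)\<^sup>2) * ennreal ((tail k (k + p) G (?e j) i)\<^sup>2) \<partial>?M)"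
        by (simp add: ennreal_mult[symmetric] power_mult_distrib)
      also have "\<dots> = ennreal ((c i)\<^sup>2) * (\<integral>\<^sup>+G. ennreal ((tail k (k + p) G (?e j) i)\<^sup>2) \<partial>?M)"
        by (intro nn_integral_cmult measurable_compose[OF _ measurable_ennreal] borel_measurable_power tm i)
      finally show "(\<integral>\<^sup>+G. ennreal ((c i * tail k (k + p) G (?e j) i)\<^sup>2) \<partial>?M) = \<dots>" .
    qed
    also have "\<dots> \<le> (\<Sum>j<k. \<Sum>i\<in>{k..<m}. ennreal ((c i)\<^sup>2) * ennreal (1 / (real p - 1)))"
      by (intro sum_mono mult_left_mono one) auto
    also have "\<dots> = ennreal (\<Sum>j<k. \<Sum>i\<in>{k..<m}. (c i)\<^sup>2 * (1 / (real p - 1)))"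
      using p by (simp add: ennreal_mult[symmetric] sum_nonneg ennreal_of_nat_eq_real_of_nat)
    also have "(\<Sum>j<k. \<Sum>i\<in>{k..<m}. (c i)\<^sup>2 * (1 / (real p - 1))) = a\<^sup>2"
      using F0 p by (simp add: a_def F_def[symmetric] sum_divide_distrib[symmetric] power_mult_distrib)
    finally have YY: "(\<integral>\<^sup>+G. ennreal (Y G) \<partial>?M) \<le> ennreal (a\<^sup>2)" .
    have "(\<integral>\<^sup>+G. ennreal (sqrt (Y G)) \<partial>?M) \<le> (\<integral>\<^sup>+G. ennreal (a / 2) + ennreal (1 / (2 * a)) * ennreal (Y G) \<partial>?M)"
    proof (rule nn_integral_mono)
      fix G
      have "0 \<le> (sqrt (Y G) - a)\<^sup>2" by simp
      then have "2 * a * sqrt (Y G) \<le> a\<^sup>2 + Y G"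
        using Y0[of G] by (simp add: power2_diff algebra_simps)
      then have "sqrt (Y G) \<le> a / 2 + 1 / (2 * a) * Y G"
        using a by (simp add: field_simps power2_eq_square)
      then show "ennreal (sqrt (Y G)) \<le> ennreal (a / 2) + ennreal (1 / (2 * a)) * ennreal (Y G)"
        using a Y0[of G] by (simp add: ennreal_mult[symmetric] ennreal_plus[symmetric] ennreal_leI del: ennreal_plus)
    qed
    also have "\<dots> = ennreal (a / 2) + ennreal (1 / (2 * a)) * (\<integral>\<^sup>+G. ennreal (Y G) \<partial>?M)"
      using prob_space.emeasure_space_1[OF prob_space_gauss[of "{..<m} \<times> {..<k + p}"]]
      by (subst nn_integral_add) (auto simp: nn_integral_cmult)
    also have "\<dots> \<le> ennreal (a / 2) + ennreal (1 / (2 * a)) * ennreal (a\<^sup>2)"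
      by (intro add_left_mono mult_left_mono YY) auto
    also have "\<dots> = ennreal a"
      by (rule ennreal_half_add_half[OF a])
    finally show ?thesis unfolding Y_def a_def F_def .
  qed
qed

section \<open>Residuals of orthogonal projections\<close>

unbundle no inner_syntax

lemma mult_mat_vec_scalar_prod:
  fixes M :: "real mat"
  assumes "M \<in> carrier_mat r c" "x \<in> carrier_vec c" "y \<in> carrier_vec r"
  shows "(M *\<^sub>v x) \<bullet> y = x \<bullet> (M\<^sup>T *\<^sub>v y)"
proof -
  have c: "M *\<^sub>v x \<in> carrier_vec r" "M\<^sup>T *\<^sub>v y \<in> carrier_vec c"
    using assms by simp_all
  have "(M *\<^sub>v x) \<bullet> y = y \<bullet> (M *\<^sub>v x)"
    by (rule comm_scalar_prod[OF c(1) assms(3)])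
  also have "\<dots> = (M\<^sup>T *\<^sub>v y) \<bullet> x"
    by (rule transpose_vec_mult_scalar[OF assms, symmetric])
  also have "\<dots> = x \<bullet> (M\<^sup>T *\<^sub>v y)"
    by (rule comm_scalar_prod[OF c(2) assms(2)])
  finally show ?thesis .
qed

lemma vnorm2_eq: "v \<in> carrier_vec n \<Longrightarrow> vnorm2 v = sqrt (\<Sum>i<n. (vec_index v i)\<^sup>2)"
  by (auto simp: vnorm2_def scalar_prod_def power2_eq_square lessThan_atLeast0)

lemma vnorm2_nonneg [simp]: "0 \<le> vnorm2 v"
  by (auto simp: vnorm2_def scalar_prod_def intro!: sum_nonneg)

lemma vnorm2_power2: "(vnorm2 v)\<^sup>2 = v \<bullet> v"
  by (auto simp: vnorm2_def scalar_prod_def intro!: sum_nonneg)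

lemma vnorm2_orthonormal_cols:
  assumes M: "M \<in> carrier_mat r c" "M\<^sup>T * M = 1\<^sub>m c" and x: "x \<in> carrier_vec c"
  shows "vnorm2 (M *\<^sub>v x) = vnorm2 x"
proof -
  have "(M *\<^sub>v x) \<bullet> (M *\<^sub>v x) = x \<bullet> (M\<^sup>T *\<^sub>v (M *\<^sub>v x))"
    using M x by (intro mult_mat_vec_scalar_prod) auto
  also have "M\<^sup>T *\<^sub>v (M *\<^sub>v x) = (M\<^sup>T * M) *\<^sub>v x"
    using M x by (intro assoc_mult_mat_vec[symmetric]) auto
  also have "\<dots> = x" using M x by simp
  finally show ?thesis by (simp add: vnorm2_def)
qed

lemma orthogonal_transpose:
  fixes M :: "real mat"
  assumes "M \<in> carrier_mat n n" "M\<^sup>T * M = 1\<^sub>m n"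
  shows "M * M\<^sup>T = 1\<^sub>m n"
  by (rule mat_mult_left_right_inverse[OF _ _ assms(2)]) (use assms(1) in auto)

lemma vnorm2_orthogonal_transpose:
  assumes "M \<in> carrier_mat n n" "M\<^sup>T * M = 1\<^sub>m n" "x \<in> carrier_vec n"
  shows "vnorm2 (M\<^sup>T *\<^sub>v x) = vnorm2 x"
  using assms orthogonal_transpose[OF assms(1,2)]
  by (intro vnorm2_orthonormal_cols[where r = n]) auto

text \<open>With \<open>c = Q\<^sup>T y\<close> the residual is orthogonal to the range of
  \<open>Q\<close>, so Pythagoras applies to \<open>y - Q w = (y - Q c) + Q (c - w)\<close>.\<close>

lemma projection_residual_le:
  assumes Q: "Q \<in> carrier_mat a d" "Q\<^sup>T * Q = 1\<^sub>m d"
    and y: "y \<in> carrier_vec a" and w: "w \<in> carrier_vec d"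
  shows "vnorm2 (y - Q *\<^sub>v (Q\<^sup>T *\<^sub>v y)) \<le> vnorm2 (y - Q *\<^sub>v w)"
proof -
  define c where "c = Q\<^sup>T *\<^sub>v y"
  define u where "u = y - Q *\<^sub>v c"
  define h where "h = c - w"
  have c: "c \<in> carrier_vec d" using Q y by (simp add: c_def)
  have u: "u \<in> carrier_vec a" using Q y c by (simp add: u_def)
  have h: "h \<in> carrier_vec d" using c w by (simp add: h_def)
  have Qh: "Q *\<^sub>v h \<in> carrier_vec a" using Q h by simp
  have "Q\<^sup>T *\<^sub>v u = c - Q\<^sup>T *\<^sub>v (Q *\<^sub>v c)"
    unfolding u_def using Q y c by (subst mult_minus_distrib_mat_vec[of _ d a]) (auto simp: c_def)
  also have "Q\<^sup>T *\<^sub>v (Q *\<^sub>v c) = (Q\<^sup>T * Q) *\<^sub>v c"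
    using Q c by (intro assoc_mult_mat_vec[symmetric]) auto
  also have "c - \<dots> = 0\<^sub>v d" using Q c by simp
  finally have Qu: "Q\<^sup>T *\<^sub>v u = 0\<^sub>v d" .
  have hu: "(Q *\<^sub>v h) \<bullet> u = 0"
    using mult_mat_vec_scalar_prod[OF Q(1) h u] h by (simp add: Qu)
  have eq: "y - Q *\<^sub>v w = u + Q *\<^sub>v h"
  proof -
    have "Q *\<^sub>v h = Q *\<^sub>v c - Q *\<^sub>v w"
      unfolding h_def by (rule mult_minus_distrib_mat_vec[OF Q(1) c w])
    moreover have "y - q = (y - p) + (p - q)" if "p \<in> carrier_vec a" "q \<in> carrier_vec a" for p q
      using that y by (intro eq_vecI) auto
    ultimately show ?thesis
      using Q(1) c w unfolding u_def by simp
  qed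
  have "(vnorm2 (y - Q *\<^sub>v w))\<^sup>2 = u \<bullet> u + u \<bullet> (Q *\<^sub>v h) + ((Q *\<^sub>v h) \<bullet> u + (Q *\<^sub>v h) \<bullet> (Q *\<^sub>v h))"
    unfolding vnorm2_power2 eq using u Qh
    by (simp add: add_scalar_prod_distrib[of _ a] scalar_prod_add_distrib[of _ a])
  also have "u \<bullet> (Q *\<^sub>v h) = 0" using hu comm_scalar_prod[OF u Qh] by simp
  finally have "(vnorm2 (y - Q *\<^sub>v w))\<^sup>2 = (vnorm2 u)\<^sup>2 + (vnorm2 (Q *\<^sub>v h))\<^sup>2"
    using hu by (simp add: vnorm2_power2)
  then have "(vnorm2 u)\<^sup>2 \<le> (vnorm2 (y - Q *\<^sub>v w))\<^sup>2" by simp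
  then show ?thesis
    unfolding u_def c_def by (rule power2_le_imp_le) simp
qed

lemma spec_norm_le:
  assumes M: "M \<in> carrier_mat a b" and b: "b > 0"
    and le: "\<And>x. x \<in> carrier_vec b \<Longrightarrow> vnorm2 (M *\<^sub>v x) \<le> c * vnorm2 x"
  shows "spec_norm M \<le> c"
  unfolding spec_norm_def
proof (rule cSup_least)
  have "vnorm2 (unit_vec b 0) = 1" using b by (simp add: vnorm2_def)
  then show "{vnorm2 (M *\<^sub>v x) |x. x \<in> carrier_vec (dim_col M) \<and> vnorm2 x = 1} \<noteq> {}"
    using M b by (auto intro!: exI[of _ "unit_vec b 0"])
next
  fix y assume "y \<in> {vnorm2 (M *\<^sub>v x) |x. x \<in> carrier_vec (dim_col M) \<and> vnorm2 x = 1}"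
  then show "y \<le> c" using le M by force
qed

text \<open>The squared norm of \<open>M\<^sup>T y\<close> is the inner product of
  \<open>M (M\<^sup>T y)\<close> with \<open>y\<close>, and one factor cancels. This carries bounds
  for \<open>A\<^sup>T - P P\<^sup>T A\<^sup>T\<close> over to its transpose.\<close>

lemma vnorm2_transpose_le:
  assumes M: "M \<in> carrier_mat a b" and c: "c \<ge> 0"
    and le: "\<And>x. x \<in> carrier_vec b \<Longrightarrow> vnorm2 (M *\<^sub>v x) \<le> c * vnorm2 x"
    and y: "y \<in> carrier_vec a"
  shows "vnorm2 (M\<^sup>T *\<^sub>v y) \<le> c * vnorm2 y"
proof -
  define z where "z = M\<^sup>T *\<^sub>v y"
  have z: "z \<in> carrier_vec b" using M y by (simp add: z_def)
  have "(vnorm2 z)\<^sup>2 = (M *\<^sub>v z) \<bullet> y"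
    using mult_mat_vec_scalar_prod[OF M z y] by (simp add: vnorm2_power2 z_def)
  also have "\<dots> = (\<Sum>i<a. vec_index (M *\<^sub>v z) i * vec_index y i)"
    using y by (auto simp: scalar_prod_def lessThan_atLeast0)
  also have "\<dots> \<le> sqrt ((\<Sum>i<a. (vec_index (M *\<^sub>v z) i)\<^sup>2) * (\<Sum>i<a. (vec_index y i)\<^sup>2))"
    by (rule real_le_rsqrt) (rule Cauchy_Schwarz_ineq_sum)
  also have "\<dots> = vnorm2 (M *\<^sub>v z) * vnorm2 y"
    using M z y by (simp add: real_sqrt_mult vnorm2_eq[of _ a])
  also have "\<dots> \<le> c * vnorm2 z * vnorm2 y"
    by (intro mult_right_mono le z) simp
  finally have "vnorm2 z * vnorm2 z \<le> vnorm2 z * (c * vnorm2 y)"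
    by (simp add: power2_eq_square mult_ac)
  moreover have "0 \<le> c * vnorm2 y" using c by simp
  ultimately show ?thesis
    unfolding z_def[symmetric]
    by (metis mult_le_cancel_left_pos order_le_less vnorm2_nonneg)
qed

lemma frob_norm_transpose: "frob_norm (M\<^sup>T) = frob_norm M"
  unfolding frob_norm_def by (subst sum.swap) simp

text \<open>Multiplication by \<open>W\<^sup>T\<close> preserves the norm of each row of
  \<open>M\<close>. The purpose is to test \<open>M\<close> on the right singular vectors.\<close>

lemma frob_norm_cols:
  assumes M: "M \<in> carrier_mat a b" and W: "W \<in> carrier_mat b b" "W\<^sup>T * W = 1\<^sub>m b"
  shows "(frob_norm M)\<^sup>2 = (\<Sum>j<b. (vnorm2 (M *\<^sub>v (W *\<^sub>v unit_vec b j)))\<^sup>2)"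
proof -
  have row: "(\<Sum>j<b. (M $$ (i, j))\<^sup>2) = (\<Sum>j<b. (vec_index (M *\<^sub>v (W *\<^sub>v unit_vec b j)) i)\<^sup>2)" if i: "i < a" for i
  proof -
    have r: "row M i \<in> carrier_vec b" using M by auto
    have "(\<Sum>j<b. (vec_index (M *\<^sub>v (W *\<^sub>v unit_vec b j)) i)\<^sup>2) = (\<Sum>j<b. (vec_index (W\<^sup>T *\<^sub>v row M i) j)\<^sup>2)"
    proof (intro sum.cong refl)
      fix j assume j: "j \<in> {..<b}"
      have "vec_index (M *\<^sub>v (W *\<^sub>v unit_vec b j)) i = row M i \<bullet> (W *\<^sub>v unit_vec b j)"
        using i M by simp
      also have "\<dots> = (W *\<^sub>v unit_vec b j) \<bullet> row M i"
        using r W by (intro comm_scalar_prod) auto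
      also have "\<dots> = unit_vec b j \<bullet> (W\<^sup>T *\<^sub>v row M i)"
        using r W by (intro mult_mat_vec_scalar_prod) auto
      also have "\<dots> = vec_index (W\<^sup>T *\<^sub>v row M i) j"
        using r W j by (intro scalar_prod_left_unit) auto
      finally show "(vec_index (M *\<^sub>v (W *\<^sub>v unit_vec b j)) i)\<^sup>2 = (vec_index (W\<^sup>T *\<^sub>v row M i) j)\<^sup>2"
        by simp
    qed
    also have "\<dots> = (vnorm2 (W\<^sup>T *\<^sub>v row M i))\<^sup>2"
      using r W by (subst vnorm2_eq[of _ b]) (auto simp: sum_nonneg)
    also have "\<dots> = (vnorm2 (row M i))\<^sup>2"
      by (simp only: vnorm2_orthogonal_transpose[OF W r])
    also have "\<dots> = (\<Sum>j<b. (M $$ (i, j))\<^sup>2)"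
      using r M i by (subst vnorm2_eq[of _ b]) (auto simp: sum_nonneg)
    finally show ?thesis ..
  qed
  have "(frob_norm M)\<^sup>2 = (\<Sum>i<a. \<Sum>j<b. (M $$ (i, j))\<^sup>2)"
    using M by (simp add: frob_norm_def sum_nonneg)
  also have "\<dots> = (\<Sum>j<b. \<Sum>i<a. (vec_index (M *\<^sub>v (W *\<^sub>v unit_vec b j)) i)\<^sup>2)"
    by (simp add: row, rule sum.swap)
  also have "\<dots> = (\<Sum>j<b. (vnorm2 (M *\<^sub>v (W *\<^sub>v unit_vec b j)))\<^sup>2)"
  proof (intro sum.cong refl)
    fix j
    have "M *\<^sub>v (W *\<^sub>v unit_vec b j) \<in> carrier_vec a"
      by (intro mult_mat_vec_carrier[OF M] mult_mat_vec_carrier[OF W(1)] unit_vec_carrier)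
    then show "(\<Sum>i<a. (vec_index (M *\<^sub>v (W *\<^sub>v unit_vec b j)) i)\<^sup>2) = (vnorm2 (M *\<^sub>v (W *\<^sub>v unit_vec b j)))\<^sup>2"
      by (subst vnorm2_eq) (auto simp: sum_nonneg)
  qed
  finally show ?thesis .
qed

lemma tail_scale: "tail k d G (\<lambda>j. c * v j) i = c * tail k d G v i"
  unfolding tail_altdef by (simp add: sum_distrib_left mult_ac)

lemma tail_cong: "(\<And>j. j < k \<Longrightarrow> v j = v' j) \<Longrightarrow> tail k d G v i = tail k d G v' i"
  unfolding tail_altdef by (intro sum.cong) auto

text \<open>Common form of the two residuals: \<open>A\<close> with \<open>Q\<close> and
  \<open>t = 2 * q + 2\<close>, or \<open>A\<^sup>T\<close> with \<open>P\<close> and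
  \<open>t = 2 * q + 1\<close>. \<open>L\<close> and \<open>W\<close> are the singular bases of
  \<open>B\<close>, and \<open>G\<close> is the rotated test matrix. \<open>range\<close> says, in
  the coordinates of \<open>L\<close>, that the range of \<open>Q\<close> contains the image of
  \<open>G\<close> scaled by the \<open>t\<close>-th powers of the singular values. As
  \<open>B\<close> may be tall or wide, \<open>m\<close> bounds both dimensions.\<close>

locale residual =
  fixes B L W Q :: "real mat" and sg :: "nat \<Rightarrow> real" and G :: "nat \<times> nat \<Rightarrow> real"
    and a b d k m t :: nat and s0 s1 :: real
  assumes B: "B \<in> carrier_mat a b"
    and L: "L \<in> carrier_mat a a" "L\<^sup>T * L = 1\<^sub>m a"
    and W: "W \<in> carrier_mat b b" "W\<^sup>T * W = 1\<^sub>m b"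
    and Q: "Q \<in> carrier_mat a d" "Q\<^sup>T * Q = 1\<^sub>m d"
    and svd: "\<And>x i. x \<in> carrier_vec b \<Longrightarrow> i < a \<Longrightarrow> vec_index (L\<^sup>T *\<^sub>v (B *\<^sub>v x)) i =
      (if i < b then sg i * vec_index (W\<^sup>T *\<^sub>v x) i else 0)"
    and range: "\<And>z. \<exists>w\<in>carrier_vec d. \<forall>i<a. vec_index (L\<^sup>T *\<^sub>v (Q *\<^sub>v w)) i =
      sg i ^ t * (\<Sum>l<d. G (i, l) * z l)"
    and t: "t \<ge> 1" and dims: "k \<le> a" "k \<le> b" "a \<le> m" "b \<le> m" "0 < a" "0 < b"
    and sg: "\<And>i. 0 \<le> sg i" "\<And>i. i < k \<Longrightarrow> s0 \<le> sg i" "\<And>i. k \<le> i \<Longrightarrow> sg i \<le> s1"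
    and s0: "0 < s0" and s1: "0 \<le> s1"
    and det: "Determinant.det (gram k d G) \<noteq> 0"
begin

abbreviation "M \<equiv> B - Q * Q\<^sup>T * B"

lemma M_carrier: "M \<in> carrier_mat a b"
  using B Q by auto

lemma residual_le:
  assumes x: "x \<in> carrier_vec b"
  defines "y \<equiv> \<lambda>i. vec_index (W\<^sup>T *\<^sub>v x) i"
  shows "vnorm2 (M *\<^sub>v x) \<le> sqrt (\<Sum>i\<in>{k..<a}.
    ((if i < b then sg i * y i else 0) - sg i ^ t * tail k d G (\<lambda>j. y j / sg j ^ (t - 1)) i)\<^sup>2)"
proof -
  \<comment> \<open>Dividing by \<open>sg j ^ (t - 1)\<close> makes the leading coordinates of the
    competitor, \<open>sg j ^ t * v j\<close>, equal to those of \<open>B x\<close>, since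
    \<open>rinv\<close> is a right inverse.\<close>
  define v where "v j = y j / sg j ^ (t - 1)" for j
  define z where "z l = (\<Sum>j<k. rinv k d G l j * v j)" for l
  obtain w where w: "w \<in> carrier_vec d"
    "\<And>i. i < a \<Longrightarrow> vec_index (L\<^sup>T *\<^sub>v (Q *\<^sub>v w)) i = sg i ^ t * (\<Sum>l<d. G (i, l) * z l)"
    using range[of z] by blast
  let ?u = "\<lambda>i. ((if i < b then sg i * y i else 0) - sg i ^ t * (\<Sum>l<d. G (i, l) * z l))\<^sup>2" and ?w = "\<lambda>i. ((if i < b then sg i * y i else 0) - sg i ^ t * tail k d G v i)\<^sup>2"
  have Bx: "B *\<^sub>v x \<in> carrier_vec a" and Qw: "Q *\<^sub>v w \<in> carrier_vec a" using B Q x w by auto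
  have "M *\<^sub>v x = B *\<^sub>v x - Q *\<^sub>v (Q\<^sup>T *\<^sub>v (B *\<^sub>v x))"
  proof -
    have "M *\<^sub>v x = B *\<^sub>v x - (Q * Q\<^sup>T * B) *\<^sub>v x"
      using B Q x by (intro minus_mult_distrib_mat_vec[of _ a b]) auto
    also have "(Q * Q\<^sup>T * B) *\<^sub>v x = (Q * Q\<^sup>T) *\<^sub>v (B *\<^sub>v x)"
      using B Q x by (intro assoc_mult_mat_vec[of _ a a _ b]) auto
    also have "\<dots> = Q *\<^sub>v (Q\<^sup>T *\<^sub>v (B *\<^sub>v x))"
      using B Q x by (intro assoc_mult_mat_vec[of _ a d _ a]) auto
    finally show ?thesis .
  qed
  then have "vnorm2 (M *\<^sub>v x) \<le> vnorm2 (B *\<^sub>v x - Q *\<^sub>v w)"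
    using projection_residual_le[OF Q Bx w(1)] by simp
  also have "\<dots> = vnorm2 (L\<^sup>T *\<^sub>v (B *\<^sub>v x - Q *\<^sub>v w))"
    using Bx Qw by (intro vnorm2_orthogonal_transpose[OF L, symmetric]) auto
  also have "L\<^sup>T *\<^sub>v (B *\<^sub>v x - Q *\<^sub>v w) = L\<^sup>T *\<^sub>v (B *\<^sub>v x) - L\<^sup>T *\<^sub>v (Q *\<^sub>v w)"
    using L Bx Qw by (intro mult_minus_distrib_mat_vec[of _ a a]) auto
  also have "vnorm2 \<dots> = sqrt (\<Sum>i<a. ?u i)"
  proof -
    have "L\<^sup>T *\<^sub>v (B *\<^sub>v x) - L\<^sup>T *\<^sub>v (Q *\<^sub>v w) \<in> carrier_vec a"
      using L(1) mult_mat_vec_carrier[OF _ Bx, of "L\<^sup>T" a] mult_mat_vec_carrier[OF _ Qw, of "L\<^sup>T" a]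
      by (simp only: minus_carrier_vec transpose_carrier_mat)
    moreover have "vec_index (L\<^sup>T *\<^sub>v (B *\<^sub>v x) - L\<^sup>T *\<^sub>v (Q *\<^sub>v w)) i =
        (if i < b then sg i * y i else 0) - sg i ^ t * (\<Sum>l<d. G (i, l) * z l)" if "i < a" for i
    proof -
      have "vec_index (L\<^sup>T *\<^sub>v (B *\<^sub>v x) - L\<^sup>T *\<^sub>v (Q *\<^sub>v w)) i =
        vec_index (L\<^sup>T *\<^sub>v (B *\<^sub>v x)) i - vec_index (L\<^sup>T *\<^sub>v (Q *\<^sub>v w)) i"
        using that L by (intro index_minus_vec) auto
      then show ?thesis unfolding svd[OF x that] w(2)[OF that] y_def .
    qed
    ultimately show ?thesis by (subst vnorm2_eq) auto
  qed
  also have "(\<Sum>i<a. ?u i) =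
      (\<Sum>i\<in>{k..<a}. ?w i)"
  proof -
    have 0: "?u i = 0" if i: "i < k" for i
    proof -
      have "(\<Sum>l<d. G (i, l) * z l) = (\<Sum>j<k. (\<Sum>l<d. G (i, l) * rinv k d G l j) * v j)"
        unfolding z_def by (simp add: sum_distrib_left sum_distrib_right mult.assoc, rule sum.swap)
      also have "\<dots> = (\<Sum>j<k. if i = j then v j else 0)"
        using i by (intro sum.cong) (auto simp: rinv_right_inverse[OF det])
      also have "\<dots> = v i" using i by simp
      finally have G: "(\<Sum>l<d. G (i, l) * z l) = v i" .
      have "sg i ^ t = sg i ^ (t - 1) * sg i"
        using t by (cases t) simp_all
      moreover have "sg i > 0" using sg(2)[OF i] s0 by simp
      ultimately have "sg i ^ t * v i = sg i * y i" by (simp add: v_def)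
      then show ?thesis unfolding G using i dims by simp
    qed
    have "{k..<a} \<subseteq> {..<a}" by auto
    then have "(\<Sum>i<a. ?u i) =
       (\<Sum>i\<in>{k..<a}. ?u i)"
    proof (rule sum.mono_neutral_right[rotated])
      show "\<forall>i\<in>{..<a} - {k..<a}. ?u i = 0"
      proof
        fix i assume "i \<in> {..<a} - {k..<a}"
        then have ik: "i < k" by auto
        show "?u i = 0"
          by (fact 0[OF ik])
      qed
    qed simp
    also have "\<dots> = (\<Sum>i\<in>{k..<a}. ?w i)"
      by (simp add: tail_def z_def mult.commute)
    finally show ?thesis .
  qed
  finally show ?thesis unfolding v_def .
qed

text \<open>Minkowski's inequality separates the trailing part of \<open>B x\<close>, at most
  \<open>s1\<close> times the norm of \<open>x\<close>, from the competitor. The latter carries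
  \<open>sg i ^ t \<le> s1 ^ t\<close>, and \<open>v\<close> carries at most
  \<open>1 / s0 ^ (t - 1)\<close>, so one factor \<open>s1\<close> stays outside the ratio.\<close>

lemma vnorm2_le:
  assumes N: "N \<ge> 0" "\<And>v. sqrt (\<Sum>i\<in>{k..<m}. (tail k d G v i)\<^sup>2) \<le> N * sqrt (\<Sum>j<k. (v j)\<^sup>2)"
    and x: "x \<in> carrier_vec b"
  shows "vnorm2 (M *\<^sub>v x) \<le> (s1 * (1 + (s1 / s0) ^ (t - 1) * N)) * vnorm2 x"
proof -
  define y where "y i = vec_index (W\<^sup>T *\<^sub>v x) i" for i
  define v where "v j = y j / sg j ^ (t - 1)" for j
  let ?p = "\<lambda>i. if i < b then sg i * y i else 0" and ?q = "\<lambda>i. sg i ^ t * tail k d G v i"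
  have yx: "(\<Sum>i<b. (y i)\<^sup>2) = (vnorm2 x)\<^sup>2"
  proof -
    have "(vnorm2 x)\<^sup>2 = (vnorm2 (W\<^sup>T *\<^sub>v x))\<^sup>2"
      by (simp only: vnorm2_orthogonal_transpose[OF W x])
    also have "\<dots> = (\<Sum>i<b. (y i)\<^sup>2)"
      using W x by (subst vnorm2_eq[of _ b]) (auto simp: y_def sum_nonneg)
    finally show ?thesis ..
  qed
  have pb: "L2_set ?p {k..<a} \<le> s1 * vnorm2 x"
  proof -
    have "(\<Sum>i\<in>{k..<a}. (?p i)\<^sup>2) \<le> (\<Sum>i\<in>{k..<a} \<inter> {..<b}. s1\<^sup>2 * (y i)\<^sup>2)"
    proof -
      have "(\<Sum>i\<in>{k..<a}. (?p i)\<^sup>2) = (\<Sum>i\<in>{k..<a} \<inter> {..<b}. (?p i)\<^sup>2)"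
        by (rule sum.mono_neutral_right) auto
      also have "\<dots> \<le> (\<Sum>i\<in>{k..<a} \<inter> {..<b}. s1\<^sup>2 * (y i)\<^sup>2)"
        using sg s1 by (intro sum_mono) (auto simp: power_mult_distrib intro!: mult_right_mono power_mono)
      finally show ?thesis .
    qed
    also have "\<dots> \<le> (\<Sum>i<b. s1\<^sup>2 * (y i)\<^sup>2)"
      by (rule sum_mono2) auto
    also have "\<dots> = (s1 * vnorm2 x)\<^sup>2"
      by (simp add: sum_distrib_left[symmetric] yx power_mult_distrib)
    finally have "sqrt (\<Sum>i\<in>{k..<a}. (?p i)\<^sup>2) \<le> s1 * vnorm2 x"
      using s1 by (intro real_le_lsqrt) (auto simp: sum_nonneg)
    then show ?thesis unfolding L2_set_def .
  qed
  have qb: "L2_set (\<lambda>i. - ?q i) {k..<a} \<le> s1 ^ t * (N * (vnorm2 x / s0 ^ (t - 1)))"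
  proof -
    have "(\<Sum>i\<in>{k..<a}. (- ?q i)\<^sup>2) \<le> (\<Sum>i\<in>{k..<a}. (s1 ^ t)\<^sup>2 * (tail k d G v i)\<^sup>2)"
      using sg s1 by (intro sum_mono) (auto simp: power_mult_distrib intro!: mult_right_mono power_mono)
    also have "\<dots> \<le> (\<Sum>i\<in>{k..<m}. (s1 ^ t)\<^sup>2 * (tail k d G v i)\<^sup>2)"
      using dims by (intro sum_mono2) auto
    finally have "sqrt (\<Sum>i\<in>{k..<a}. (- ?q i)\<^sup>2) \<le> sqrt ((s1 ^ t)\<^sup>2 * (\<Sum>i\<in>{k..<m}. (tail k d G v i)\<^sup>2))"
      by (simp add: sum_distrib_left[symmetric])
    also have "\<dots> = s1 ^ t * sqrt (\<Sum>i\<in>{k..<m}. (tail k d G v i)\<^sup>2)"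
      using s1 by (simp add: real_sqrt_mult)
    also have "\<dots> \<le> s1 ^ t * (N * sqrt (\<Sum>j<k. (v j)\<^sup>2))"
      using s1 by (intro mult_left_mono N) auto
    also have "\<dots> \<le> s1 ^ t * (N * (vnorm2 x / s0 ^ (t - 1)))"
    proof -
      have "(\<Sum>j<k. (v j)\<^sup>2) \<le> (\<Sum>j<k. (y j)\<^sup>2 / (s0 ^ (t - 1))\<^sup>2)"
      proof (intro sum_mono)
        fix j assume "j \<in> {..<k}"
        then have "s0 ^ (t - 1) \<le> sg j ^ (t - 1)" using s0 sg(2)[of j] by (intro power_mono) auto
        then have "(s0 ^ (t - 1))\<^sup>2 \<le> (sg j ^ (t - 1))\<^sup>2" by (rule power_mono) (use s0 in simp)
        then show "(v j)\<^sup>2 \<le> (y j)\<^sup>2 / (s0 ^ (t - 1))\<^sup>2"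
          using s0 unfolding v_def power_divide by (intro divide_left_mono mult_pos_pos) (auto intro: less_le_trans[of _ "(s0 ^ (t - 1))\<^sup>2"])
      qed
      also have "\<dots> \<le> (\<Sum>j<b. (y j)\<^sup>2 / (s0 ^ (t - 1))\<^sup>2)"
        using dims by (intro sum_mono2) auto
      also have "\<dots> = (vnorm2 x / s0 ^ (t - 1))\<^sup>2"
        by (simp add: sum_divide_distrib[symmetric] yx power_divide)
      finally have "sqrt (\<Sum>j<k. (v j)\<^sup>2) \<le> vnorm2 x / s0 ^ (t - 1)"
        using s0 by (intro real_le_lsqrt) (auto simp: sum_nonneg)
      then show ?thesis using s1 N(1) by (intro mult_left_mono) auto
    qed
    finally show ?thesis unfolding L2_set_def .
  qed
  have c1: "vnorm2 (M *\<^sub>v x) \<le> L2_set (\<lambda>i. ?p i + (- ?q i)) {k..<a}"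
    using residual_le[OF x] unfolding L2_set_def y_def v_def by simp
  have c2: "L2_set (\<lambda>i. ?p i + (- ?q i)) {k..<a} \<le> L2_set ?p {k..<a} + L2_set (\<lambda>i. - ?q i) {k..<a}"
    by (rule L2_set_triangle_ineq)
  have st: "s1 ^ t = s1 * s1 ^ (t - 1)"
    using t by (cases t) simp_all
  have c3: "s1 * X + s1 ^ t * (N * (X / s0 ^ (t - 1))) = (s1 * (1 + (s1 / s0) ^ (t - 1) * N)) * X" for X
    unfolding st power_divide by (simp add: distrib_left distrib_right mult_ac)
  show ?thesis
    using order_trans[OF c1 order_trans[OF c2 add_mono[OF pb qb]]] unfolding c3 .
qed

text \<open>On the right singular vectors the two parts of the residual do not meet: for
  \<open>j \<ge> k\<close> the competitor is zero, and for \<open>j < k\<close> the trailing part of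
  \<open>B x\<close> is. The squares therefore add. One factor \<open>sg i\<close> is kept inside
  the tail term, so that it later yields the Frobenius norm of the trailing block instead of
  \<open>s1\<close>.\<close>

lemma frob_le:
  "frob_norm M \<le> sqrt (\<Sum>i\<in>{k..<m}. (sg i)\<^sup>2) + (s1 / s0) ^ (t - 1) *
    sqrt (\<Sum>j<k. \<Sum>i\<in>{k..<m}. (sg i * tail k d G (\<lambda>j'. if j' = j then 1 else 0) i)\<^sup>2)"
proof -
  let ?e = "\<lambda>j j'. if j' = j then 1 else 0 :: real"
  let ?F = "\<Sum>i\<in>{k..<m}. (sg i)\<^sup>2" and ?\<rho> = "(s1 / s0) ^ (t - 1)"
  let ?n = "\<lambda>j. (vnorm2 (M *\<^sub>v (W *\<^sub>v unit_vec b j)))\<^sup>2" and ?r = "\<lambda>j i. ((if i < b then sg i * ?e j i else 0) - sg i ^ t * tail k d G (\<lambda>j'. ?e j j' / sg j' ^ (t - 1)) i)\<^sup>2"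
  let ?Y = "\<lambda>j. \<Sum>i\<in>{k..<m}. (sg i * tail k d G (?e j) i)\<^sup>2"
  have \<rho>0: "?\<rho> \<ge> 0" using s0 s1 by simp
  have y: "vec_index (W\<^sup>T *\<^sub>v (W *\<^sub>v unit_vec b j)) i = ?e j i" if "i < b" "j < b" for i j
  proof -
    have "W\<^sup>T *\<^sub>v (W *\<^sub>v unit_vec b j) = (W\<^sup>T * W) *\<^sub>v unit_vec b j"
      using W by (intro assoc_mult_mat_vec[symmetric, of _ b b _ b]) auto
    also have "\<dots> = unit_vec b j" using W by simp
    finally show ?thesis using that by auto
  qed
  have col: "?n j \<le>
     (\<Sum>i\<in>{k..<a}. ?r j i)"
    if j: "j < b" for j
  proof -
    have c: "W *\<^sub>v unit_vec b j \<in> carrier_vec b" using W by auto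
    let ?y = "\<lambda>i. vec_index (W\<^sup>T *\<^sub>v (W *\<^sub>v unit_vec b j)) i"
    let ?ry = "\<lambda>i. ((if i < b then sg i * ?y i else 0) - sg i ^ t * tail k d G (\<lambda>j'. ?y j' / sg j' ^ (t - 1)) i)\<^sup>2"
    have "?n j \<le> (sqrt (\<Sum>i\<in>{k..<a}.
      ?ry i))\<^sup>2"
      by (intro power_mono residual_le c) simp
    also have "\<dots> = (\<Sum>i\<in>{k..<a}.
      ?ry i)"
      by (simp add: sum_nonneg)
    also have "\<dots> = (\<Sum>i\<in>{k..<a}. ?r j i)"
    proof (intro sum.cong refl arg_cong[where f = "\<lambda>x. x\<^sup>2"] arg_cong2[where f = "(-)"] arg_cong2[where f = "(*)"])
      fix i
      show "(if i < b then sg i * ?y i else 0) = (if i < b then sg i * ?e j i else 0)"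
        using y[of i j] j by (cases "i < b") (simp_all only: if_True if_False)
      show "tail k d G (\<lambda>j'. ?y j' / sg j' ^ (t - 1)) i = tail k d G (\<lambda>j'. ?e j j' / sg j' ^ (t - 1)) i"
      proof (rule tail_cong)
        fix j' assume "j' < k"
        then have "j' < b" using dims by simp
        then show "?y j' / sg j' ^ (t - 1) = ?e j j' / sg j' ^ (t - 1)" using y[of j' j] j by (simp only:)
      qed
    qed
    finally show ?thesis .
  qed
  have high: "?n j \<le> (sg j)\<^sup>2" if j: "j \<in> {k..<b}" for j
  proof -
    have "tail k d G (\<lambda>j'. ?e j j' / sg j' ^ (t - 1)) i = tail k d G (\<lambda>j'. 0 * 0) i" for i
      using j by (intro tail_cong) auto
    then have t0: "tail k d G (\<lambda>j'. ?e j j' / sg j' ^ (t - 1)) i = 0" for i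
      by (simp add: tail_scale[of k d G 0 "\<lambda>_. 0", simplified] tail_def)
    have "?n j \<le> (\<Sum>i\<in>{k..<a}. if i = j then (sg j)\<^sup>2 else 0)"
    proof (rule order_trans[OF col])
      show "j < b" using j by simp
      show "(\<Sum>i\<in>{k..<a}. ?r j i) \<le>
          (\<Sum>i\<in>{k..<a}. if i = j then (sg j)\<^sup>2 else 0)"
        unfolding t0 by (intro sum_mono) auto
    qed
    also have "\<dots> \<le> (sg j)\<^sup>2" by simp
    finally show ?thesis .
  qed
  have low: "?n j \<le> ?\<rho>\<^sup>2 * ?Y j" if j: "j < k" for j
  proof -
    have sj: "sg j > 0" "s0 \<le> sg j" using sg(2)[OF j] s0 by auto
    have tl: "tail k d G (\<lambda>j'. ?e j j' / sg j' ^ (t - 1)) i = 1 / sg j ^ (t - 1) * tail k d G (?e j) i" for i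
      unfolding tail_scale[symmetric] by (intro tail_cong) auto
    have "?n j \<le> (\<Sum>i\<in>{k..<a}. ?\<rho>\<^sup>2 * (sg i * tail k d G (?e j) i)\<^sup>2)"
    proof (rule order_trans[OF col sum_mono])
      show "j < b" using j dims by simp
      fix i assume i: "i \<in> {k..<a}"
      have st: "sg i ^ t = sg i * sg i ^ (t - 1)"
        using t by (cases t) simp_all
      have "(sg i / sg j) ^ (t - 1) \<le> ?\<rho>"
        using i sj sg s0 s1 by (intro power_mono frac_le) auto
      then have "((sg i / sg j) ^ (t - 1))\<^sup>2 \<le> ?\<rho>\<^sup>2"
        by (rule power_mono) (use sg(1)[of i] sj in simp)
      then have "((sg i / sg j) ^ (t - 1))\<^sup>2 * (sg i * tail k d G (?e j) i)\<^sup>2 \<le> ?\<rho>\<^sup>2 * (sg i * tail k d G (?e j) i)\<^sup>2"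
        by (rule mult_right_mono) simp
      moreover have "(if i < b then sg i * ?e j i else 0) = 0" using i j by auto
      ultimately show "?r j i \<le>
          ?\<rho>\<^sup>2 * (sg i * tail k d G (?e j) i)\<^sup>2"
        unfolding tl st by (simp add: power_divide power_mult_distrib mult_ac)
    qed
    also have "\<dots> \<le> (\<Sum>i\<in>{k..<m}. ?\<rho>\<^sup>2 * (sg i * tail k d G (?e j) i)\<^sup>2)"
      using dims by (intro sum_mono2) auto
    finally show ?thesis by (simp add: sum_distrib_left)
  qed
  have split: "{..<b} = {..<k} \<union> {k..<b}" using dims by auto
  have "(frob_norm M)\<^sup>2 = (\<Sum>j<b. ?n j)"
    by (rule frob_norm_cols[OF M_carrier W])
  also have "\<dots> = (\<Sum>j<k. ?n j) + (\<Sum>j\<in>{k..<b}. ?n j)"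
    unfolding split by (rule sum.union_disjoint) auto
  also have "\<dots> \<le> (\<Sum>j<k. ?\<rho>\<^sup>2 * ?Y j) + (\<Sum>j\<in>{k..<b}. (sg j)\<^sup>2)"
    by (intro add_mono sum_mono low high) simp_all
  also have "\<dots> \<le> ?\<rho>\<^sup>2 * (\<Sum>j<k. ?Y j) + ?F"
    unfolding sum_distrib_left using dims by (intro add_left_mono sum_mono2) simp_all
  also have "\<dots> \<le> (sqrt ?F + ?\<rho> * sqrt (\<Sum>j<k. ?Y j))\<^sup>2"
  proof -
    have aux: "r\<^sup>2 * Z + F \<le> (sqrt F + r * sqrt Z)\<^sup>2" if "0 \<le> F" "0 \<le> Z" "0 \<le> r" for F Z r :: real
      using that by (simp add: power2_sum power_mult_distrib)
    show ?thesis by (rule aux) (intro sum_nonneg \<rho>0 zero_le_power2)+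
  qed
  finally have "(frob_norm M)\<^sup>2 \<le> (sqrt ?F + ?\<rho> * sqrt (\<Sum>j<k. ?Y j))\<^sup>2" .
  then show ?thesis
    by (rule power2_le_imp_le) (intro add_nonneg_nonneg mult_nonneg_nonneg \<rho>0 real_sqrt_ge_zero sum_nonneg zero_le_power2)
qed

end

text \<open>\<open>P\<close> projects from the right; the transpose projects from the left, as in
  \<open>residual\<close>.\<close>

lemma transpose_residual:
  fixes A P :: "real mat"
  assumes A: "A \<in> carrier_mat m n" and P: "P \<in> carrier_mat n d"
  shows "A - A * P * P\<^sup>T = transpose_mat (A\<^sup>T - P * P\<^sup>T * A\<^sup>T)"
proof -
  have At: "A\<^sup>T \<in> carrier_mat n m" and PP: "P * P\<^sup>T \<in> carrier_mat n n"
    using A P by simp_all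
  have "transpose_mat (P * P\<^sup>T * A\<^sup>T) = A * transpose_mat (P * P\<^sup>T)"
    using transpose_mult[OF PP At] by simp
  also have "transpose_mat (P * P\<^sup>T) = P * P\<^sup>T"
    using transpose_mult[OF P, of "P\<^sup>T" n] P by simp
  also have "A * (P * P\<^sup>T) = A * P * P\<^sup>T"
    using assoc_mult_mat[OF A P, of "P\<^sup>T" n] P by simp
  finally show ?thesis
    using transpose_minus[OF At, of "P * P\<^sup>T * A\<^sup>T"] PP At by simp
qed

section \<open>The singular value decomposition and RU-QLP\<close>

locale svd_setting =
  fixes A U V :: "real mat" and \<sigma> :: "nat \<Rightarrow> real" and m n :: nat
  assumes mn: "n \<le> m"
    and A: "A \<in> carrier_mat m n"
    and U: "U \<in> carrier_mat m m" "U\<^sup>T * U = 1\<^sub>m m"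
    and V: "V \<in> carrier_mat n n" "V\<^sup>T * V = 1\<^sub>m n"
    and svd: "A = U * mat m n (\<lambda>(i,j). if i = j then \<sigma> (i+1) else 0) * V\<^sup>T"
begin

text \<open>Singular values shifted to coordinates that start at \<open>0\<close> and padded with
  zeros, because \<open>U\<^sup>T A x\<close> has \<open>m\<close> coordinates.\<close>

definition sg :: "nat \<Rightarrow> real" where
  "sg i = (if i < n then \<sigma> (i + 1) else 0)"

abbreviation "S \<equiv> mat m n (\<lambda>(i,j). if i = j then \<sigma> (i+1) else 0)"

lemma S_mult:
  assumes "y \<in> carrier_vec n" "i < m"
  shows "vec_index (S *\<^sub>v y) i = (if i < n then sg i * vec_index y i else 0)"
proof -
  have "vec_index (S *\<^sub>v y) i = (\<Sum>j<n. S $$ (i, j) * vec_index y j)"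
    by (rule mult_mat_vec_index_sum[of _ m n]) (use assms in simp_all)
  also have "\<dots> = (\<Sum>j<n. if i = j then \<sigma> (i + 1) * vec_index y j else 0)"
    using assms by (intro sum.cong) auto
  finally show ?thesis by (simp add: sg_def)
qed

lemma S_transpose_mult:
  assumes "y \<in> carrier_vec m" "i < n"
  shows "vec_index (S\<^sup>T *\<^sub>v y) i = sg i * vec_index y i"
proof -
  have "vec_index (S\<^sup>T *\<^sub>v y) i = (\<Sum>j<m. S\<^sup>T $$ (i, j) * vec_index y j)"
    by (rule mult_mat_vec_index_sum[of _ n m]) (use assms in simp_all)
  also have "\<dots> = (\<Sum>j<m. if i = j then \<sigma> (i + 1) * vec_index y j else 0)"
    using assms by (intro sum.cong) auto
  finally show ?thesis using assms mn by (simp add: sg_def)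
qed

lemma left_coords:
  assumes x: "x \<in> carrier_vec n" and i: "i < m"
  shows "vec_index (U\<^sup>T *\<^sub>v (A *\<^sub>v x)) i = (if i < n then sg i * vec_index (V\<^sup>T *\<^sub>v x) i else 0)"
proof -
  have c: "V\<^sup>T *\<^sub>v x \<in> carrier_vec n" using V x by simp
  have c': "S *\<^sub>v (V\<^sup>T *\<^sub>v x) \<in> carrier_vec m"
    by (rule mult_mat_vec_carrier[OF _ c]) simp
  have "A *\<^sub>v x = (U * S) *\<^sub>v (V\<^sup>T *\<^sub>v x)"
    unfolding svd by (rule assoc_mult_mat_vec[of _ m n _ n]) (use U V x in auto)
  also have "\<dots> = U *\<^sub>v (S *\<^sub>v (V\<^sup>T *\<^sub>v x))"
    by (rule assoc_mult_mat_vec[of _ m m _ n]) (use U c in simp_all)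
  finally have "U\<^sup>T *\<^sub>v (A *\<^sub>v x) = U\<^sup>T *\<^sub>v (U *\<^sub>v (S *\<^sub>v (V\<^sup>T *\<^sub>v x)))"
    by simp
  also have "\<dots> = (U\<^sup>T * U) *\<^sub>v (S *\<^sub>v (V\<^sup>T *\<^sub>v x))"
    by (rule assoc_mult_mat_vec[OF _ U(1) c', symmetric]) (use U in simp)
  also have "\<dots> = S *\<^sub>v (V\<^sup>T *\<^sub>v x)"
    unfolding U(2) using c' by (rule one_mult_mat_vec)
  finally show ?thesis using S_mult[OF c i] by simp
qed

lemma right_coords:
  assumes u: "u \<in> carrier_vec m" and i: "i < n"
  shows "vec_index (V\<^sup>T *\<^sub>v (A\<^sup>T *\<^sub>v u)) i = sg i * vec_index (U\<^sup>T *\<^sub>v u) i"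
proof -
  have c: "U\<^sup>T *\<^sub>v u \<in> carrier_vec m" using U u by simp
  have c': "S\<^sup>T *\<^sub>v (U\<^sup>T *\<^sub>v u) \<in> carrier_vec n"
    by (rule mult_mat_vec_carrier[OF _ c]) simp
  have "A\<^sup>T = V * (S\<^sup>T * U\<^sup>T)"
  proof -
    have "A\<^sup>T = transpose_mat (V\<^sup>T) * transpose_mat (U * S)"
      unfolding svd by (rule transpose_mult[of _ m n _ n]) (use U V in auto)
    also have "transpose_mat (U * S) = S\<^sup>T * U\<^sup>T"
      by (rule transpose_mult[of _ m m _ n]) (use U in simp_all)
    finally show ?thesis by simp
  qed
  then have "A\<^sup>T *\<^sub>v u = V *\<^sub>v ((S\<^sup>T * U\<^sup>T) *\<^sub>v u)"
    by (simp only:) (rule assoc_mult_mat_vec[of _ n n _ m], use U V u in auto)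
  also have "(S\<^sup>T * U\<^sup>T) *\<^sub>v u = S\<^sup>T *\<^sub>v (U\<^sup>T *\<^sub>v u)"
    by (rule assoc_mult_mat_vec[of _ n m _ m]) (use U u in auto)
  finally have "V\<^sup>T *\<^sub>v (A\<^sup>T *\<^sub>v u) =
      V\<^sup>T *\<^sub>v (V *\<^sub>v (S\<^sup>T *\<^sub>v (U\<^sup>T *\<^sub>v u)))"
    by simp
  also have "\<dots> = (V\<^sup>T * V) *\<^sub>v (S\<^sup>T *\<^sub>v (U\<^sup>T *\<^sub>v u))"
    by (rule assoc_mult_mat_vec[OF _ V(1) c', symmetric]) (use V in simp)
  also have "\<dots> = S\<^sup>T *\<^sub>v (U\<^sup>T *\<^sub>v u)"
    unfolding V(2) using c' by (rule one_mult_mat_vec)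
  finally show ?thesis using S_transpose_mult[OF c i] by simp
qed

text \<open>Each factor \<open>A\<close> or \<open>A\<^sup>T\<close> contributes one
  \<open>sg i\<close>. A further \<open>A\<^sup>T * A\<close> acts first and replaces
  \<open>u\<close> by \<open>A (A\<^sup>T u)\<close>, so the induction keeps \<open>u\<close>
  arbitrary.\<close>

lemma power_coords:
  assumes "u \<in> carrier_vec m" and i: "i < n"
  shows "vec_index (V\<^sup>T *\<^sub>v ((A\<^sup>T * A) ^\<^sub>m q *\<^sub>v (A\<^sup>T *\<^sub>v u))) i =
    sg i ^ (2 * q + 1) * vec_index (U\<^sup>T *\<^sub>v u) i"
  using assms(1)
proof (induction q arbitrary: u)
  case 0
  have "A\<^sup>T *\<^sub>v u \<in> carrier_vec n" using A 0 by simp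
  then show ?case using right_coords[OF 0 i] A by simp
next
  case (Suc q)
  let ?K = "A\<^sup>T * A"
  have K: "?K \<in> carrier_mat n n" using A by simp
  have c: "A\<^sup>T *\<^sub>v u \<in> carrier_vec n" using A Suc.prems by simp
  have u': "A *\<^sub>v (A\<^sup>T *\<^sub>v u) \<in> carrier_vec m" by (rule mult_mat_vec_carrier[OF A c])
  have "?K ^\<^sub>m Suc q *\<^sub>v (A\<^sup>T *\<^sub>v u) = ?K ^\<^sub>m q *\<^sub>v (?K *\<^sub>v (A\<^sup>T *\<^sub>v u))"
    unfolding pow_mat.simps by (rule assoc_mult_mat_vec[of _ n n _ n]) (use K c in simp_all)
  also have "?K *\<^sub>v (A\<^sup>T *\<^sub>v u) = A\<^sup>T *\<^sub>v (A *\<^sub>v (A\<^sup>T *\<^sub>v u))"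
    by (rule assoc_mult_mat_vec[OF _ A c]) (use A in simp)
  finally have "vec_index (V\<^sup>T *\<^sub>v (?K ^\<^sub>m Suc q *\<^sub>v (A\<^sup>T *\<^sub>v u))) i =
      sg i ^ (2 * q + 1) * vec_index (U\<^sup>T *\<^sub>v (A *\<^sub>v (A\<^sup>T *\<^sub>v u))) i"
    using Suc.IH[OF u'] by (simp only:)
  also have "vec_index (U\<^sup>T *\<^sub>v (A *\<^sub>v (A\<^sup>T *\<^sub>v u))) i =
      sg i * (sg i * vec_index (U\<^sup>T *\<^sub>v u) i)"
    using i mn left_coords[OF c, of i] right_coords[OF Suc.prems i] by simp
  finally show ?case by simp
qed

text \<open>The entries of \<open>U\<^sup>T \<Phi>\<close>: the rows below \<open>k\<close> form
  \<open>\<Phi>\<^sub>1\<close>, the others \<open>\<Phi>\<^sub>2\<close>.\<close>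

definition rot :: "nat \<Rightarrow> (nat \<times> nat \<Rightarrow> real) \<Rightarrow> nat \<times> nat \<Rightarrow> real" where
  "rot d = lin_map ({..<m} \<times> {..<d}) (col_block (\<lambda>i j. U $$ (j, i)))"

lemma rot_coords:
  assumes i: "i < m"
  shows "vec_index (U\<^sup>T *\<^sub>v (gauss_mat m d \<omega> *\<^sub>v vec d z)) i = (\<Sum>l<d. rot d \<omega> (i, l) * z l)"
proof -
  have G: "gauss_mat m d \<omega> \<in> carrier_mat m d" by (simp add: gauss_mat_def)
  have c: "gauss_mat m d \<omega> *\<^sub>v vec d z \<in> carrier_vec m" by (rule mult_mat_vec_carrier[OF G]) simp
  have "vec_index (U\<^sup>T *\<^sub>v (gauss_mat m d \<omega> *\<^sub>v vec d z)) i =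
      (\<Sum>j<m. U\<^sup>T $$ (i, j) * vec_index (gauss_mat m d \<omega> *\<^sub>v vec d z) j)"
    by (rule mult_mat_vec_index_sum[OF _ c i]) (use U in simp)
  also have "\<dots> = (\<Sum>j<m. \<Sum>l<d. U $$ (j, i) * \<omega> (j, l) * z l)"
  proof (rule sum.cong[OF refl])
    fix j assume j: "j \<in> {..<m}"
    have "vec_index (gauss_mat m d \<omega> *\<^sub>v vec d z) j = (\<Sum>l<d. gauss_mat m d \<omega> $$ (j, l) * vec_index (vec d z) l)"
      by (rule mult_mat_vec_index_sum[OF G]) (use j in simp_all)
    also have "\<dots> = (\<Sum>l<d. \<omega> (j, l) * z l)"
      using j by (intro sum.cong) (auto simp: gauss_mat_def)
    finally show "U\<^sup>T $$ (i, j) * vec_index (gauss_mat m d \<omega> *\<^sub>v vec d z) j =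
        (\<Sum>l<d. U $$ (j, i) * \<omega> (j, l) * z l)"
      using i j U(1) by (simp add: sum_distrib_left mult.assoc)
  qed
  also have "\<dots> = (\<Sum>l<d. \<Sum>j<m. U $$ (j, i) * \<omega> (j, l) * z l)"
    by (rule sum.swap)
  also have "\<dots> = (\<Sum>l<d. rot d \<omega> (i, l) * z l)"
    using i by (intro sum.cong) (auto simp: rot_def lin_map_col_block sum_distrib_right)
  finally show ?thesis .
qed

lemma orth_on_U: "orth_on {..<m} (\<lambda>i j. U $$ (j, i))"
proof -
  have "(\<Sum>i<m. U $$ (k, i) * U $$ (l, i)) = (if k = l then 1 else 0)" if kl: "k < m" "l < m" for k l
  proof -
    have c: "U\<^sup>T \<in> carrier_mat m m" using U by simp
    have "(\<Sum>i<m. U $$ (k, i) * U $$ (l, i)) = (\<Sum>i<m. U $$ (k, i) * U\<^sup>T $$ (i, l))"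
      using kl U(1) by (intro sum.cong) auto
    also have "\<dots> = (U * U\<^sup>T) $$ (k, l)"
      by (rule mult_mat_index_sum[OF U(1) c kl, symmetric])
    finally show ?thesis
      unfolding orthogonal_transpose[OF U] using kl by simp
  qed
  then show ?thesis by (simp add: orth_on_def)
qed

lemma nn_integral_gauss_rot:
  assumes "f \<in> borel_measurable (gauss ({..<m} \<times> {..<d}))"
  shows "(\<integral>\<^sup>+\<omega>. f (rot d \<omega>) \<partial>gauss ({..<m} \<times> {..<d})) = (\<integral>\<^sup>+\<omega>. f \<omega> \<partial>gauss ({..<m} \<times> {..<d}))"
  unfolding rot_def
  by (rule nn_integral_gauss_orth) (use assms orth_on_col_block[OF _ _ orth_on_U] in \<open>auto simp: measurable_gauss_eq\<close>)

lemma measurable_rot: "rot d \<in> measurable (gauss ({..<m} \<times> {..<d})) (gauss ({..<m} \<times> {..<d}))"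
  using measurable_lin_map[of "{..<m} \<times> {..<d}" "col_block (\<lambda>i j. U $$ (j, i))"]
    measurable_cong_sets[OF sets_gauss sets_gauss] unfolding rot_def by blast

text \<open>\<open>rot\<close> preserves the measure and the Gram matrix reads the first
  \<open>k\<close> rows only, so the claim comes down to
  \<open>AE_gauss_gram_det_nonzero\<close>.\<close>

lemma AE_rot_gram_det_nonzero:
  assumes "k \<le> d" "k \<le> m"
  shows "AE \<omega> in gauss ({..<m} \<times> {..<d}). Determinant.det (gram k d (rot d \<omega>)) \<noteq> 0"
proof -
  let ?I = "{..<m} \<times> {..<d}" and ?J = "{..<k} \<times> {..<d}"
  let ?f = "\<lambda>G. indicator {0} (Determinant.det (gram k d G)) :: ennreal"
  have sub: "?J \<subseteq> ?I" using assms by auto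
  have fI: "?f \<in> borel_measurable (gauss ?I)" and fJ: "?f \<in> borel_measurable (borels ?J)"
    unfolding measurable_gauss_eq using borel_measurable_gram_det[OF sub] borel_measurable_gram_det[OF order_refl, of k d]
    by simp_all
  have "(\<integral>\<^sup>+\<omega>. ?f (rot d \<omega>) \<partial>gauss ?I) = (\<integral>\<^sup>+\<omega>. ?f \<omega> \<partial>gauss ?I)"
    by (rule nn_integral_gauss_rot[OF fI])
  also have "\<dots> = (\<integral>\<^sup>+\<omega>. ?f (restrict \<omega> ?J) \<partial>gauss ?I)"
  proof (intro nn_integral_cong arg_cong[where f = "\<lambda>x. indicator {0} (Determinant.det x)"] gram_cong)
    fix \<omega> :: "nat \<times> nat \<Rightarrow> real" and i l assume "i < k" "l < d"
    then show "\<omega> (i, l) = restrict \<omega> ?J (i, l)" by simp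
  qed
  also have "\<dots> = (\<integral>\<^sup>+\<omega>. ?f \<omega> \<partial>gauss ?J)"
    by (rule nn_integral_gauss_restrict[OF _ sub fJ]) simp
  also have "\<dots> = (\<integral>\<^sup>+\<omega>. 0 \<partial>gauss ?J)"
    using AE_gauss_gram_det_nonzero[OF assms(1)]
    by (intro nn_integral_cong_AE) (auto elim!: eventually_mono)
  finally have "(\<integral>\<^sup>+\<omega>. ?f (rot d \<omega>) \<partial>gauss ?I) = 0" by simp
  then have "AE \<omega> in gauss ?I. ?f (rot d \<omega>) = 0"
    by (subst (asm) nn_integral_0_iff_AE) (use measurable_compose[OF measurable_rot fI] in auto)
  then show ?thesis
    by eventually_elim (auto simp: indicator_def split: if_splits)
qed

text \<open>The exponents count factors: \<open>(A\<^sup>T A)\<^sup>q A\<^sup>T\<close> has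
  \<open>2 * q + 1\<close> of them, and \<open>Q\<close> comes from one more multiplication by
  \<open>A\<close>. The witnesses for \<open>range\<close> arise by multiplication, never by
  inverting a triangular factor.\<close>

lemma residual_instances:
  assumes alg: "ru_qlp A q (gauss_mat m d \<omega>) Pbar Q R Ptil Rtil P L"
    and det: "Determinant.det (gram k d (rot d \<omega>)) \<noteq> 0"
    and k: "1 \<le> k" "k < n" "\<sigma> k > 0"
    and sorted: "\<And>i j. 1 \<le> i \<Longrightarrow> i \<le> j \<Longrightarrow> j \<le> n \<Longrightarrow> \<sigma> j \<le> \<sigma> i"
    and nonneg: "\<And>i. 1 \<le> i \<Longrightarrow> i \<le> n \<Longrightarrow> 0 \<le> \<sigma> i"
  shows "residual A U V Q sg (rot d \<omega>) m n d k m (2 * q + 2) (\<sigma> k) (\<sigma> (k + 1))"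
    and "residual (A\<^sup>T) V U P sg (rot d \<omega>) n m d k m (2 * q + 1) (\<sigma> k) (\<sigma> (k + 1))"
    and "P \<in> carrier_mat n d"
proof -
  let ?Phi = "gauss_mat m d \<omega>"
  let ?Y = "(A\<^sup>T * A) ^\<^sub>m q * A\<^sup>T * ?Phi"
  have Phi: "?Phi \<in> carrier_mat m d" by (simp add: gauss_mat_def)
  have dims: "dim_row A = m" "dim_col A = n" "dim_col ?Phi = d" using A Phi by auto
  note alg' = alg[unfolded ru_qlp_def Let_def dims]
  have Pbar: "Pbar \<in> carrier_mat n d" "Pbar\<^sup>T * Pbar = 1\<^sub>m d"
    and cs: "col_space Pbar = col_space ?Y"
    and Q: "Q \<in> carrier_mat m d" "Q\<^sup>T * Q = 1\<^sub>m d"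
    and R: "R \<in> carrier_mat d d" and AP: "A * Pbar = Q * R"
    and Ptil: "Ptil \<in> carrier_mat d d" "Ptil\<^sup>T * Ptil = 1\<^sub>m d"
    and P: "P = Pbar * Ptil"
    using alg' by (auto simp: orthonormal_cols_def)
  have K: "(A\<^sup>T * A) ^\<^sub>m q \<in> carrier_mat n n" using A by (intro pow_carrier_mat) simp
  have Yv: "?Y *\<^sub>v vec d z = (A\<^sup>T * A) ^\<^sub>m q *\<^sub>v (A\<^sup>T *\<^sub>v (?Phi *\<^sub>v vec d z))" for z
  proof -
    have "?Y *\<^sub>v vec d z = ((A\<^sup>T * A) ^\<^sub>m q * A\<^sup>T) *\<^sub>v (?Phi *\<^sub>v vec d z)"
      by (rule assoc_mult_mat_vec[of _ n m _ d]) (use A K Phi in auto)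
    also have "\<dots> = (A\<^sup>T * A) ^\<^sub>m q *\<^sub>v (A\<^sup>T *\<^sub>v (?Phi *\<^sub>v vec d z))"
      by (rule assoc_mult_mat_vec[OF K]) (use A Phi in \<open>auto intro!: mult_mat_vec_carrier[OF Phi]\<close>)
    finally show ?thesis .
  qed
  have Phiv: "?Phi *\<^sub>v vec d z \<in> carrier_vec m" for z by (rule mult_mat_vec_carrier[OF Phi]) simp
  have ex: "\<exists>w\<in>carrier_vec d. Pbar *\<^sub>v w = ?Y *\<^sub>v vec d z" for z
  proof -
    have "?Y *\<^sub>v vec d z \<in> col_space ?Y"
      unfolding col_space_def using Phi by auto
    then have "?Y *\<^sub>v vec d z \<in> col_space Pbar" using cs by simp
    then show ?thesis unfolding col_space_def using Pbar(1) by auto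
  qed
  have VY: "vec_index (V\<^sup>T *\<^sub>v (?Y *\<^sub>v vec d z)) i = sg i ^ (2 * q + 1) * (\<Sum>l<d. rot d \<omega> (i, l) * z l)"
    if "i < n" for z i
    unfolding Yv power_coords[OF Phiv that] using rot_coords[of i d \<omega> z] that mn by simp
  have Yc: "?Y *\<^sub>v vec d z \<in> carrier_vec n" for z
    unfolding Yv by (rule mult_mat_vec_carrier[OF K]) (use A Phiv in auto)
  have sg0: "0 \<le> sg i" for i using nonneg[of "i + 1"] by (simp add: sg_def)
  have sg1: "\<sigma> k \<le> sg i" if "i < k" for i using sorted[of "i + 1" k] that k by (simp add: sg_def)
  have sg2: "sg i \<le> \<sigma> (k + 1)" if "k \<le> i" for i
    using sorted[of "k + 1" "i + 1"] nonneg[of "k + 1"] that k by (simp add: sg_def)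
  have s1: "0 \<le> \<sigma> (k + 1)" using nonneg[of "k + 1"] k by simp
  have dim_le: "1 \<le> 2 * q + 2" "1 \<le> 2 * q + 1" "k \<le> m" "k \<le> n" "m \<le> m" "n \<le> m" "0 < m" "0 < n"
    using k mn by simp_all
  have At: "A\<^sup>T \<in> carrier_mat n m" using A by simp
  show "residual A U V Q sg (rot d \<omega>) m n d k m (2 * q + 2) (\<sigma> k) (\<sigma> (k + 1))"
  proof
    fix z
    obtain w where w: "w \<in> carrier_vec d" "Pbar *\<^sub>v w = ?Y *\<^sub>v vec d z" using ex by blast
    have Rw: "R *\<^sub>v w \<in> carrier_vec d" by (rule mult_mat_vec_carrier[OF R w(1)])
    \<comment> \<open>The relation \<open>A * Pbar = Q * R\<close> supplies the preimage
      \<open>R w\<close> under \<open>Q\<close>.\<close>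
    have "Q *\<^sub>v (R *\<^sub>v w) = (Q * R) *\<^sub>v w"
      by (rule assoc_mult_mat_vec[OF Q(1) R w(1), symmetric])
    also have "\<dots> = A *\<^sub>v (Pbar *\<^sub>v w)"
      unfolding AP[symmetric] by (rule assoc_mult_mat_vec[OF A Pbar(1) w(1)])
    finally have QR: "Q *\<^sub>v (R *\<^sub>v w) = A *\<^sub>v (?Y *\<^sub>v vec d z)" unfolding w(2) .
    have "vec_index (U\<^sup>T *\<^sub>v (Q *\<^sub>v (R *\<^sub>v w))) i = sg i ^ (2 * q + 2) * (\<Sum>l<d. rot d \<omega> (i, l) * z l)"
      if i: "i < m" for i
    proof (cases "i < n")
      case True
      then show ?thesis unfolding QR left_coords[OF Yc i] using VY[OF True] by simp
    next
      case False
      then show ?thesis unfolding QR left_coords[OF Yc i] by (simp add: sg_def)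
    qed
    then show "\<exists>w\<in>carrier_vec d. \<forall>i<m. vec_index (U\<^sup>T *\<^sub>v (Q *\<^sub>v w)) i =
        sg i ^ (2 * q + 2) * (\<Sum>l<d. rot d \<omega> (i, l) * z l)"
      using Rw by blast
  qed (assumption | rule A U V Q left_coords sg0 sg1 sg2 s1 det dim_le k(3))+
  have PtilT: "Ptil * Ptil\<^sup>T = 1\<^sub>m d" by (rule orthogonal_transpose[OF Ptil])
  show Pc: "P \<in> carrier_mat n d" unfolding P using Pbar Ptil by simp
  have PP: "P\<^sup>T * P = 1\<^sub>m d"
  proof -
    have "P\<^sup>T * P = Ptil\<^sup>T * (Pbar\<^sup>T * (Pbar * Ptil))"
      unfolding P transpose_mult[OF Pbar(1) Ptil(1)]
      by (rule assoc_mult_mat[of _ d d _ n _ d]) (use Pbar Ptil in auto)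
    also have "Pbar\<^sup>T * (Pbar * Ptil) = (Pbar\<^sup>T * Pbar) * Ptil"
      by (rule assoc_mult_mat[of _ d n _ d _ d, symmetric]) (use Pbar Ptil in auto)
    also have "\<dots> = Ptil" using Pbar Ptil by simp
    finally show ?thesis using Ptil by simp
  qed
  show "residual (A\<^sup>T) V U P sg (rot d \<omega>) n m d k m (2 * q + 1) (\<sigma> k) (\<sigma> (k + 1))"
  proof
    fix z
    obtain w where w: "w \<in> carrier_vec d" "Pbar *\<^sub>v w = ?Y *\<^sub>v vec d z" using ex by blast
    \<comment> \<open>\<open>Ptil\<close> is square, so \<open>P * Ptil\<^sup>T = Pbar\<close>, and
      \<open>Ptil\<^sup>T w\<close> is the preimage under \<open>P\<close>.\<close>
    have c: "Ptil\<^sup>T *\<^sub>v w \<in> carrier_vec d" using Ptil w by simp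
    have "P *\<^sub>v (Ptil\<^sup>T *\<^sub>v w) = Pbar *\<^sub>v (Ptil *\<^sub>v (Ptil\<^sup>T *\<^sub>v w))"
      unfolding P by (rule assoc_mult_mat_vec[OF Pbar(1) Ptil(1) c])
    also have "Ptil *\<^sub>v (Ptil\<^sup>T *\<^sub>v w) = (Ptil * Ptil\<^sup>T) *\<^sub>v w"
      by (rule assoc_mult_mat_vec[OF Ptil(1) _ w(1), symmetric]) (use Ptil in simp)
    also have "\<dots> = w" unfolding PtilT using w by simp
    finally have "P *\<^sub>v (Ptil\<^sup>T *\<^sub>v w) = ?Y *\<^sub>v vec d z" unfolding w(2) .
    then show "\<exists>w\<in>carrier_vec d. \<forall>i<n. vec_index (V\<^sup>T *\<^sub>v (P *\<^sub>v w)) i =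
        sg i ^ (2 * q + 1) * (\<Sum>l<d. rot d \<omega> (i, l) * z l)"
      using c VY by (intro bexI[of _ "Ptil\<^sup>T *\<^sub>v w"]) simp_all
  next
    fix x :: "real vec" and i assume "x \<in> carrier_vec m" "i < n"
    then show "vec_index (V\<^sup>T *\<^sub>v (A\<^sup>T *\<^sub>v x)) i =
        (if i < m then sg i * vec_index (U\<^sup>T *\<^sub>v x) i else 0)"
      using right_coords mn by simp
  qed (assumption | rule At U V Pc PP sg0 sg1 sg2 s1 det dim_le k(3))+
qed

end

text \<open>A function that is not integrable has integral \<open>0\<close>, which \<open>c\<close>
  dominates; otherwise the integral is at most that of the positive part. A majorant thus suffices
  for residual norms whose measurability is unknown.\<close>

lemma integral_le_nn_integral_bound:
  fixes f :: "'a \<Rightarrow> real"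
  assumes "0 \<le> c" "AE x in M. ennreal (f x) \<le> H x" "(\<integral>\<^sup>+x. H x \<partial>M) \<le> ennreal c"
  shows "(\<integral>x. f x \<partial>M) \<le> c"
proof (cases "integrable M f")
  case True
  have "(\<integral>x. f x \<partial>M) = enn2real (\<integral>\<^sup>+x. ennreal (f x) \<partial>M) - enn2real (\<integral>\<^sup>+x. ennreal (- f x) \<partial>M)"
    by (rule real_lebesgue_integral_def[OF True])
  also have "\<dots> \<le> enn2real (\<integral>\<^sup>+x. ennreal (f x) \<partial>M)" by simp
  also have "\<dots> \<le> enn2real (ennreal c)"
    by (intro enn2real_mono order_trans[OF nn_integral_mono_AE[OF assms(2)] assms(3)]) simp
  finally show ?thesis using assms(1) by simp
next
  case False
  then show ?thesis using assms(1) by (simp add: not_integrable_integral_eq)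
qed

text \<open>\<open>H\<close> has a finite mean and is therefore finite almost everywhere, so the
  bound on \<open>f\<close> is asked only where \<open>enn2real\<close> is faithful.\<close>

lemma integral_le_affine:
  fixes f :: "'a \<Rightarrow> real"
  assumes "prob_space M" and abc: "0 \<le> a" "0 \<le> b" "0 \<le> c"
    and H [measurable]: "H \<in> borel_measurable M" and int: "(\<integral>\<^sup>+x. H x \<partial>M) \<le> ennreal c"
    and f: "AE x in M. H x \<noteq> \<infinity> \<longrightarrow> f x \<le> a + b * enn2real (H x)"
  shows "(\<integral>x. f x \<partial>M) \<le> a + b * c"
proof (rule integral_le_nn_integral_bound)
  interpret prob_space M by fact
  have fin: "AE x in M. H x \<noteq> \<infinity>"
    by (rule nn_integral_PInf_AE[OF H]) (use int in \<open>auto simp: top_unique\<close>)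
  show "0 \<le> a + b * c" using abc by simp
  show "AE x in M. ennreal (f x) \<le> ennreal a + ennreal b * H x"
    using f fin
  proof eventually_elim
    case (elim x)
    obtain y where y: "H x = ennreal y" "0 \<le> y" using elim(2) by (cases "H x") auto
    have "ennreal (f x) \<le> ennreal (a + b * y)"
      using elim y by (intro ennreal_leI) simp
    then show ?case using abc y by (simp add: ennreal_mult)
  qed
  have "(\<integral>\<^sup>+x. ennreal a + ennreal b * H x \<partial>M) = ennreal a + ennreal b * (\<integral>\<^sup>+x. H x \<partial>M)"
    by (subst nn_integral_add) (auto simp: nn_integral_cmult emeasure_space_1)
  also have "\<dots> \<le> ennreal a + ennreal b * ennreal c"
    by (intro add_left_mono mult_left_mono int) auto
  also have "\<dots> = ennreal (a + b * c)"
    using abc by (simp add: ennreal_mult)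
  finally show "(\<integral>\<^sup>+x. ennreal a + ennreal b * H x \<partial>M) \<le> ennreal (a + b * c)" .
qed

theorem theorem10:
  fixes A U V :: "real mat" and \<sigma> :: "nat \<Rightarrow> real" and m n k p q :: nat
    and Pbar Q R Ptil Rtil P L :: "((nat \<times> nat) \<Rightarrow> real) \<Rightarrow> real mat"
  assumes mn: "m \<ge> n"
    and A: "A \<in> carrier_mat m n"
    and U: "U \<in> carrier_mat m m" "transpose_mat U * U = 1\<^sub>m m"
    and V: "V \<in> carrier_mat n n" "transpose_mat V * V = 1\<^sub>m n"
    and svd: "A = U * mat m n (\<lambda>(i,j). if i = j then \<sigma> (i+1) else 0) * transpose_mat V"
    and sorted: "\<And>i j. 1 \<le> i \<Longrightarrow> i \<le> j \<Longrightarrow> j \<le> n \<Longrightarrow> \<sigma> j \<le> \<sigma> i"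
    and nonneg: "\<And>i. 1 \<le> i \<Longrightarrow> i \<le> n \<Longrightarrow> 0 \<le> \<sigma> i"
    and k: "k \<ge> 1" "\<sigma> k > 0"
    and p: "p \<ge> 2" "k + p < n"
    and alg: "AE \<omega> in gauss_space m (k+p).
               ru_qlp A q (gauss_mat m (k+p) \<omega>) (Pbar \<omega>) (Q \<omega>) (R \<omega>) (Ptil \<omega>) (Rtil \<omega>) (P \<omega>) (L \<omega>)"
  defines "C \<equiv> sqrt (real k / (real p - 1)) + exp 1 * sqrt (real (m - k) * real (k + p)) / real p"
    and "\<delta> \<equiv> \<sigma> (k+1) / \<sigma> k"
    and "SF \<equiv> sqrt (\<Sum>i\<in>{k+1..n}. (\<sigma> i)\<^sup>2)"
  shows
    "(\<integral>\<omega>. spec_norm (A - Q \<omega> * transpose_mat (Q \<omega>) * A) \<partial>gauss_space m (k+p))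
        \<le> (1 + C * \<delta> ^ (2*q+1)) * \<sigma> (k+1) \<and>
     (\<integral>\<omega>. frob_norm (A - Q \<omega> * transpose_mat (Q \<omega>) * A) \<partial>gauss_space m (k+p))
        \<le> (1 + C * \<delta> ^ (2*q+1)) * SF \<and>
     (\<integral>\<omega>. spec_norm (A - A * P \<omega> * transpose_mat (P \<omega>)) \<partial>gauss_space m (k+p))
        \<le> (1 + C * \<delta> ^ (2*q)) * \<sigma> (k+1) \<and>
     (\<integral>\<omega>. frob_norm (A - A * P \<omega> * transpose_mat (P \<omega>)) \<partial>gauss_space m (k+p))
        \<le> (1 + C * \<delta> ^ (2*q)) * SF"

proof -
  interpret svd_setting A U V \<sigma> m n
    by unfold_locales (use mn A U V svd in auto)
  let ?d = "k + p"
  let ?M = "gauss ({..<m} \<times> {..<?d})"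
  let ?s1 = "\<sigma> (k + 1)"
  have M: "gauss_space m ?d = ?M"
    by (simp add: gauss_space_def gauss_def lessThan_atLeast0)
  interpret prob_space ?M by (rule prob_space_gauss)
  have kn: "k < n" "k \<le> m" "k + p < m" "n > 0" "m > 0" using p mn by auto
  have s1: "0 \<le> ?s1" using nonneg[of "k + 1"] kn by simp
  have \<delta>0: "0 \<le> \<delta>" unfolding \<delta>_def using s1 k by simp
  have root0: "0 < sqrt (real k / (real p - 1))" using k p by simp
  have C0: "0 < C" unfolding C_def using root0 by (intro add_pos_nonneg) auto
  \<comment> \<open>The sum over \<open>k + 1\<close> to \<open>n\<close> becomes one over
    \<open>k\<close> to \<open>m - 1\<close>: the index shifts by one, and \<open>sg\<close>
    vanishes from \<open>n\<close> on.\<close>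
  have SF: "SF = sqrt (\<Sum>i\<in>{k..<m}. (sg i)\<^sup>2)"
  proof -
    have "(\<Sum>i\<in>{k..<m}. (sg i)\<^sup>2) = (\<Sum>i\<in>{k..<n}. (sg i)\<^sup>2)"
      by (rule sum.mono_neutral_right) (use mn in \<open>auto simp: sg_def\<close>)
    also have "\<dots> = (\<Sum>i\<in>{k..<n}. (\<sigma> (Suc i))\<^sup>2)"
      by (intro sum.cong) (auto simp: sg_def)
    also have "\<dots> = (\<Sum>i\<in>{Suc k..<Suc n}. (\<sigma> i)\<^sup>2)"
      by (rule sum.shift_bounds_Suc_ivl[symmetric])
    also have "{Suc k..<Suc n} = {k + 1..n}" by auto
    finally show ?thesis by (simp add: SF_def)
  qed
  have SF0: "0 \<le> SF" unfolding SF by (simp add: sum_nonneg)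
  obtain N where N: "N \<in> borel_measurable ?M" "(\<integral>\<^sup>+G. N G \<partial>?M) \<le> ennreal C"
    "\<And>G v. ennreal (sqrt (\<Sum>i\<in>{k..<m}. (tail k ?d G v i)\<^sup>2)) \<le> N G * ennreal (sqrt (\<Sum>j<k. (v j)\<^sup>2))"
    by (rule ex_tail_opnorm_bound[OF k(1) p(1) kn(3), folded C_def]) (rule that, assumption+)
  \<comment> \<open>The majorants are evaluated at \<open>U\<^sup>T \<Phi>\<close>, which has the
    same law as \<open>\<Phi>\<close>.\<close>
  have Nrot [measurable]: "(\<lambda>\<omega>. N (rot ?d \<omega>)) \<in> borel_measurable ?M"
    by (rule measurable_compose[OF measurable_rot N(1)])
  have Nint: "(\<integral>\<^sup>+\<omega>. N (rot ?d \<omega>) \<partial>?M) \<le> ennreal C"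
    unfolding nn_integral_gauss_rot[OF N(1)] by (rule N(2))
  define Y where "Y G = sqrt (\<Sum>j<k. \<Sum>i\<in>{k..<m}. (sg i * tail k ?d G (\<lambda>j'. if j' = j then 1 else 0) i)\<^sup>2)" for G
  have Y0: "0 \<le> Y G" for G by (simp add: Y_def sum_nonneg)
  have tm: "(\<lambda>G. tail k ?d G (\<lambda>j'. if j' = j then 1 else 0) i) \<in> borel_measurable ?M" if "i \<in> {k..<m}" for i j
    unfolding measurable_gauss_eq using kn that
    by (intro borel_measurable_tail[where g = "\<lambda>x. x" and I = "{..<m} \<times> {..<?d}"]) auto
  have Ym: "(\<lambda>G. ennreal (Y G)) \<in> borel_measurable ?M"
    unfolding Y_def
    by (intro measurable_compose[OF _ measurable_ennreal] measurable_compose[OF _ borel_measurable_sqrt]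
        borel_measurable_sum borel_measurable_power borel_measurable_times borel_measurable_const tm)
  have Yrot [measurable]: "(\<lambda>\<omega>. ennreal (Y (rot ?d \<omega>))) \<in> borel_measurable ?M"
    by (rule measurable_compose[OF measurable_rot Ym])
  \<comment> \<open>Only the first summand of \<open>C\<close> enters the Frobenius bound; it is
    enlarged to \<open>C\<close> at the end.\<close>
  have Yint: "(\<integral>\<^sup>+\<omega>. ennreal (Y (rot ?d \<omega>)) \<partial>?M) \<le> ennreal (C * SF)"
  proof -
    have "(\<integral>\<^sup>+\<omega>. ennreal (Y (rot ?d \<omega>)) \<partial>?M) = (\<integral>\<^sup>+G. ennreal (Y G) \<partial>?M)"
      by (rule nn_integral_gauss_rot[OF Ym])
    also have "\<dots> \<le> ennreal (sqrt (real k / (real p - 1)) * SF)"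
      unfolding Y_def SF by (rule nn_integral_gauss_tail_frob[OF k(1) p(1) kn(2)])
    also have "\<dots> \<le> ennreal (C * SF)"
      unfolding C_def by (intro ennreal_leI mult_right_mono SF0) auto
    finally show ?thesis .
  qed
  have spec: "(\<integral>\<omega>. f \<omega> \<partial>?M) \<le> (1 + C * \<delta> ^ t) * ?s1"
    if "AE \<omega> in ?M. N (rot ?d \<omega>) \<noteq> \<infinity> \<longrightarrow> f \<omega> \<le> ?s1 * (1 + \<delta> ^ t * enn2real (N (rot ?d \<omega>)))"
    for f :: "_ \<Rightarrow> real" and t
    using integral_le_affine[OF prob_space_gauss s1 _ less_imp_le[OF C0] Nrot Nint, of "?s1 * \<delta> ^ t" f] that s1 \<delta>0
    by (simp add: distrib_left distrib_right mult_ac)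
  have frob: "(\<integral>\<omega>. f \<omega> \<partial>?M) \<le> (1 + C * \<delta> ^ t) * SF"
    if "AE \<omega> in ?M. f \<omega> \<le> SF + \<delta> ^ t * Y (rot ?d \<omega>)" for f :: "_ \<Rightarrow> real" and t
    using integral_le_affine[OF prob_space_gauss SF0 _ _ Yrot Yint, of "\<delta> ^ t" f] that SF0 \<delta>0 C0 Y0
    by (simp add: distrib_left distrib_right mult_ac)
  have pointwise: "AE \<omega> in ?M.
      (N (rot ?d \<omega>) \<noteq> \<infinity> \<longrightarrow>
        spec_norm (A - Q \<omega> * transpose_mat (Q \<omega>) * A) \<le> ?s1 * (1 + \<delta> ^ (2*q+1) * enn2real (N (rot ?d \<omega>))) \<and>
        spec_norm (A - A * P \<omega> * transpose_mat (P \<omega>)) \<le> ?s1 * (1 + \<delta> ^ (2*q) * enn2real (N (rot ?d \<omega>)))) \<and>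
      frob_norm (A - Q \<omega> * transpose_mat (Q \<omega>) * A) \<le> SF + \<delta> ^ (2*q+1) * Y (rot ?d \<omega>) \<and>
      frob_norm (A - A * P \<omega> * transpose_mat (P \<omega>)) \<le> SF + \<delta> ^ (2*q) * Y (rot ?d \<omega>)"
    using alg[unfolded M] AE_rot_gram_det_nonzero[OF le_add1 kn(2), of p]
  proof eventually_elim
    case (elim \<omega>)
    note inst = residual_instances[OF elim(1,2) k(1) kn(1) k(2) sorted nonneg]
    interpret q: residual A U V "Q \<omega>" sg "rot ?d \<omega>" m n ?d k m "2 * q + 2" "\<sigma> k" ?s1
      by (rule inst(1))
    interpret p: residual "A\<^sup>T" V U "P \<omega>" sg "rot ?d \<omega>" n m ?d k m "2 * q + 1" "\<sigma> k" ?s1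
      by (rule inst(2))
    have AP: "A - A * P \<omega> * transpose_mat (P \<omega>) = transpose_mat p.M"
      by (rule transpose_residual[OF A inst(3)])
    \<comment> \<open>The locale bounds contain the exponent \<open>t - 1\<close>; this is where the
      powers of \<open>\<delta>\<close> in the two estimates come from.\<close>
    have e: "2 * q + 2 - 1 = 2 * q + 1" "2 * q + 1 - 1 = 2 * q" by simp_all
    show ?case
    proof (intro conjI impI)
      show "frob_norm (A - Q \<omega> * transpose_mat (Q \<omega>) * A) \<le> SF + \<delta> ^ (2*q+1) * Y (rot ?d \<omega>)"
        using q.frob_le unfolding SF Y_def \<delta>_def e .
      show "frob_norm (A - A * P \<omega> * transpose_mat (P \<omega>)) \<le> SF + \<delta> ^ (2*q) * Y (rot ?d \<omega>)"
        unfolding AP frob_norm_transpose using p.frob_le unfolding SF Y_def \<delta>_def e .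
    next
      define x where "x = enn2real (N (rot ?d \<omega>))"
      assume "N (rot ?d \<omega>) \<noteq> \<infinity>"
      then have x: "N (rot ?d \<omega>) = ennreal x" "0 \<le> x" by (simp_all add: x_def less_top)
      have Nx: "sqrt (\<Sum>i\<in>{k..<m}. (tail k ?d (rot ?d \<omega>) v i)\<^sup>2) \<le> x * sqrt (\<Sum>j<k. (v j)\<^sup>2)" for v
      proof -
        have "ennreal (sqrt (\<Sum>i\<in>{k..<m}. (tail k ?d (rot ?d \<omega>) v i)\<^sup>2)) \<le> ennreal (x * sqrt (\<Sum>j<k. (v j)\<^sup>2))"
          using N(3)[of "rot ?d \<omega>" v] x by (simp add: ennreal_mult sum_nonneg)
        then show ?thesis
          by (subst (asm) ennreal_le_iff) (use x(2) in \<open>auto simp: sum_nonneg\<close>)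
      qed
      show "spec_norm (A - Q \<omega> * transpose_mat (Q \<omega>) * A) \<le> ?s1 * (1 + \<delta> ^ (2*q+1) * enn2real (N (rot ?d \<omega>)))"
        using spec_norm_le[OF q.M_carrier kn(4) q.vnorm2_le[OF x(2) Nx]] unfolding \<delta>_def x_def e .
      have c: "0 \<le> ?s1 * (1 + (?s1 / \<sigma> k) ^ (2 * q + 1 - 1) * x)"
        using s1 x(2) k(2) by simp
      show "spec_norm (A - A * P \<omega> * transpose_mat (P \<omega>)) \<le> ?s1 * (1 + \<delta> ^ (2*q) * enn2real (N (rot ?d \<omega>)))"
        unfolding AP using spec_norm_le[OF transpose_carrier_mat[THEN iffD2, OF p.M_carrier] kn(4) vnorm2_transpose_le[OF p.M_carrier c p.vnorm2_le[OF x(2) Nx]]]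
        unfolding \<delta>_def x_def e .
    qed
  qed
  show ?thesis
    unfolding M
    by (intro conjI spec frob) (use pointwise in \<open>auto elim!: eventually_mono\<close>)
qed

end
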